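(* Let $p \geq 3$ be a prime. For $p \equiv 1, 3 \pmod{8}$, write $p = x^2+2y^2$ with $x, y \in \mathbb{Z}$. Let $\chi_{-4}$ denote the non-principal Dirichlet character modulo $4$. Then for $m \in \mathbb{Z}$, \[ H_{m,8}(p) = \begin{cases} \frac{p+1}{6}+\frac{1}{3}\chi_{-4}(x)x&\text{if }m \equiv 1,7 \pmod{8},\ p \equiv 1,3 \pmod{8},\\ \frac{p+1}{6}&\text{if }m \equiv 1,3,5,7 \pmod{8},\ p \equiv 5,7 \pmod{8},\\ \frac{p+1}{6}-\frac{1}{3}\chi_{-4}(x)x&\text{if }m \equiv 3,5 \pmod{8},\ p \equiv 1,3 \pmod{8}. \end{cases} \]
   Context: For an integer $n>0$ with $n \equiv 0,3 \pmod 4$, the Hurwitz class number $H(n)$ is $\sum_{Q}1/\omega_Q$, where $Q$ runs over $\mathrm{SL}_2(\mathbb{Z})$-equivalence classes of positive definite binary integral quadratic forms of discriminant $-n$, and $\omega_Q = 2$ if $Q$ is equivalent to $a(x^2+y^2)$, $\omega_Q=3$ if $Q$ is equivalent to $a(x^2+xy+y^2)$, and $\omega_Q=1$ otherwise. Also $H(0) = -\frac{1}{12}$ and $H(n)=0$ if $n<0$ or $n \equiv 1,2 \pmod 4$. For $m \in \mathbb{Z}$, $M \in \mathbb{Z}_{\geq 1}$, $n \in \mathbb{Z}_{\geq 0}$, define $H_{m,M}(n) := \sum_{t \in \mathbb{Z},\, t \equiv m \pmod{M}} H(4n-t^2)$. *)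

theory Defs
  imports "HOL-Analysis.Analysis" "HOL-Number_Theory.Number_Theory"
begin

text \<open>The triple \<open>(a, b, c)\<close> stands for the integral form \<open>a x\<^sup>2 + b x y + c y\<^sup>2\<close>
  (not necessarily primitive, \<open>b\<close> not necessarily even).\<close>

type_synonym bqf = "int \<times> int \<times> int"

fun bqf_eval :: "bqf \<Rightarrow> 'a::comm_ring_1 \<Rightarrow> 'a \<Rightarrow> 'a" where
  "bqf_eval (a, b, c) x y = of_int a * x\<^sup>2 + of_int b * x * y + of_int c * y\<^sup>2"

fun bqf_discr :: "bqf \<Rightarrow> int" where
  "bqf_discr (a, b, c) = b\<^sup>2 - 4 * a * c"

definition bqf_pos_def :: "bqf \<Rightarrow> bool" where
  "bqf_pos_def Q \<longleftrightarrow> (\<forall>x y :: real. (x, y) \<noteq> (0, 0) \<longrightarrow> bqf_eval Q x y > 0)"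

definition bqf_equiv :: "(bqf \<times> bqf) set" where
  "bqf_equiv = {(Q, Q'). \<exists>\<alpha> \<beta> \<gamma> \<delta> :: int. \<alpha> * \<delta> - \<beta> * \<gamma> = 1 \<and>
     (\<forall>x y :: int. bqf_eval Q' x y = bqf_eval Q (\<alpha> * x + \<beta> * y) (\<gamma> * x + \<delta> * y))}"

lemma equiv_bqf_equiv: "equiv UNIV bqf_equiv"
proof (rule equivI)
  show "bqf_equiv \<subseteq> UNIV \<times> UNIV" by simp
  show "refl bqf_equiv"
  proof (rule refl_onI)
    fix Q :: bqf
    show "(Q, Q) \<in> bqf_equiv"
      unfolding bqf_equiv_def
      by (simp, rule exI[of _ 1], rule exI[of _ 0], rule exI[of _ 0], rule exI[of _ 1], simp)
  qed
  show "sym bqf_equiv"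
  proof (rule symI)
    fix Q R assume "(Q, R) \<in> bqf_equiv"
    then obtain a b c d :: int where det: "a * d - b * c = 1"
      and R: "\<And>x y. bqf_eval R x y = bqf_eval Q (a * x + b * y) (c * x + d * y)"
      unfolding bqf_equiv_def by blast
    have "bqf_eval Q x y = bqf_eval R (d * x + (- b) * y) ((- c) * x + a * y)" for x y
    proof -
      have "a * (d * x + (- b) * y) + b * ((- c) * x + a * y) = (a * d - b * c) * x"
        "c * (d * x + (- b) * y) + d * ((- c) * x + a * y) = (a * d - b * c) * y"
        by (simp_all add: algebra_simps)
      then show ?thesis by (simp only: R det mult_1_left)
    qed
    moreover have "d * a - (- b) * (- c) = 1" using det by (simp add: algebra_simps)
    ultimately show "(R, Q) \<in> bqf_equiv" unfolding bqf_equiv_def by blast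
  qed
  show "trans bqf_equiv"
  proof (rule transI)
    fix Q R S assume "(Q, R) \<in> bqf_equiv" "(R, S) \<in> bqf_equiv"
    then obtain a b c d a' b' c' d' :: int where
      det: "a * d - b * c = 1" "a' * d' - b' * c' = 1"
      and R: "\<And>x y. bqf_eval R x y = bqf_eval Q (a * x + b * y) (c * x + d * y)"
      and S: "\<And>x y. bqf_eval S x y = bqf_eval R (a' * x + b' * y) (c' * x + d' * y)"
      unfolding bqf_equiv_def by blast
    have "bqf_eval S x y = bqf_eval Q ((a * a' + b * c') * x + (a * b' + b * d') * y)
        ((c * a' + d * c') * x + (c * b' + d * d') * y)" for x y
    proof -
      have "a * (a' * x + b' * y) + b * (c' * x + d' * y) =
          (a * a' + b * c') * x + (a * b' + b * d') * y"
        "c * (a' * x + b' * y) + d * (c' * x + d' * y) =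
          (c * a' + d * c') * x + (c * b' + d * d') * y"
        by (simp_all add: algebra_simps)
      then show ?thesis by (simp only: R S)
    qed
    moreover have "(a * a' + b * c') * (c * b' + d * d') - (a * b' + b * d') * (c * a' + d * c')
        = (a * d - b * c) * (a' * d' - b' * c')"
      by (simp add: algebra_simps)
    then have "(a * a' + b * c') * (c * b' + d * d') - (a * b' + b * d') * (c * a' + d * c') = 1"
      by (simp add: det)
    ultimately show "(Q, S) \<in> bqf_equiv" unfolding bqf_equiv_def by blast
  qed
qed

definition bqf_classes :: "int \<Rightarrow> bqf set set" where
  "bqf_classes n = {Q. bqf_pos_def Q \<and> bqf_discr Q = - n} // bqf_equiv"

text \<open>The weight of a class: a form in \<open>C\<close> is equivalent to \<open>R\<close> iff \<open>R \<in> C\<close>.\<close>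

definition bqf_omega :: "bqf set \<Rightarrow> nat" where
  "bqf_omega C =
    (if \<exists>a. (a, 0, a) \<in> C then 2
     else if \<exists>a. (a, a, a) \<in> C then 3
     else 1)"

definition hurwitz_H :: "int \<Rightarrow> real" where
  "hurwitz_H n =
    (if n > 0 \<and> n mod 4 \<in> {0, 3} then \<Sum>C\<in>bqf_classes n. 1 / real (bqf_omega C)
     else if n = 0 then - 1 / 12
     else 0)"

text \<open>Only finitely many terms of the sum over \<open>t\<close> are nonzero.\<close>

definition hurwitz_H_sum :: "int \<Rightarrow> nat \<Rightarrow> nat \<Rightarrow> real" where
  "hurwitz_H_sum m M n =
    (\<Sum>\<^sub>\<infinity>t\<in>{t. [t = m] (mod int M)}. hurwitz_H (4 * int n - t\<^sup>2))"

lemma hurwitz_H_sum_finite: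
  "hurwitz_H_sum m M n =
    (\<Sum>t | [t = m] (mod int M) \<and> t\<^sup>2 \<le> 4 * int n. hurwitz_H (4 * int n - t\<^sup>2))"
proof -
  have "finite {t. [t = m] (mod int M) \<and> t\<^sup>2 \<le> 4 * int n}"
  proof (rule finite_subset)
    show "{t. [t = m] (mod int M) \<and> t\<^sup>2 \<le> 4 * int n} \<subseteq> {- (4 * int n)..4 * int n}"
    proof clarify
      fix t :: int assume "t\<^sup>2 \<le> 4 * int n"
      moreover have "\<bar>t\<bar> \<le> t\<^sup>2"
        using self_le_power[of "\<bar>t\<bar>" 2] by (cases "t = 0") auto
      ultimately show "t \<in> {- (4 * int n)..4 * int n}" by auto
    qed
  qed simp
  moreover have "hurwitz_H_sum m M n =
    (\<Sum>\<^sub>\<infinity>t\<in>{t. [t = m] (mod int M) \<and> t\<^sup>2 \<le> 4 * int n}. hurwitz_H (4 * int n - t\<^sup>2))"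
    unfolding hurwitz_H_sum_def
    by (rule infsum_cong_neutral) (auto simp: hurwitz_H_def)
  ultimately show ?thesis by simp
qed

definition chi_m4 :: "int \<Rightarrow> int" where
  "chi_m4 x = (if x mod 4 = 1 then 1 else if x mod 4 = 3 then - 1 else 0)"

end

theory Submission
  imports Defs "HOL-Computational_Algebra.Formal_Power_Series"
begin

text \<open>
  For \<open>N \<equiv> 3 (mod 8)\<close>, Selling reduction identifies \<open>3 H(N)\<close> with the number \<open>h(N)\<close> of triples of
  positive odd integers with \<open>A B + B C + C A = N\<close>. A solution of
  \<open>t\<^sup>2 + A B + B C + C A = 4 n\<close> is the same as an integral matrix of determinant \<open>n\<close> and trace \<open>t\<close>
  that is a similitude of the reduced form \<open>(A, B, C)\<close>. If \<open>n\<close> is odd, every sublattice of \<open>\<int>\<^sup>2\<close> of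
  index \<open>n\<close> is the image of exactly one such matrix in each of the two residue classes modulo 2 of
  odd trace: a matrix exists by Brouwer's fixed point theorem applied to the map that reduces a form
  with respect to the sublattice, and it is unique because a reduced form attains its minimum on each
  class modulo 2 only at \<open>\<plusminus>v\<close>. Hence the sum of \<open>h(4 n - t\<^sup>2)\<close> over odd \<open>t\<close> is \<open>2 \<sigma>(n)\<close>.

  On the other hand, an identity of Liouville type computes the logarithmic derivatives of
  \<open>\<phi>(-q) = \<Sum>(-1)\<^sup>i q\<^bsup>i^2\<^esup>\<close> and of \<open>U(q) = \<Sum>(-1)\<^sup>j (2j+1) q\<^bsup>j(j+1)/2\<^esup>\<close>. Together with identities for
  pairs of squares this yields \<open>U(q) = \<phi>(-q)\<^sup>2 \<psi>(q)\<close> and \<open>\<psi>(q)\<^sup>4 = \<Sum>\<sigma>(2n+1) q\<^sup>n\<close>, where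
  \<open>\<psi>(q) = \<Sum>q\<^bsup>j(j+1)/2\<^esup>\<close>. So the generating function of \<open>h(8 n + 3)\<close> is \<open>\<psi>(q)\<^sup>3\<close>, and its product with
  \<open>\<psi>(-q)\<close>, which twists by the quadratic character modulo 8 of \<open>t\<close>, is \<open>\<phi>(q) U(q\<^sup>4)\<close>. The
  coefficients of the latter are the sums of \<open>\<chi>(x) x\<close> over \<open>x\<^sup>2 + 2 y\<^sup>2 = n\<close>.
\<close>

section \<open>Selling-reduced forms\<close>

text \<open>Given a sublattice L, the unknown is the form: some reduced q must have, in a reduced
  basis of L, its own Selling parameters up to a factor. The parameters of q restricted to L are
  determined by the minima of q on the three nonzero classes modulo 2. So they depend continuously
  on q, though not linearly, and a topological fixed point is available. Oddness of n identifies
  L/2L with (Z/2)^2, so that L and Z^2 have the same classes. Odd trace keeps the fixed point away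
  from degenerate forms and excludes orientation-reversing similitudes, whose trace is 0. It also
  makes all parameters odd, hence nonzero; reduction is then unique up to cyclic rotation, which is
  the origin of the factor 3. The end is linear algebra: by t -> -t the residues 1, 7 have equal
  sums, and so have 3, 5; the plain sum over t determines their total and the twisted sum their
  difference.\<close>

definition selling_triples :: "int \<Rightarrow> (int \<times> int \<times> int) set" where
  "selling_triples N = {(A, B, C). odd A \<and> odd B \<and> odd C \<and> A > 0 \<and> B > 0 \<and> C > 0 \<and>
     A * B + B * C + C * A = N}"

text \<open>The symmetric parametrisation of binary forms by Selling: the triple \<open>(A, B, C)\<close> stands for twice
  the form \<open>((A + C) / 2, C, (B + C) / 2)\<close>, whose discriminant is \<open>- (A B + B C + C A)\<close>.\<close>

definition selling_val :: "'a::comm_ring_1 \<times> 'a \<times> 'a \<Rightarrow> 'a \<Rightarrow> 'a \<Rightarrow> 'a" where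
  "selling_val = (\<lambda>(A, B, C) x y. A * x\<^sup>2 + B * y\<^sup>2 + C * (x + y)\<^sup>2)"

lemma selling_val_simp: "selling_val (A, B, C) x y = A * x\<^sup>2 + B * y\<^sup>2 + C * (x + y)\<^sup>2"
  by (simp add: selling_val_def)

lemma selling_triples_pos: "z \<in> selling_triples N \<Longrightarrow> N > 0"
  by (auto simp: selling_triples_def intro!: add_pos_pos)

lemma finite_selling_triples: "finite (selling_triples N)"
proof (rule finite_subset)
  show "selling_triples N \<subseteq> {0..N} \<times> {0..N} \<times> {0..N}"
  proof (clarsimp simp: selling_triples_def)
    fix A B C :: int assume p: "A > 0" "B > 0" "C > 0"
    have "A * 1 \<le> A * B" "B * 1 \<le> B * C" "C * 1 \<le> C * A"
      using p by (intro mult_left_mono; simp)+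
    moreover have "A * B > 0" "B * C > 0" "C * A > 0" using p by simp_all
    ultimately show "A \<le> A * B + B * C + C * A \<and> B \<le> A * B + B * C + C * A \<and> C \<le> A * B + B * C + C * A"
      by linarith
  qed
qed simp

lemma abs_le_square_int: "\<bar>z\<bar> \<le> (z::int)\<^sup>2"
  using self_le_power[of "\<bar>z\<bar>" 2] by (cases "z = 0") auto

lemma finite_square_le: "finite {t::int. t\<^sup>2 \<le> c}"
proof (rule finite_subset)
  show "{t::int. t\<^sup>2 \<le> c} \<subseteq> {- c..c}"
  proof clarify
    fix t :: int assume "t\<^sup>2 \<le> c"
    then show "t \<in> {- c..c}" using abs_le_square_int[of t] by auto
  qed
qed simp

lemma one_le_square_odd:
  fixes x :: int assumes "odd x" shows "1 \<le> x\<^sup>2"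
  using assms by (metis dvd_0_right int_one_le_iff_zero_less zero_less_power2)

lemma odd_square_mod_8:
  fixes i :: int
  assumes "odd i"
  shows "i\<^sup>2 mod 8 = 1"
proof -
  obtain k where k: "i = 2 * k + 1" using assms by (elim oddE)
  obtain m where m: "k * (k + 1) = 2 * m" by (metis even_mult_iff even_plus_one_iff evenE)
  have "i\<^sup>2 = 8 * m + 1" using k m by (simp add: power2_eq_square algebra_simps)
  then show ?thesis by simp
qed

lemma odd_square_eq_one:
  fixes x :: int assumes "odd x" "x\<^sup>2 \<le> 1" shows "x = 1 \<or> x = -1"
  using assms one_le_square_odd[of x] by (auto simp: power2_eq_1_iff)

text \<open>In each nonzero class modulo 2 exactly two of x, y, x + y are odd, so two of the three
  squares are at least 1. The ring is general because both integral triples and the real parameters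
  of a fixed point are estimated this way.\<close>

lemma selling_val_ge:
  fixes A B C :: "'a::linordered_idom" and x y :: int
  assumes "A \<ge> 0" "B \<ge> 0" "C \<ge> 0"
  shows "odd x \<Longrightarrow> even y \<Longrightarrow> A + C \<le> selling_val (A, B, C) (of_int x) (of_int y)"
    and "even x \<Longrightarrow> odd y \<Longrightarrow> B + C \<le> selling_val (A, B, C) (of_int x) (of_int y)"
    and "odd x \<Longrightarrow> odd y \<Longrightarrow> A + B \<le> selling_val (A, B, C) (of_int x) (of_int y)"
proof -
  have ge: "D \<le> D * (of_int z)\<^sup>2" if "odd z" "D \<ge> 0" for D :: 'a and z :: int
  proof -
    have "(1::'a) \<le> of_int (z\<^sup>2)" using one_le_square_odd[OF that(1)] by (metis of_int_1 of_int_le_iff)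
    from mult_left_mono[OF this that(2)] show ?thesis by simp
  qed
  have nn: "0 \<le> D * (of_int z)\<^sup>2" if "D \<ge> 0" for D :: 'a and z :: int using that by simp
  show "odd x \<Longrightarrow> even y \<Longrightarrow> A + C \<le> selling_val (A, B, C) (of_int x) (of_int y)"
    proof -
    assume h: "odd x" "even y"
    have "A \<le> A * (of_int x)\<^sup>2" "C \<le> C * (of_int (x + y))\<^sup>2" "0 \<le> B * (of_int y)\<^sup>2" using assms h ge[of x A] ge[of "x + y" C] nn[of B y] by simp_all
    then show ?thesis unfolding selling_val_simp of_int_add by linarith
  qed
  show "even x \<Longrightarrow> odd y \<Longrightarrow> B + C \<le> selling_val (A, B, C) (of_int x) (of_int y)"
    proof -
    assume h: "even x" "odd y"
    have "B \<le> B * (of_int y)\<^sup>2" "C \<le> C * (of_int (x + y))\<^sup>2" "0 \<le> A * (of_int x)\<^sup>2" using assms h ge[of y B] ge[of "x + y" C] nn[of A x] by simp_all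
    then show ?thesis unfolding selling_val_simp of_int_add by linarith
  qed
  show "odd x \<Longrightarrow> odd y \<Longrightarrow> A + B \<le> selling_val (A, B, C) (of_int x) (of_int y)"
    proof -
    assume h: "odd x" "odd y"
    have "A \<le> A * (of_int x)\<^sup>2" "B \<le> B * (of_int y)\<^sup>2" "0 \<le> C * (of_int (x + y))\<^sup>2" using assms h ge[of x A] ge[of y B] nn[of C "x + y"] by simp_all
    then show ?thesis unfolding selling_val_simp of_int_add by linarith
  qed
qed

text \<open>Equality in the preceding bounds forces the two odd squares to be 1 and the even one to
  be 0, because all coefficients are strictly positive; a vanishing coefficient would admit further
  minimisers.\<close>

lemma selling_val_min_unique:
  fixes A B C x y :: int
  assumes "A > 0" "B > 0" "C > 0"
  shows "odd x \<Longrightarrow> even y \<Longrightarrow> selling_val (A, B, C) x y \<le> A + C \<Longrightarrow> (x = 1 \<or> x = -1) \<and> y = 0"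
    and "even x \<Longrightarrow> odd y \<Longrightarrow> selling_val (A, B, C) x y \<le> B + C \<Longrightarrow> x = 0 \<and> (y = 1 \<or> y = -1)"
    and "odd x \<Longrightarrow> odd y \<Longrightarrow> selling_val (A, B, C) x y \<le> A + B \<Longrightarrow> (x = 1 \<or> x = -1) \<and> y = - x"
proof -
  have ge: "D \<le> D * z\<^sup>2" if "odd z" "D > 0" for D z :: int
    using one_le_square_odd[OF that(1)] that(2) by simp
  have le1: "z\<^sup>2 \<le> 1" if "D * z\<^sup>2 \<le> D" "D > 0" for D z :: int
    using that by (metis mult.right_neutral mult_le_cancel_left_pos)
  have eq0: "z = 0" if "D * z\<^sup>2 \<le> 0" "D > 0" for D z :: int
    using that by (auto simp: mult_le_0_iff)
  show "odd x \<Longrightarrow> even y \<Longrightarrow> selling_val (A, B, C) x y \<le> A + C \<Longrightarrow> (x = 1 \<or> x = -1) \<and> y = 0"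
  proof -
    assume h: "odd x" "even y" "selling_val (A, B, C) x y \<le> A + C"
    have o: "odd (x + y)" using h by simp
    have nn: "0 \<le> B * y\<^sup>2" using assms by simp
    have "A * x\<^sup>2 \<le> A" "B * y\<^sup>2 \<le> 0"
      using h(3) ge[OF h(1), of A] ge[OF o, of C] nn assms unfolding selling_val_simp by linarith+
    then show ?thesis using odd_square_eq_one[OF h(1)] le1[of A x] eq0[of B y] assms by blast
  qed
  show "even x \<Longrightarrow> odd y \<Longrightarrow> selling_val (A, B, C) x y \<le> B + C \<Longrightarrow> x = 0 \<and> (y = 1 \<or> y = -1)"
  proof -
    assume h: "even x" "odd y" "selling_val (A, B, C) x y \<le> B + C"
    have o: "odd (x + y)" using h by simp
    have nn: "0 \<le> A * x\<^sup>2" using assms by simp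
    have "B * y\<^sup>2 \<le> B" "A * x\<^sup>2 \<le> 0"
      using h(3) ge[OF h(2), of B] ge[OF o, of C] nn assms unfolding selling_val_simp by linarith+
    then show ?thesis using odd_square_eq_one[OF h(2)] le1[of B y] eq0[of A x] assms by blast
  qed
  show "odd x \<Longrightarrow> odd y \<Longrightarrow> selling_val (A, B, C) x y \<le> A + B \<Longrightarrow> (x = 1 \<or> x = -1) \<and> y = - x"
  proof -
    assume h: "odd x" "odd y" "selling_val (A, B, C) x y \<le> A + B"
    have nn: "0 \<le> C * (x + y)\<^sup>2" using assms by simp
    have "A * x\<^sup>2 \<le> A" "C * (x + y)\<^sup>2 \<le> 0"
      using h(3) ge[OF h(1), of A] ge[OF h(2), of B] nn assms unfolding selling_val_simp by linarith+
    then show ?thesis using odd_square_eq_one[OF h(1)] le1[of A x] eq0[of C "x + y"] assms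
      by (metis add.commute add.inverse_unique)
  qed
qed

definition selling_form :: "int \<times> int \<times> int \<Rightarrow> bqf" where
  "selling_form = (\<lambda>(A, B, C). ((A + C) div 2, C, (B + C) div 2))"

lemma selling_form_eval:
  assumes "odd A" "odd B" "odd C"
  shows "2 * bqf_eval (selling_form (A, B, C)) (x::int) y = selling_val (A, B, C) x y"
proof -
  have "even (A + C)" "even (B + C)" using assms by auto
  then obtain k l where "A + C = 2 * k" "B + C = 2 * l" by (meson evenE)
  then have "A = 2 * k - C" "B = 2 * l - C" by auto
  then show ?thesis
    by (simp add: selling_form_def selling_val_simp) (simp add: algebra_simps power2_eq_square)
qed

lemma selling_form_discr:
  assumes "(A, B, C) \<in> selling_triples N"
  shows "bqf_discr (selling_form (A, B, C)) = - N"
proof -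
  have "even (A + C)" "even (B + C)" using assms by (auto simp: selling_triples_def)
  then obtain k l where "A + C = 2 * k" "B + C = 2 * l" by (meson evenE)
  then have "A = 2 * k - C" "B = 2 * l - C" by auto
  then show ?thesis using assms
    by (simp add: selling_form_def selling_triples_def) (simp add: algebra_simps power2_eq_square)
qed

lemma bqf_pos_def_iff:
  assumes "bqf_discr (a, b, c) < 0"
  shows "bqf_pos_def (a, b, c) \<longleftrightarrow> a > 0"
proof
  assume "bqf_pos_def (a, b, c)"
  then have "((1::real), (0::real)) \<noteq> (0, 0) \<longrightarrow> bqf_eval (a, b, c) (1::real) 0 > 0"
    unfolding bqf_pos_def_def by (elim allE)
  then show "a > 0" by simp
next
  assume a: "a > 0"
  define D where "D = 4 * real_of_int a * c - (real_of_int b)\<^sup>2"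
  have "b\<^sup>2 - 4 * a * c < 0" using assms by simp
  then have "real_of_int (b\<^sup>2 - 4 * a * c) < 0" by linarith
  then have D: "D > 0" by (simp add: D_def)
  show "bqf_pos_def (a, b, c)" unfolding bqf_pos_def_def
  proof (intro allI impI)
    fix x y :: real assume xy: "(x, y) \<noteq> (0, 0)"
    have e: "4 * real_of_int a * bqf_eval (a, b, c) x y = (2 * a * x + b * y)\<^sup>2 + D * y\<^sup>2"
      by (simp add: D_def power2_eq_square algebra_simps)
    have "(2 * a * x + b * y)\<^sup>2 + D * y\<^sup>2 > 0"
    proof (cases "y = 0")
      case True then show ?thesis using xy a by simp
    next
      case False then show ?thesis using D by (simp add: add_nonneg_pos)
    qed
    then have "0 < 4 * real_of_int a * bqf_eval (a, b, c) x y" using e by simp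
    then show "0 < bqf_eval (a, b, c) x y" using a by (simp add: zero_less_mult_iff)
  qed
qed

lemma selling_form_pos_def:
  assumes "(A, B, C) \<in> selling_triples N"
  shows "bqf_pos_def (selling_form (A, B, C))"
proof -
  have p: "A > 0" "C > 0" "odd A" "odd C" using assms by (auto simp: selling_triples_def)
  have "bqf_discr (selling_form (A, B, C)) < 0" using selling_form_discr[OF assms] selling_triples_pos[OF assms] by simp
  moreover have "(A + C) div 2 > 0" using p by presburger
  ultimately show ?thesis by (simp add: selling_form_def bqf_pos_def_iff)
qed

section \<open>Proper equivalence and Selling reduction\<close>

lemma bqf_equiv_I:
  assumes "\<alpha> * \<delta> - \<beta> * \<gamma> = 1"
    and "\<And>x y :: int. bqf_eval Q' x y = bqf_eval Q (\<alpha> * x + \<beta> * y) (\<gamma> * x + \<delta> * y)"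
  shows "(Q, Q') \<in> bqf_equiv"
  using assms unfolding bqf_equiv_def by blast

lemma bqf_equiv_discr:
  assumes "(Q, Q') \<in> bqf_equiv"
  shows "bqf_discr Q' = bqf_discr Q"
proof -
  obtain a b c where Q: "Q = (a, b, c)" by (cases Q)
  obtain a' b' c' where Q': "Q' = (a', b', c')" by (cases Q')
  obtain \<alpha> \<beta> \<gamma> \<delta> :: int where det: "\<alpha> * \<delta> - \<beta> * \<gamma> = 1"
    and V: "\<And>x y. bqf_eval Q' x y = bqf_eval Q (\<alpha> * x + \<beta> * y) (\<gamma> * x + \<delta> * y)"
    using assms unfolding bqf_equiv_def by blast
  have a': "a' = a * \<alpha>\<^sup>2 + b * \<alpha> * \<gamma> + c * \<gamma>\<^sup>2" using V[of 1 0] by (simp add: Q Q')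
  have c': "c' = a * \<beta>\<^sup>2 + b * \<beta> * \<delta> + c * \<delta>\<^sup>2" using V[of 0 1] by (simp add: Q Q')
  have "a' + b' + c' = a * (\<alpha> + \<beta>)\<^sup>2 + b * (\<alpha> + \<beta>) * (\<gamma> + \<delta>) + c * (\<gamma> + \<delta>)\<^sup>2"
    using V[of 1 1] by (simp add: Q Q')
  then have b': "b' = 2 * a * \<alpha> * \<beta> + b * (\<alpha> * \<delta> + \<beta> * \<gamma>) + 2 * c * \<gamma> * \<delta>"
    unfolding a' c' by (simp add: power2_eq_square algebra_simps)
  have "bqf_discr Q' = (\<alpha> * \<delta> - \<beta> * \<gamma>)\<^sup>2 * bqf_discr Q"
    unfolding Q Q' bqf_discr.simps a' b' c' by (simp add: power2_eq_square algebra_simps)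
  then show ?thesis by (simp add: det)
qed

text \<open>The parameters of (a, b, c) are 2 a - b, 2 c - b, b, and the induction is on their sum 2
  a + 2 c - b. A negative parameter admits a change of basis that lowers this sum, which is also the
  sum of the values a, c, a - b + c at (1, 0), (0, 1), (1, -1) and therefore stays positive.\<close>

lemma bqf_equiv_selling_form:
  fixes a b c :: int
  assumes "b\<^sup>2 - 4 * a * c = - N" "N mod 8 = 3" "a > 0" "N > 0"
  shows "\<exists>z\<in>selling_triples N. ((a, b, c), selling_form z) \<in> bqf_equiv"
  using assms
proof (induction "nat (2 * a + 2 * c - b)" arbitrary: a b c rule: less_induct)
  case less
  have D: "b\<^sup>2 - 4 * a * c = - N" and a: "a > 0" using less.prems by auto
  have ac: "4 * (a * c) = N + b\<^sup>2" using D by (simp add: algebra_simps)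
  have c: "c > 0"
  proof -
    have "a * c > 0" using ac \<open>N > 0\<close> by (smt (verit) zero_le_power2)
    then show ?thesis using a by (simp add: zero_less_mult_iff)
  qed
  have bo: "odd b"
  proof
    assume "even b" then obtain k where "b = 2 * k" by (elim evenE)
    then have "N = 4 * (a * c - k\<^sup>2)" using ac by (simp add: power2_eq_square)
    moreover have False if "N = 4 * w" for w using that less.prems(2) by presburger
    ultimately show False by blast
  qed
  have aco: "odd a \<and> odd c"
  proof -
    have "odd w" if "4 * w = N + B" "B mod 8 = 1" for w B
      using that less.prems(2) by presburger
    then have "odd (a * c)" using ac odd_square_mod_8[OF bo] by metis
    then show ?thesis by simp
  qed
  have m: "a - b + c > 0"
  proof -
    have "4 * a * (a - b + c) = (2 * a - b)\<^sup>2 + N" using ac by (simp add: power2_eq_square algebra_simps)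
    then have "4 * a * (a - b + c) > 0" using \<open>N > 0\<close> by (smt (verit) zero_le_power2)
    then show ?thesis using a by (simp add: zero_less_mult_iff)
  qed
  have trans: "\<exists>z\<in>selling_triples N. ((a, b, c), selling_form z) \<in> bqf_equiv"
    if "((a, b, c), (a', b', c')) \<in> bqf_equiv" "b'\<^sup>2 - 4 * a' * c' = - N" "a' > 0"
      "2 * a' + 2 * c' - b' < 2 * a + 2 * c - b" for a' b' c'
  proof -
    have "0 < 2 * a + 2 * c - b" using a c m by linarith
    then have "nat (2 * a' + 2 * c' - b') < nat (2 * a + 2 * c - b)" using that(4) by linarith
    from less.hyps[OF this that(2) less.prems(2) that(3) less.prems(4)] that(1)
    show ?thesis using equiv_bqf_equiv unfolding equiv_def trans_def by blast
  qed
  \<comment> \<open>As b is odd, no parameter is 0: either one is negative, or all three are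
    positive and the form is reduced.\<close>
  consider "b < 0" | "b > 2 * a" | "b > 2 * c" | "0 < b" "b < 2 * a" "b < 2 * c"
  proof -
    have "b \<noteq> 0" "b \<noteq> 2 * a" "b \<noteq> 2 * c" using bo by auto
    then show ?thesis using that by linarith
  qed
  then show ?case
  proof cases
    case 1
    show ?thesis
    proof (rule trans[of c "- b" a])
      show "((a, b, c), (c, - b, a)) \<in> bqf_equiv"
        by (rule bqf_equiv_I[of 0 0 "-1" 1]) (simp_all add: power2_eq_square algebra_simps)
    qed (use 1 D c in \<open>auto simp: algebra_simps\<close>)
  next
    case 2
    show ?thesis
    proof (rule trans[of a "b - 2 * a" "a - b + c"])
      show "((a, b, c), (a, b - 2 * a, a - b + c)) \<in> bqf_equiv"
        by (rule bqf_equiv_I[of 1 1 "-1" 0]) (simp_all add: power2_eq_square algebra_simps)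
    qed (use 2 D a in \<open>auto simp: algebra_simps power2_eq_square\<close>)
  next
    case 3
    show ?thesis
    proof (rule trans[of "a - b + c" "b - 2 * c" c])
      show "((a, b, c), (a - b + c, b - 2 * c, c)) \<in> bqf_equiv"
        by (rule bqf_equiv_I[of 1 1 0 "-1"]) (simp_all add: power2_eq_square algebra_simps)
    qed (use 3 D m in \<open>auto simp: algebra_simps power2_eq_square\<close>)
  next
    case 4
    have "(2 * a - b, 2 * c - b, b) \<in> selling_triples N"
      using 4 bo D by (auto simp: selling_triples_def algebra_simps power2_eq_square)
    moreover have "selling_form (2 * a - b, 2 * c - b, b) = (a, b, c)" by (simp add: selling_form_def)
    moreover have "((a, b, c), (a, b, c)) \<in> bqf_equiv"
      using equiv_bqf_equiv by (auto simp: equiv_def dest: refl_onD)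
    ultimately show ?thesis by force
  qed
qed

fun rotate3 :: "'a \<times> 'a \<times> 'a \<Rightarrow> 'a \<times> 'a \<times> 'a" where
  "rotate3 (A, B, C) = (B, C, A)"

lemma rotate3_selling_triples: "z \<in> selling_triples N \<Longrightarrow> rotate3 z \<in> selling_triples N"
  by (cases z) (auto simp: selling_triples_def algebra_simps)

lemma selling_form_rotate3_equiv:
  assumes "z \<in> selling_triples N"
  shows "(selling_form z, selling_form (rotate3 z)) \<in> bqf_equiv"
proof -
  obtain A B C where z: "z = (A, B, C)" by (cases z)
  have o: "odd A" "odd B" "odd C" using assms z by (auto simp: selling_triples_def)
  show ?thesis unfolding z
  proof (rule bqf_equiv_I[of 1 0 1 "-1"])
    fix x y :: int
    have "2 * bqf_eval (selling_form (rotate3 (A, B, C))) x y = selling_val (B, C, A) x y"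
      using selling_form_eval o by simp
    also have "\<dots> = selling_val (A, B, C) (1 * x + 1 * y) (- 1 * x + 0 * y)"
      by (simp add: selling_val_simp power2_eq_square algebra_simps)
    also have "\<dots> = 2 * bqf_eval (selling_form (A, B, C)) (1 * x + 1 * y) (- 1 * x + 0 * y)"
      using selling_form_eval o by simp
    finally show "bqf_eval (selling_form (rotate3 (A, B, C))) x y =
      bqf_eval (selling_form (A, B, C)) (1 * x + 1 * y) (- 1 * x + 0 * y)" by linarith
  qed simp
qed

text \<open>Modulo 2 an equivalence permutes the three nonzero classes, and corresponding classes
  have equal minima, so the pairwise sums of the parameters are permuted. Even permutations give the
  rotations. For an odd one, uniqueness of minimisers determines the images of the basis vectors so
  far that the matrix has determinant -1.\<close>

lemma selling_form_equiv_imp_rotate3: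
  assumes z: "z \<in> selling_triples N" and z': "z' \<in> selling_triples N"
    and eq: "(selling_form z, selling_form z') \<in> bqf_equiv"
  shows "z' \<in> {z, rotate3 z, rotate3 (rotate3 z)}"
proof -
  obtain A B C where [simp]: "z = (A, B, C)" by (cases z)
  obtain A' B' C' where [simp]: "z' = (A', B', C')" by (cases z')
  have o: "odd A" "odd B" "odd C" and p: "A > 0" "B > 0" "C > 0"
    using z by (auto simp: selling_triples_def)
  have o': "odd A'" "odd B'" "odd C'" and p': "A' > 0" "B' > 0" "C' > 0"
    using z' by (auto simp: selling_triples_def)
  have half: "selling_val (A', B', C') x y = selling_val (A, B, C) (\<alpha> * x + \<beta> * y) (\<gamma> * x + \<delta> * y)"
    if "\<And>x y :: int. bqf_eval (selling_form z') x y = bqf_eval (selling_form z) (\<alpha> * x + \<beta> * y) (\<gamma> * x + \<delta> * y)"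
    for \<alpha> \<beta> \<gamma> \<delta> x y :: int
    using that[of x y] selling_form_eval[OF o, of "\<alpha> * x + \<beta> * y" "\<gamma> * x + \<delta> * y"]
      selling_form_eval[OF o', of x y] by simp
  obtain \<alpha> \<beta> \<gamma> \<delta> :: int where det: "\<alpha> * \<delta> - \<beta> * \<gamma> = 1"
    and V: "\<And>x y. selling_val (A', B', C') x y = selling_val (A, B, C) (\<alpha> * x + \<beta> * y) (\<gamma> * x + \<delta> * y)"
    using eq half unfolding bqf_equiv_def by blast
  have V': "selling_val (A, B, C) x y = selling_val (A', B', C') (\<delta> * x - \<beta> * y) (\<alpha> * y - \<gamma> * x)" for x y
  proof -
    have "\<alpha> * (\<delta> * x - \<beta> * y) + \<beta> * (\<alpha> * y - \<gamma> * x) = (\<alpha> * \<delta> - \<beta> * \<gamma>) * x"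
      "\<gamma> * (\<delta> * x - \<beta> * y) + \<delta> * (\<alpha> * y - \<gamma> * x) = (\<alpha> * \<delta> - \<beta> * \<gamma>) * y"
      by (simp_all add: algebra_simps)
    then show ?thesis by (simp add: V det)
  qed
  note ge = selling_val_ge[of A B C, simplified] and ge' = selling_val_ge[of A' B' C', simplified]
  note v = V[of 1 0, simplified] V[of 0 1, simplified] V[of 1 "-1", simplified]
  note v' = V'[of 1 0, simplified] V'[of 0 1, simplified] V'[of 1 "-1", simplified]
  have ev: "selling_val (P, Q, R) 1 0 = P + R" "selling_val (P, Q, R) 0 1 = Q + R"
    "selling_val (P, Q, R) 1 (-1) = P + Q" for P Q R :: int
    by (simp_all add: selling_val_simp)
  have "odd (\<alpha> * \<delta> - \<beta> * \<gamma>)" using det by simp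
  then have par: "(odd \<alpha> \<and> odd \<delta>) \<noteq> (odd \<beta> \<and> odd \<gamma>)" by auto
  note mu = selling_val_min_unique[OF p]
  note v = v[unfolded ev] and v' = v'[unfolded ev]
  \<comment> \<open>The six invertible matrices modulo 2; the transpositions are the cases 2, 3 and
    6.\<close>
  consider "odd \<alpha>" "even \<gamma>" "even \<beta>" "odd \<delta>" | "odd \<alpha>" "even \<gamma>" "odd \<beta>" "odd \<delta>"
    | "even \<alpha>" "odd \<gamma>" "odd \<beta>" "even \<delta>" | "even \<alpha>" "odd \<gamma>" "odd \<beta>" "odd \<delta>"
    | "odd \<alpha>" "odd \<gamma>" "odd \<beta>" "even \<delta>" | "odd \<alpha>" "odd \<gamma>" "even \<beta>" "odd \<delta>"
    using par by blast
  then show ?thesis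
  proof cases
    case 1
    show ?thesis using 1 v v' ge(1)[of \<alpha> \<gamma>] ge(2)[of \<beta> \<delta>] ge(3)[of "\<alpha> - \<beta>" "\<gamma> - \<delta>"]
      ge'(1)[of \<delta> "- \<gamma>"] ge'(2)[of "- \<beta>" \<alpha>] ge'(3)[of "\<delta> + \<beta>" "- \<alpha> - \<gamma>"] p p'
      by simp
  next
    case 2
    have 1: "A' + C' = A + C" "B' + C' = A + B" "A' + B' = B + C"
      using 2 v v' ge(1)[of \<alpha> \<gamma>] ge(3)[of \<beta> \<delta>] ge(2)[of "\<alpha> - \<beta>" "\<gamma> - \<delta>"]
      ge'(1)[of \<delta> "- \<gamma>"] ge'(3)[of "- \<beta>" \<alpha>] ge'(2)[of "\<delta> + \<beta>" "- \<alpha> - \<gamma>"] p p'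
      by simp_all
    then have "\<alpha> = 1 \<or> \<alpha> = -1" "\<gamma> = 0" "\<delta> = - \<beta>" "\<alpha> = \<beta>"
      using 2 v mu(1)[of \<alpha> \<gamma>] mu(3)[of \<beta> \<delta>] mu(2)[of "\<alpha> - \<beta>" "\<gamma> - \<delta>"] by simp_all
    then show ?thesis using det by auto
  next
    case 3
    have 1: "A' + C' = B + C" "B' + C' = A + C" "A' + B' = A + B"
      using 3 v v' ge(2)[of \<alpha> \<gamma>] ge(1)[of \<beta> \<delta>] ge(3)[of "\<alpha> - \<beta>" "\<gamma> - \<delta>"]
      ge'(2)[of \<delta> "- \<gamma>"] ge'(1)[of "- \<beta>" \<alpha>] ge'(3)[of "\<delta> + \<beta>" "- \<alpha> - \<gamma>"] p p'
      by simp_all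
    then have "\<alpha> = 0" "\<delta> = 0" "\<beta> = 1 \<or> \<beta> = -1" "\<gamma> = \<beta>"
      using 3 v mu(2)[of \<alpha> \<gamma>] mu(1)[of \<beta> \<delta>] mu(3)[of "\<alpha> - \<beta>" "\<gamma> - \<delta>"] by simp_all
    then show ?thesis using det by auto
  next
    case 4
    show ?thesis using 4 v v' ge(2)[of \<alpha> \<gamma>] ge(3)[of \<beta> \<delta>] ge(1)[of "\<alpha> - \<beta>" "\<gamma> - \<delta>"]
      ge'(3)[of \<delta> "- \<gamma>"] ge'(1)[of "- \<beta>" \<alpha>] ge'(2)[of "\<delta> + \<beta>" "- \<alpha> - \<gamma>"] p p'
      by simp
  next
    case 5
    show ?thesis using 5 v v' ge(3)[of \<alpha> \<gamma>] ge(1)[of \<beta> \<delta>] ge(2)[of "\<alpha> - \<beta>" "\<gamma> - \<delta>"]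
      ge'(2)[of \<delta> "- \<gamma>"] ge'(3)[of "- \<beta>" \<alpha>] ge'(1)[of "\<delta> + \<beta>" "- \<alpha> - \<gamma>"] p p'
      by simp
  next
    case 6
    have 1: "A' + C' = A + B" "B' + C' = B + C" "A' + B' = A + C"
      using 6 v v' ge(3)[of \<alpha> \<gamma>] ge(2)[of \<beta> \<delta>] ge(1)[of "\<alpha> - \<beta>" "\<gamma> - \<delta>"]
      ge'(3)[of \<delta> "- \<gamma>"] ge'(2)[of "- \<beta>" \<alpha>] ge'(1)[of "\<delta> + \<beta>" "- \<alpha> - \<gamma>"] p p'
      by simp_all
    then have "\<alpha> = 1 \<or> \<alpha> = -1" "\<gamma> = - \<alpha>" "\<beta> = 0" "\<delta> = \<gamma>"
      using 6 v mu(3)[of \<alpha> \<gamma>] mu(2)[of \<beta> \<delta>] mu(1)[of "\<alpha> - \<beta>" "\<gamma> - \<delta>"] by simp_all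
    then show ?thesis using det by auto
  qed
qed

text \<open>Classes correspond to rotation orbits of triples, and an orbit has 3 / \<omega>
  elements: that of (a, a, a) is a point, every other one has three. Weight 2 would require the
  discriminant -4 a^2.\<close>

theorem hurwitz_H_eq_card_selling_triples:
  assumes N: "N mod 8 = 3" "N > 0"
  shows "3 * hurwitz_H N = real (card (selling_triples N))"
proof -
  define cls where "cls z = bqf_equiv `` {selling_form z}" for z
  have cls_eq: "cls z = cls z' \<longleftrightarrow> (selling_form z, selling_form z') \<in> bqf_equiv" for z z'
    unfolding cls_def using equiv_bqf_equiv by (meson UNIV_I eq_equiv_class_iff)
  have img: "bqf_classes N = cls ` selling_triples N"
  proof
    show "bqf_classes N \<subseteq> cls ` selling_triples N"
    proof
      fix K assume "K \<in> bqf_classes N"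
      then obtain Q where Q: "bqf_pos_def Q" "bqf_discr Q = - N" "K = bqf_equiv `` {Q}"
        unfolding bqf_classes_def by (auto elim!: quotientE)
      obtain a b c where abc: "Q = (a, b, c)" by (cases Q)
      have "a > 0" using Q N by (simp add: abc bqf_pos_def_iff)
      then obtain z where "z \<in> selling_triples N" "(Q, selling_form z) \<in> bqf_equiv"
        using bqf_equiv_selling_form[of b a c N] Q N by (auto simp: abc)
      then show "K \<in> cls ` selling_triples N"
        using Q(3) equiv_class_eq[OF equiv_bqf_equiv] unfolding cls_def by blast
    qed
    show "cls ` selling_triples N \<subseteq> bqf_classes N"
      unfolding cls_def bqf_classes_def using selling_form_discr selling_form_pos_def
      by (auto intro!: quotientI)
  qed
  have fibre: "{z' \<in> selling_triples N. cls z' = cls z} = {z, rotate3 z, rotate3 (rotate3 z)}"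
    if z: "z \<in> selling_triples N" for z
  proof (intro equalityI subsetI)
    fix z' assume "z' \<in> {z' \<in> selling_triples N. cls z' = cls z}"
    then show "z' \<in> {z, rotate3 z, rotate3 (rotate3 z)}"
      using selling_form_equiv_imp_rotate3[OF z] cls_eq[of z z'] by simp
  next
    fix z' assume z': "z' \<in> {z, rotate3 z, rotate3 (rotate3 z)}"
    have "cls (rotate3 w) = cls w" if "w \<in> selling_triples N" for w
      using selling_form_rotate3_equiv[OF that] cls_eq by metis
    note c = this
    note r = rotate3_selling_triples[OF z] rotate3_selling_triples[OF rotate3_selling_triples[OF z]]
    show "z' \<in> {z' \<in> selling_triples N. cls z' = cls z}"
      using z' by (elim insertE) (simp_all add: z r c[OF z] c[OF r(1)])
  qed
  have w: "3 / real (bqf_omega (cls z)) = card {z' \<in> selling_triples N. cls z' = cls z}"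
    if z: "z \<in> selling_triples N" for z
  proof -
    obtain A B C where zt: "z = (A, B, C)" by (cases z)
    have o: "odd A" "odd B" "odd C" and p: "A > 0" "B > 0" "C > 0"
      using z by (auto simp: selling_triples_def zt)
    have discr: "bqf_discr Q = - N" if "Q \<in> cls z" for Q
      using that bqf_equiv_discr[of "selling_form z" Q] selling_form_discr z
      by (auto simp: cls_def zt)
    have no2: "(a, 0, a) \<notin> cls z" for a
    proof
      assume "(a, 0, a) \<in> cls z"
      then have "N = 4 * (a * a)" using discr by force
      moreover have False if "N = 4 * w" for w using that N(1) by presburger
      ultimately show False by blast
    qed
    \<comment> \<open>Once a is known to be positive and odd, (a, a, a) is the form of the triple
      (a, a, a), whose orbit is a single point.\<close>
    have is3: "z = (a, a, a)" if a: "(a, a, a) \<in> cls z" for a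
    proof -
      have N3: "N = 3 * (a * a)" using discr[OF a] by (simp add: power2_eq_square)
      have "(selling_form z, (a, a, a)) \<in> bqf_equiv" using a by (simp add: cls_def)
      then obtain \<alpha> \<gamma> :: int where "bqf_eval (a, a, a) (1::int) 0 = bqf_eval (selling_form z) \<alpha> \<gamma>"
        unfolding bqf_equiv_def by blast
      then have "2 * a = selling_val (A, B, C) \<alpha> \<gamma>" using selling_form_eval[OF o] by (simp add: zt)
      also have "\<dots> \<ge> 0" using p by (simp add: selling_val_simp)
      finally have "a > 0" using N3 N(2) by (cases "a = 0") auto
      moreover have "odd a"
      proof
        assume "even a"
        then obtain k where "a = 2 * k" by (elim evenE)
        then have "N = 4 * (3 * (k * k))" using N3 by simp
        moreover have False if "N = 4 * w" for w using that N(1) by presburger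
        ultimately show False by blast
      qed
      ultimately have aT: "(a, a, a) \<in> selling_triples N" using N3 by (simp add: selling_triples_def)
      moreover have "cls (a, a, a) = cls z"
        using cls_eq[of z "(a, a, a)"] a by (simp add: selling_form_def cls_def)
      ultimately have "(a, a, a) \<in> {z, rotate3 z, rotate3 (rotate3 z)}" using fibre[OF z] by blast
      then show ?thesis by (auto simp: zt)
    qed
    show ?thesis
    proof (cases "A = B \<and> B = C")
      case True
      then have "(A, A, A) \<in> cls z"
        unfolding cls_def using equiv_class_self[OF equiv_bqf_equiv, of "(A, A, A)"]
        by (simp add: zt selling_form_def)
      then have "bqf_omega (cls z) = 3" using no2 by (auto simp: bqf_omega_def)
      then show ?thesis using True fibre[OF z] by (simp add: zt)
    next
      case False
      then have "bqf_omega (cls z) = 1" using no2 is3 by (auto simp: bqf_omega_def zt)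
      moreover have "z \<noteq> rotate3 z" "z \<noteq> rotate3 (rotate3 z)" "rotate3 z \<noteq> rotate3 (rotate3 z)"
        unfolding zt rotate3.simps prod.inject using False by metis+
      then have "card {z, rotate3 z, rotate3 (rotate3 z)} = 3" by simp
      ultimately show ?thesis using fibre[OF z] by simp
    qed
  qed
  have "hurwitz_H N = (\<Sum>K\<in>bqf_classes N. 1 / real (bqf_omega K))"
  proof -
    have "N mod 4 = 3" using N(1) by presburger
    then show ?thesis using N(2) by (simp add: hurwitz_H_def)
  qed
  then have "3 * hurwitz_H N = (\<Sum>K\<in>cls ` selling_triples N. 3 / real (bqf_omega K))"
    by (simp add: img sum_distrib_left)
  also have "\<dots> = (\<Sum>K\<in>cls ` selling_triples N. real (card {z \<in> selling_triples N. cls z = K}))"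
    using w by (intro sum.cong) auto
  also have "\<dots> = real (card (selling_triples N))"
    using sum.image_gen[OF finite_selling_triples, of "\<lambda>_. 1::real" N cls] by simp
  finally show ?thesis .
qed

section \<open>Similitudes of reduced forms\<close>

text \<open>The sublattices of \<open>\<int>\<^sup>2\<close> of index \<open>n\<close> are the lattices spanned by \<open>(\<alpha>, 0)\<close> and
  \<open>(\<beta>, \<delta>)\<close> with \<open>\<alpha> \<delta> = n\<close> and \<open>0 \<le> \<beta> < \<alpha>\<close>.\<close>

definition lat :: "int \<Rightarrow> int \<Rightarrow> int \<Rightarrow> (int \<times> int) set" where
  "lat \<alpha> \<beta> \<delta> = {(x, y). \<exists>k l. x = \<alpha> * k + \<beta> * l \<and> y = \<delta> * l}"

abbreviation parity :: "int \<Rightarrow> int \<Rightarrow> bool \<times> bool" where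
  "parity x y \<equiv> (odd x, odd y)"

abbreviation rval :: "real \<times> real \<times> real \<Rightarrow> int \<Rightarrow> int \<Rightarrow> real" where
  "rval v x y \<equiv> selling_val v (real_of_int x) (real_of_int y)"

section \<open>Forms with nonnegative real parameters\<close>

definition param_simplex :: "(real \<times> real \<times> real) set" where
  "param_simplex = {(A, B, C). A \<ge> 0 \<and> B \<ge> 0 \<and> C \<ge> 0 \<and> A + B + C = 1}"

lemma continuous_on_Min_image:
  fixes f :: "'a \<Rightarrow> 'b::topological_space \<Rightarrow> real"
  assumes "finite W" "W \<noteq> {}" "\<And>w. w \<in> W \<Longrightarrow> continuous_on S (f w)"
  shows "continuous_on S (\<lambda>x. Min ((\<lambda>w. f w x) ` W))"
  using assms
proof (induction W rule: finite_ne_induct)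
  case (insert w W)
  then have "(\<lambda>x. Min ((\<lambda>w. f w x) ` insert w W)) = (\<lambda>x. min (f w x) (Min ((\<lambda>w. f w x) ` W)))"
    by simp
  then show ?case using insert by (auto intro!: continuous_on_min)
qed simp

lemma compact_param_simplex: "compact param_simplex"
proof -
  have eq: "param_simplex = {v. 0 \<le> fst v} \<inter> {v. 0 \<le> fst (snd v)} \<inter> {v. 0 \<le> snd (snd v)}
      \<inter> {v. fst v + fst (snd v) + snd (snd v) = 1}"
    by (auto simp: param_simplex_def)
  have "closed param_simplex" unfolding eq
    by (intro closed_Int closed_Collect_le closed_Collect_eq continuous_intros)
  moreover have "param_simplex \<subseteq> cbox (0, 0, 0) (1, 1, 1)"
    by (auto simp: param_simplex_def cbox_Pair_eq)
  then have "bounded param_simplex" using bounded_cbox bounded_subset by blast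
  ultimately show ?thesis by (simp add: compact_eq_bounded_closed)
qed

lemma convex_param_simplex: "convex param_simplex"
proof -
  have "u * a + v * a' + (u * b + v * b') + (u * c + v * c') = (1::real)"
    if "u + v = 1" "a + b + c = 1" "a' + b' + c' = 1" for u v a b c a' b' c'
  proof -
    have "u * a + v * a' + (u * b + v * b') + (u * c + v * c') = u * (a + b + c) + v * (a' + b' + c')"
      by (simp add: algebra_simps)
    then show ?thesis using that by simp
  qed
  then show ?thesis unfolding convex_def param_simplex_def by auto
qed

text \<open>Positive pairwise sums mean that at most one parameter vanishes, so two of x, y, x + y
  are bounded, and with them x and y.\<close>

lemma finite_rval_le:
  assumes "A \<ge> 0" "B \<ge> 0" "C \<ge> 0" "A + B > 0" "B + C > 0" "A + C > 0"
  shows "finite {(x, y). rval (A, B, C) x y \<le> K}"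
proof -
  have bnd: "\<exists>M::int. \<forall>z::int. D * (real_of_int z)\<^sup>2 \<le> K \<longrightarrow> \<bar>z\<bar> \<le> M" if "D > 0" for D
  proof (intro exI allI impI)
    fix z :: int assume "D * (real_of_int z)\<^sup>2 \<le> K"
    then have "(real_of_int z)\<^sup>2 \<le> K / D" using that by (simp add: field_simps)
    then have "real_of_int (z\<^sup>2) \<le> K / D" by simp
    then have "z\<^sup>2 \<le> \<lfloor>K / D\<rfloor>" by (simp add: le_floor_iff)
    moreover have "\<bar>z\<bar> \<le> z\<^sup>2" by (rule abs_le_square_int)
    ultimately show "\<bar>z\<bar> \<le> \<lfloor>K / D\<rfloor>" by linarith
  qed
  have le: "A * (real_of_int x)\<^sup>2 \<le> K" "B * (real_of_int y)\<^sup>2 \<le> K" "C * (real_of_int (x + y))\<^sup>2 \<le> K"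
    if "rval (A, B, C) x y \<le> K" for x y
  proof -
    have "0 \<le> A * (real_of_int x)\<^sup>2" "0 \<le> B * (real_of_int y)\<^sup>2" "0 \<le> C * (real_of_int x + real_of_int y)\<^sup>2"
      using assms by simp_all
    then show "A * (real_of_int x)\<^sup>2 \<le> K" "B * (real_of_int y)\<^sup>2 \<le> K" "C * (real_of_int (x + y))\<^sup>2 \<le> K"
      using that unfolding selling_val_simp of_int_add by linarith+
  qed
  consider "A > 0" "B > 0" | "B > 0" "C > 0" | "A > 0" "C > 0" using assms by linarith
  then have "\<exists>M::int. \<forall>x y. rval (A, B, C) x y \<le> K \<longrightarrow> \<bar>x\<bar> \<le> M \<and> \<bar>y\<bar> \<le> M"
  proof cases
    case 1
    obtain M1 M2 where "\<And>z. A * (real_of_int z)\<^sup>2 \<le> K \<Longrightarrow> \<bar>z\<bar> \<le> M1"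
      "\<And>z. B * (real_of_int z)\<^sup>2 \<le> K \<Longrightarrow> \<bar>z\<bar> \<le> M2"
      using bnd[OF 1(1)] bnd[OF 1(2)] by blast
    then have *: "\<bar>x\<bar> \<le> M1" "\<bar>y\<bar> \<le> M2" if "rval (A, B, C) x y \<le> K" for x y
      using le[OF that] by blast+
    have "\<bar>x\<bar> \<le> M1 + M2 \<and> \<bar>y\<bar> \<le> M1 + M2" if "rval (A, B, C) x y \<le> K" for x y
      using *[OF that] by linarith
    then show ?thesis by blast
  next
    case 2
    obtain M1 M2 where "\<And>z. B * (real_of_int z)\<^sup>2 \<le> K \<Longrightarrow> \<bar>z\<bar> \<le> M1"
      "\<And>z. C * (real_of_int z)\<^sup>2 \<le> K \<Longrightarrow> \<bar>z\<bar> \<le> M2"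
      using bnd[OF 2(1)] bnd[OF 2(2)] by blast
    then have *: "\<bar>y\<bar> \<le> M1" "\<bar>x + y\<bar> \<le> M2" if "rval (A, B, C) x y \<le> K" for x y
      using le[OF that] by blast+
    have "\<bar>x\<bar> \<le> M1 + M2 \<and> \<bar>y\<bar> \<le> M1 + M2" if "rval (A, B, C) x y \<le> K" for x y
      using *[OF that] by linarith
    then show ?thesis by blast
  next
    case 3
    obtain M1 M2 where "\<And>z. A * (real_of_int z)\<^sup>2 \<le> K \<Longrightarrow> \<bar>z\<bar> \<le> M1"
      "\<And>z. C * (real_of_int z)\<^sup>2 \<le> K \<Longrightarrow> \<bar>z\<bar> \<le> M2"
      using bnd[OF 3(1)] bnd[OF 3(2)] by blast
    then have *: "\<bar>x\<bar> \<le> M1" "\<bar>x + y\<bar> \<le> M2" if "rval (A, B, C) x y \<le> K" for x y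
      using le[OF that] by blast+
    have "\<bar>x\<bar> \<le> M1 + M2 \<and> \<bar>y\<bar> \<le> M1 + M2" if "rval (A, B, C) x y \<le> K" for x y
      using *[OF that] by linarith
    then show ?thesis by blast
  qed
  then obtain M :: int where M: "\<And>x y. rval (A, B, C) x y \<le> K \<Longrightarrow> \<bar>x\<bar> \<le> M \<and> \<bar>y\<bar> \<le> M" by blast
  have "{(x, y). rval (A, B, C) x y \<le> K} \<subseteq> {-M..M} \<times> {-M..M}" using M by force
  then show ?thesis by (rule finite_subset) simp
qed

text \<open>Since the index n is odd, reduction modulo 2 maps L onto (Z/2)^2 with kernel 2 L: every
  class meets L, and a basis of L always consists of vectors from two different nonzero
  classes.\<close>

locale odd_lattice =
  fixes n \<alpha> \<beta> \<delta> :: int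
  assumes pos: "\<alpha> > 0" "\<delta> > 0" and n: "\<alpha> * \<delta> = n" and odd_n: "odd n"
begin

abbreviation "L \<equiv> lat \<alpha> \<beta> \<delta>"

lemma n_pos: "n > 0" using pos n by auto

lemma L_comb: "(x1, y1) \<in> L \<Longrightarrow> (x2, y2) \<in> L \<Longrightarrow> (k * x1 + l * x2, k * y1 + l * y2) \<in> L"
proof -
  assume "(x1, y1) \<in> L" "(x2, y2) \<in> L"
  then obtain a b c d where "x1 = \<alpha> * a + \<beta> * b" "y1 = \<delta> * b" "x2 = \<alpha> * c + \<beta> * d" "y2 = \<delta> * d"
    unfolding lat_def by blast
  then have "k * x1 + l * x2 = \<alpha> * (k * a + l * c) + \<beta> * (k * b + l * d)" "k * y1 + l * y2 = \<delta> * (k * b + l * d)"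
    by (simp_all add: algebra_simps)
  then show ?thesis unfolding lat_def by blast
qed

lemma L_add: "(x1, y1) \<in> L \<Longrightarrow> (x2, y2) \<in> L \<Longrightarrow> (x1 + x2, y1 + y2) \<in> L"
  using L_comb[of x1 y1 x2 y2 1 1] by simp

lemma L_diff: "(x1, y1) \<in> L \<Longrightarrow> (x2, y2) \<in> L \<Longrightarrow> (x1 - x2, y1 - y2) \<in> L"
  using L_comb[of x1 y1 x2 y2 1 "-1"] by simp

lemma L_uminus: "(x, y) \<in> L \<Longrightarrow> (- x, - y) \<in> L"
  using L_comb[of x y x y 0 "-1"] by simp

lemma L_n: "(n * x, n * y) \<in> L"
proof -
  have "n * x = \<alpha> * (\<delta> * x - \<beta> * y) + \<beta> * (\<alpha> * y)" "n * y = \<delta> * (\<alpha> * y)"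
    using n by (simp_all add: algebra_simps flip: n)
  then show ?thesis unfolding lat_def by blast
qed

lemma L_det: "(x1, y1) \<in> L \<Longrightarrow> (x2, y2) \<in> L \<Longrightarrow> n dvd x1 * y2 - x2 * y1"
proof -
  assume "(x1, y1) \<in> L" "(x2, y2) \<in> L"
  then obtain a b c d where "x1 = \<alpha> * a + \<beta> * b" "y1 = \<delta> * b" "x2 = \<alpha> * c + \<beta> * d" "y2 = \<delta> * d"
    unfolding lat_def by blast
  then have "x1 * y2 - x2 * y1 = n * (a * d - c * b)" by (simp add: algebra_simps flip: n)
  then show ?thesis by simp
qed

lemma L_basis:
  assumes "(x1, y1) \<in> L" "(x2, y2) \<in> L" "\<bar>x1 * y2 - x2 * y1\<bar> = n" "(x, y) \<in> L"
  obtains k l where "x = k * x1 + l * x2" "y = k * y1 + l * y2"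
proof -
  define D where "D = x1 * y2 - x2 * y1"
  have "D dvd n" "D \<noteq> 0" using assms(3) n_pos by (auto simp: D_def)
  then obtain k l where k: "x * y2 - x2 * y = D * k" and l: "x1 * y - x * y1 = D * l"
    using L_det[OF assms(4,2)] L_det[OF assms(1,4)] by (meson dvdE dvd_trans)
  have "D * x = (x * y2 - x2 * y) * x1 + (x1 * y - x * y1) * x2"
    "D * y = (x * y2 - x2 * y) * y1 + (x1 * y - x * y1) * y2"
    by (simp_all add: D_def algebra_simps)
  then have "D * x = D * (k * x1 + l * x2)" "D * y = D * (k * y1 + l * y2)"
    unfolding k l by (simp_all add: algebra_simps)
  then show ?thesis using that \<open>D \<noteq> 0\<close> by simp
qed

definition K where "K = 4 * n"

definition box_class :: "bool \<times> bool \<Rightarrow> (int \<times> int) set" where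
  "box_class c = {(x, y) \<in> L. parity x y = c \<and> \<bar>x\<bar> \<le> K \<and> \<bar>y\<bar> \<le> K}"

lemma finite_box_class: "finite (box_class c)"
proof (rule finite_subset)
  show "box_class c \<subseteq> {-K..K} \<times> {-K..K}" by (auto simp: box_class_def)
qed simp

text \<open>Translations by \<open>2 n \<int>\<^sup>2\<close> preserve the lattice and the parity class, so finitely many
  vectors suffice to compute the minima of all nonnegative forms; this makes the minima continuous.\<close>

lemma box_class_dominates:
  assumes "(x, y) \<in> L" "parity x y = c"
  shows "\<exists>(x', y') \<in> box_class c. \<bar>x'\<bar> \<le> \<bar>x\<bar> \<and> \<bar>y'\<bar> \<le> \<bar>y\<bar> \<and> \<bar>x' + y'\<bar> \<le> \<bar>x + y\<bar>"
  using assms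
proof (induction "nat (\<bar>x\<bar> + \<bar>y\<bar>)" arbitrary: x y rule: less_induct)
  case less
  show ?case
  proof (cases "\<bar>x\<bar> \<le> K \<and> \<bar>y\<bar> \<le> K")
    case True then show ?thesis using less.prems by (auto simp: box_class_def)
  next
    case False
    define s where "s = 2 * n"
    have K: "K = 2 * s" and s: "s > 0" using n_pos by (auto simp: K_def s_def)
    have L0: "(s * a, s * b) \<in> L" for a b using L_n[of "2 * a" "2 * b"] by (simp add: s_def mult.assoc mult.left_commute)
    have par: "parity (x + s * a) (y + s * b) = c" for a b using less.prems by (simp add: s_def)
    have step: ?thesis if "\<bar>x + s * a\<bar> \<le> \<bar>x\<bar>" "\<bar>y + s * b\<bar> \<le> \<bar>y\<bar>" "\<bar>x + y + s * (a + b)\<bar> \<le> \<bar>x + y\<bar>"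
      "\<bar>x + s * a\<bar> + \<bar>y + s * b\<bar> < \<bar>x\<bar> + \<bar>y\<bar>" for a b
    proof -
      have "nat (\<bar>x + s * a\<bar> + \<bar>y + s * b\<bar>) < nat (\<bar>x\<bar> + \<bar>y\<bar>)" using that(4) by linarith
      from less.hyps[OF this L_add[OF less.prems(1) L0] par]
      obtain x' y' where w: "(x', y') \<in> box_class c" "\<bar>x'\<bar> \<le> \<bar>x + s * a\<bar>" "\<bar>y'\<bar> \<le> \<bar>y + s * b\<bar>"
        "\<bar>x' + y'\<bar> \<le> \<bar>(x + s * a) + (y + s * b)\<bar>" by blast
      have "(x + s * a) + (y + s * b) = x + y + s * (a + b)" by (simp add: algebra_simps)
      then have "\<bar>x' + y'\<bar> \<le> \<bar>x + y\<bar>" using w(4) that(3) by simp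
      moreover have "\<bar>x'\<bar> \<le> \<bar>x\<bar>" "\<bar>y'\<bar> \<le> \<bar>y\<bar>" using w(2,3) that(1,2) by (blast intro: order_trans)+
      ultimately show ?thesis using w(1) by blast
    qed
    \<comment> \<open>A coordinate beyond 2 s is moved by s towards 0. If the other one lies beyond
      s on the opposite side, it is moved too and x + y is kept; otherwise |x + y| is larger than s,
      and the move does not increase it.\<close>
    have "x > 2 * s \<or> x < - 2 * s \<or> y > 2 * s \<or> y < - 2 * s"
      using False unfolding K abs_le_iff by linarith
    then consider "x > 2 * s" | "x < - 2 * s" | "y > 2 * s" | "y < - 2 * s" by blast
    then show ?thesis
    proof cases
      case 1
      show ?thesis
      proof (cases "y < - s")
        case True then show ?thesis using 1 s by (intro step[of "-1" "1"]) auto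
      next
        case False then show ?thesis using 1 s by (intro step[of "-1" "0"]) auto
      qed
    next
      case 2
      show ?thesis
      proof (cases "y > s")
        case True then show ?thesis using 2 s by (intro step[of "1" "-1"]) auto
      next
        case False then show ?thesis using 2 s by (intro step[of "1" "0"]) auto
      qed
    next
      case 3
      show ?thesis
      proof (cases "x < - s")
        case True then show ?thesis using 3 s by (intro step[of "1" "-1"]) auto
      next
        case False then show ?thesis using 3 s by (intro step[of "0" "-1"]) auto
      qed
    next
      case 4
      show ?thesis
      proof (cases "x > s")
        case True then show ?thesis using 4 s by (intro step[of "-1" "1"]) auto
      next
        case False then show ?thesis using 4 s by (intro step[of "0" "1"]) auto
      qed
    qed
  qed
qed

definition class_min :: "bool \<times> bool \<Rightarrow> real \<times> real \<times> real \<Rightarrow> real" where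
  "class_min c v = Min ((\<lambda>(x, y). rval v x y) ` box_class c)"

text \<open>A form with nonnegative parameters is monotone in |x|, |y| and |x + y|, so the minimum
  over the finite box bounds the form on the whole class.\<close>

lemma class_min_le:
  assumes "(x, y) \<in> L" "parity x y = c" "A \<ge> 0" "B \<ge> 0" "C \<ge> 0"
  shows "class_min c (A, B, C) \<le> rval (A, B, C) x y"
proof -
  obtain x' y' where w: "(x', y') \<in> box_class c" "\<bar>x'\<bar> \<le> \<bar>x\<bar>" "\<bar>y'\<bar> \<le> \<bar>y\<bar>" "\<bar>x' + y'\<bar> \<le> \<bar>x + y\<bar>"
    using box_class_dominates[OF assms(1,2)] by blast
  have sq: "(real_of_int a)\<^sup>2 \<le> (real_of_int b)\<^sup>2" if "\<bar>a\<bar> \<le> \<bar>b\<bar>" for a b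
    using that by (metis abs_le_square_iff of_int_abs of_int_le_iff)
  have "class_min c (A, B, C) \<le> rval (A, B, C) x' y'"
    unfolding class_min_def using w(1) finite_box_class by (intro Min_le) (auto intro!: image_eqI[of _ _ "(x', y')"])
  also have "\<dots> \<le> rval (A, B, C) x y"
    unfolding selling_val_simp using sq[OF w(2)] sq[OF w(3)] sq[OF w(4)] assms
    by (intro add_mono mult_left_mono) auto
  finally show ?thesis .
qed

text \<open>Any two of (\<alpha>, 0), (\<beta>, \<delta>) and their sum form a basis of L, and
  because \<alpha> and \<delta> are odd these three vectors represent the three nonzero
  classes.\<close>

lemma exists_basis:
  assumes "c1 \<noteq> c2" "c1 \<noteq> (False, False)" "c2 \<noteq> (False, False)"
  shows "\<exists>x1 y1 x2 y2. (x1, y1) \<in> L \<and> (x2, y2) \<in> L \<and> parity x1 y1 = c1 \<and> parity x2 y2 = c2 \<and>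
    \<bar>x1 * y2 - x2 * y1\<bar> = n"
proof -
  have "odd (\<alpha> * \<delta>)" using odd_n n by simp
  then have o: "odd \<alpha>" "odd \<delta>" by simp_all
  have b: "(\<alpha>, 0) \<in> L" "(\<beta>, \<delta>) \<in> L"
    using exI[of "\<lambda>k. \<exists>l. \<alpha> = \<alpha> * k + \<beta> * l \<and> 0 = \<delta> * l" 1] exI[of "\<lambda>k. \<exists>l. \<beta> = \<alpha> * k + \<beta> * l \<and> \<delta> = \<delta> * l" 0]
    unfolding lat_def by force+
  note b = b L_add[OF b, unfolded add_0]
  have np: "\<bar>n\<bar> = n" using n_pos by simp
  have d: "\<bar>\<alpha> * \<delta> - \<beta> * 0\<bar> = n" "\<bar>\<beta> * 0 - \<alpha> * \<delta>\<bar> = n" "\<bar>\<alpha> * \<delta> - (\<alpha> + \<beta>) * 0\<bar> = n"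
    "\<bar>(\<alpha> + \<beta>) * 0 - \<alpha> * \<delta>\<bar> = n" "\<bar>\<beta> * \<delta> - (\<alpha> + \<beta>) * \<delta>\<bar> = n" "\<bar>(\<alpha> + \<beta>) * \<delta> - \<beta> * \<delta>\<bar> = n"
    using np n by (simp_all add: algebra_simps)
  have p: "parity \<alpha> 0 = (True, False)" "parity \<beta> \<delta> = (odd \<beta>, True)" "parity (\<alpha> + \<beta>) \<delta> = (even \<beta>, True)"
    using o by auto
  have cover: "c = parity \<alpha> 0 \<or> c = parity \<beta> \<delta> \<or> c = parity (\<alpha> + \<beta>) \<delta>" if "c \<noteq> (False, False)" for c
    using that unfolding p by (cases c) auto
  have wit: ?thesis if "(x1, y1) \<in> L" "(x2, y2) \<in> L" "c1 = parity x1 y1" "c2 = parity x2 y2"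
    "\<bar>x1 * y2 - x2 * y1\<bar> = n" for x1 y1 x2 y2
    using that by metis
  from cover[OF assms(2)] cover[OF assms(3)] show ?thesis
  proof (elim disjE)
    assume "c1 = parity \<alpha> 0" "c2 = parity \<alpha> 0"
    then show ?thesis using assms(1) by simp
  next
    assume "c1 = parity \<alpha> 0" "c2 = parity \<beta> \<delta>"
    then show ?thesis by (rule wit[OF b(1) b(2) _ _ d(1)])
  next
    assume "c1 = parity \<alpha> 0" "c2 = parity (\<alpha> + \<beta>) \<delta>"
    then show ?thesis by (rule wit[OF b(1) b(3) _ _ d(3)])
  next
    assume "c1 = parity \<beta> \<delta>" "c2 = parity \<alpha> 0"
    then show ?thesis by (rule wit[OF b(2) b(1) _ _ d(2)])
  next
    assume "c1 = parity \<beta> \<delta>" "c2 = parity \<beta> \<delta>"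
    then show ?thesis using assms(1) by simp
  next
    assume "c1 = parity \<beta> \<delta>" "c2 = parity (\<alpha> + \<beta>) \<delta>"
    then show ?thesis by (rule wit[OF b(2) b(3) _ _ d(5)])
  next
    assume "c1 = parity (\<alpha> + \<beta>) \<delta>" "c2 = parity \<alpha> 0"
    then show ?thesis by (rule wit[OF b(3) b(1) _ _ d(4)])
  next
    assume "c1 = parity (\<alpha> + \<beta>) \<delta>" "c2 = parity \<beta> \<delta>"
    then show ?thesis by (rule wit[OF b(3) b(2) _ _ d(6)])
  next
    assume "c1 = parity (\<alpha> + \<beta>) \<delta>" "c2 = parity (\<alpha> + \<beta>) \<delta>"
    then show ?thesis using assms(1) by simp
  qed
qed

text \<open>The minima of a form on the three parity classes \<open>c1, c2, c3\<close> of the lattice are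
  \<open>A' + C'\<close>, \<open>B' + C'\<close>, \<open>A' + B'\<close> for its Selling parameters \<open>(A', B', C')\<close> with respect to a
  reduced basis of the lattice, so a fixed point of \<open>move\<close> is a form for which this basis is the
  matrix of a similitude.\<close>

definition move :: "(bool \<times> bool) \<Rightarrow> (bool \<times> bool) \<Rightarrow> (bool \<times> bool) \<Rightarrow> real \<times> real \<times> real \<Rightarrow> real \<times> real \<times> real" where
  "move c1 c2 c3 v = (let s = class_min c1 v + class_min c2 v + class_min c3 v in
     ((class_min c1 v + class_min c3 v - class_min c2 v) / s, (class_min c2 v + class_min c3 v - class_min c1 v) / s, (class_min c1 v + class_min c2 v - class_min c3 v) / s))"

lemma box_class_nonempty: "c \<noteq> (False, False) \<Longrightarrow> box_class c \<noteq> {}"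
proof -
  assume c: "c \<noteq> (False, False)"
  obtain c' where "c \<noteq> c'" "c' \<noteq> (False, False)" by (metis Pair_inject)
  then obtain x y where "(x, y) \<in> L" "parity x y = c" using exists_basis[of c c'] c by blast
  then show ?thesis using box_class_dominates by blast
qed

lemma class_min_attained:
  assumes "c \<noteq> (False, False)"
  obtains x y where "(x, y) \<in> L" "parity x y = c" "class_min c v = rval v x y"
proof -
  have "class_min c v \<in> (\<lambda>(x, y). rval v x y) ` box_class c"
    unfolding class_min_def using finite_box_class box_class_nonempty[OF assms] by (intro Min_in) auto
  then show ?thesis using that by (auto simp: box_class_def)
qed

lemma rval_nonneg: "A \<ge> 0 \<Longrightarrow> B \<ge> 0 \<Longrightarrow> C \<ge> 0 \<Longrightarrow> rval (A, B, C) x y \<ge> 0"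
  by (simp add: selling_val_simp)

lemma rval_parallelogram:
  "rval v (x1 + x2) (y1 + y2) + rval v (x1 - x2) (y1 - y2) = 2 * rval v x1 y1 + 2 * rval v x2 y2"
  by (cases v) (simp add: selling_val_simp power2_eq_square algebra_simps)

lemma continuous_on_class_min: "c \<noteq> (False, False) \<Longrightarrow> continuous_on S (class_min c)"
proof -
  assume "c \<noteq> (False, False)"
  then have "continuous_on S (\<lambda>v. Min ((\<lambda>w. case w of (x, y) \<Rightarrow> rval v x y) ` box_class c))"
    by (intro continuous_on_Min_image finite_box_class box_class_nonempty)
      (auto simp: selling_val_def case_prod_unfold intro!: continuous_intros)
  then show ?thesis by (simp add: class_min_def[abs_def])
qed

text \<open>The classes excluded by \<open>rot\<close> are those of (1, 0), (0, 1), (1, -1), so (c1,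
  c2, c3) permutes the nonzero classes without fixed points. It describes the columns of a matrix of
  order 3 modulo 2, that is, of odd determinant and odd trace.\<close>

context
  fixes c1 c2 c3 :: "bool \<times> bool"
  assumes c: "c1 \<noteq> (False, False)" "c2 \<noteq> (False, False)" "c3 \<noteq> (False, False)"
    and dist: "c1 \<noteq> c2" "c1 \<noteq> c3" "c2 \<noteq> c3"
    and rot: "c1 \<noteq> (True, False)" "c2 \<noteq> (False, True)" "c3 \<noteq> (True, True)"
begin

lemma parity_add:
  shows "parity x1 y1 = c1 \<Longrightarrow> parity x2 y2 = c2 \<Longrightarrow> parity (x1 + x2) (y1 + y2) = c3"
    "parity x1 y1 = c1 \<Longrightarrow> parity x2 y2 = c3 \<Longrightarrow> parity (x1 + x2) (y1 + y2) = c2"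
    "parity x1 y1 = c2 \<Longrightarrow> parity x2 y2 = c3 \<Longrightarrow> parity (x1 + x2) (y1 + y2) = c1"
  using c dist by (cases c1; cases c2; cases c3; force)+

lemma class_min_nonneg: "A \<ge> 0 \<Longrightarrow> B \<ge> 0 \<Longrightarrow> C \<ge> 0 \<Longrightarrow> k \<in> {c1, c2, c3} \<Longrightarrow> class_min k (A, B, C) \<ge> 0"
  using class_min_attained[of k "(A, B, C)"] rval_nonneg c by (metis empty_iff insert_iff)

text \<open>Sum and difference of two minimisers both lie in the third class, so the parallelogram
  law bounds its minimum. These inequalities make the coordinates of \<open>move\<close>
  nonnegative.\<close>

lemma class_min_triangle:
  assumes "A \<ge> 0" "B \<ge> 0" "C \<ge> 0"
  shows "class_min c3 (A, B, C) \<le> class_min c1 (A, B, C) + class_min c2 (A, B, C)"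
    "class_min c2 (A, B, C) \<le> class_min c1 (A, B, C) + class_min c3 (A, B, C)"
    "class_min c1 (A, B, C) \<le> class_min c2 (A, B, C) + class_min c3 (A, B, C)"
proof -
  let ?v = "(A, B, C)"
  have gen: "class_min k3 ?v \<le> class_min k1 ?v + class_min k2 ?v"
    if k: "k1 \<noteq> (False, False)" "k2 \<noteq> (False, False)"
      and add: "\<And>x1 y1 x2 y2. parity x1 y1 = k1 \<Longrightarrow> parity x2 y2 = k2 \<Longrightarrow> parity (x1 + x2) (y1 + y2) = k3"
    for k1 k2 k3
  proof -
    obtain x1 y1 where 1: "(x1, y1) \<in> L" "parity x1 y1 = k1" "class_min k1 ?v = rval ?v x1 y1" using class_min_attained[OF k(1)] .
    obtain x2 y2 where 2: "(x2, y2) \<in> L" "parity x2 y2 = k2" "class_min k2 ?v = rval ?v x2 y2" using class_min_attained[OF k(2)] .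
    have "class_min k3 ?v \<le> rval ?v (x1 + x2) (y1 + y2)"
      by (rule class_min_le[OF L_add[OF 1(1) 2(1)] add[OF 1(2) 2(2)] assms])
    moreover have "parity (x1 - x2) (y1 - y2) = k3" using add[OF 1(2) 2(2)] by simp
    then have "class_min k3 ?v \<le> rval ?v (x1 - x2) (y1 - y2)"
      using class_min_le[OF L_diff[OF 1(1) 2(1)] _ assms] by blast
    ultimately show ?thesis using rval_parallelogram[of ?v x1 x2 y1 y2] 1(3) 2(3) by linarith
  qed
  show "class_min c3 ?v \<le> class_min c1 ?v + class_min c2 ?v" by (rule gen[OF c(1,2) parity_add(1)])
  show "class_min c2 ?v \<le> class_min c1 ?v + class_min c3 ?v" by (rule gen[OF c(1,3) parity_add(2)])
  show "class_min c1 ?v \<le> class_min c2 ?v + class_min c3 ?v" by (rule gen[OF c(2,3) parity_add(3)])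
qed

text \<open>A positive parameter confines the zeros of the form to a line, and the integral points
  of nonzero parity on that line share one class. Hence at most one class minimum is 0, and
  \<open>rot\<close> prevents a vertex of the simplex from being a fixed point.\<close>

lemma class_min_zero:
  assumes "A \<ge> 0" "B \<ge> 0" "C \<ge> 0" "k \<noteq> (False, False)" "class_min k (A, B, C) = 0"
  shows "A > 0 \<Longrightarrow> k = (False, True)" "B > 0 \<Longrightarrow> k = (True, False)" "C > 0 \<Longrightarrow> k = (True, True)"
proof -
  obtain x y where w: "(x, y) \<in> L" "parity x y = k" "class_min k (A, B, C) = rval (A, B, C) x y"
    using class_min_attained[OF assms(4)] .
  have "0 \<le> A * (real_of_int x)\<^sup>2" "0 \<le> B * (real_of_int y)\<^sup>2" "0 \<le> C * (real_of_int x + real_of_int y)\<^sup>2"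
    using assms by simp_all
  then have z: "A * (real_of_int x)\<^sup>2 = 0" "B * (real_of_int y)\<^sup>2 = 0" "C * (real_of_int x + real_of_int y)\<^sup>2 = 0"
    using w(3) assms(5) unfolding selling_val_simp by linarith+
  show "A > 0 \<Longrightarrow> k = (False, True)" using z(1) w(2) assms(4) by auto
  show "B > 0 \<Longrightarrow> k = (True, False)" using z(2) w(2) assms(4) by auto
  show "C > 0 \<Longrightarrow> k = (True, True)"
  proof -
    assume "C > 0"
    then have "real_of_int (x + y) = 0" using z(3) by simp
    then have "x = - y" by linarith
    then show ?thesis using w(2) assms(4) by auto
  qed
qed

lemma class_min_sum_pos:
  assumes "(A, B, C) \<in> param_simplex"
  shows "class_min c1 (A, B, C) + class_min c2 (A, B, C) + class_min c3 (A, B, C) > 0"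
proof (rule ccontr)
  assume neg: "\<not> ?thesis"
  have p: "A \<ge> 0" "B \<ge> 0" "C \<ge> 0" "A + B + C = 1" using assms by (auto simp: param_simplex_def)
  have z: "class_min c1 (A, B, C) = 0" "class_min c2 (A, B, C) = 0"
    using neg class_min_nonneg[OF p(1-3)] by (smt (verit) insertCI)+
  consider "A > 0" | "B > 0" | "C > 0" using p by linarith
  then show False
    using class_min_zero[OF p(1-3) c(1) z(1)] class_min_zero[OF p(1-3) c(2) z(2)] dist by cases auto
qed

lemma move_fixpoint:
  obtains A B C \<mu> where "(A, B, C) \<in> param_simplex" "\<mu> > 0"
    "class_min c1 (A, B, C) = \<mu> * (A + C)" "class_min c2 (A, B, C) = \<mu> * (B + C)" "class_min c3 (A, B, C) = \<mu> * (A + B)"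
proof -
  have "move c1 c2 c3 v \<in> param_simplex" if "v \<in> param_simplex" for v
  proof -
    obtain A B C where v: "v = (A, B, C)" by (cases v)
    have p: "A \<ge> 0" "B \<ge> 0" "C \<ge> 0" using that by (auto simp: v param_simplex_def)
    have s: "class_min c1 v + class_min c2 v + class_min c3 v > 0" using class_min_sum_pos that v by simp
    then show ?thesis using class_min_triangle[OF p]
      by (simp add: move_def Let_def param_simplex_def v flip: add_divide_distrib)
  qed
  moreover have "continuous_on param_simplex (move c1 c2 c3)"
    unfolding move_def[abs_def] Let_def using class_min_sum_pos
    by (intro continuous_on_Pair continuous_on_divide continuous_on_add continuous_on_diff continuous_on_class_min c) fastforce+
  moreover have "(1, 0, 0) \<in> param_simplex" by (simp add: param_simplex_def)
  ultimately obtain v where v: "v \<in> param_simplex" "move c1 c2 c3 v = v"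
    using brouwer[OF compact_param_simplex convex_param_simplex] by blast
  obtain A B C where abc: "v = (A, B, C)" by (cases v)
  define s where "s = class_min c1 v + class_min c2 v + class_min c3 v"
  have s: "s > 0" using class_min_sum_pos v(1) unfolding s_def abc by simp
  have "(class_min c1 v + class_min c3 v - class_min c2 v) / s = A" "(class_min c2 v + class_min c3 v - class_min c1 v) / s = B" "(class_min c1 v + class_min c2 v - class_min c3 v) / s = C"
    using v(2) unfolding move_def Let_def s_def by (simp_all add: abc)
  then have "class_min c1 v + class_min c3 v - class_min c2 v = A * s" "class_min c2 v + class_min c3 v - class_min c1 v = B * s" "class_min c1 v + class_min c2 v - class_min c3 v = C * s"
    using s by (simp_all add: field_simps)
  \<comment> \<open>Adding the fixed point equations in pairs leaves twice one minimum, so the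
    multiplier is s / 2.\<close>
  then have "class_min c1 v = s / 2 * (A + C)" "class_min c2 v = s / 2 * (B + C)" "class_min c3 v = s / 2 * (A + B)"
    by (simp_all add: field_simps)
  then show ?thesis using that[of A B C "s / 2"] v(1) s by (simp add: abc)
qed

text \<open>Among the bases of L with classes c1, c2, one that minimises the sum of the values at
  its two vectors and their difference is reduced for the fixed form. The values at these vectors
  are then the class minima, to which the fixed point equations apply.\<close>

lemma exists_similitude:
  obtains A B C \<mu> x1 y1 x2 y2 where "A \<ge> 0" "B \<ge> 0" "C \<ge> 0" "A + C > 0" "B + C > 0" "A + B > 0" "\<mu> > 0"
    "(x1, y1) \<in> L" "(x2, y2) \<in> L" "parity x1 y1 = c1" "parity x2 y2 = c2" "\<bar>x1 * y2 - x2 * y1\<bar> = n"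
    "rval (A, B, C) x1 y1 = \<mu> * (A + C)" "rval (A, B, C) x2 y2 = \<mu> * (B + C)"
    "rval (A, B, C) (x1 - x2) (y1 - y2) = \<mu> * (A + B)"
proof -
  obtain A B C \<mu> where v: "(A, B, C) \<in> param_simplex" "\<mu> > 0"
    "class_min c1 (A, B, C) = \<mu> * (A + C)" "class_min c2 (A, B, C) = \<mu> * (B + C)" "class_min c3 (A, B, C) = \<mu> * (A + B)"
    using move_fixpoint .
  let ?q = "rval (A, B, C)"
  have p: "A \<ge> 0" "B \<ge> 0" "C \<ge> 0" "A + B + C = 1" using v(1) by (auto simp: param_simplex_def)
  have "A + C \<noteq> 0" using class_min_zero(2)[OF p(1-3) c(1)] v(3) rot(1) p by fastforce
  moreover have "B + C \<noteq> 0" using class_min_zero(1)[OF p(1-3) c(2)] v(4) rot(2) p by fastforce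
  moreover have "A + B \<noteq> 0" using class_min_zero(3)[OF p(1-3) c(3)] v(5) rot(3) p by fastforce
  ultimately have d: "A + C > 0" "B + C > 0" "A + B > 0" using p by linarith+
  define Bs where "Bs = {((x1, y1), (x2, y2)). (x1, y1) \<in> L \<and> (x2, y2) \<in> L \<and>
    parity x1 y1 = c1 \<and> parity x2 y2 = c2 \<and> \<bar>x1 * y2 - x2 * y1\<bar> = n}"
  define cost where "cost = (\<lambda>((x1, y1), (x2, y2)). ?q x1 y1 + ?q x2 y2 + ?q (x1 - x2) (y1 - y2))"
  obtain b0 where b0: "b0 \<in> Bs" using exists_basis[OF dist(1) c(1,2)] by (force simp: Bs_def)
  define S where "S = {b \<in> Bs. cost b \<le> cost b0}"
  have "finite S"
  proof (rule finite_subset)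
    show "S \<subseteq> {(x, y). ?q x y \<le> cost b0} \<times> {(x, y). ?q x y \<le> cost b0}"
    proof
      fix b assume b: "b \<in> S"
      obtain x1 y1 x2 y2 where bt: "b = ((x1, y1), (x2, y2))" by (metis surj_pair)
      have "cost b = ?q x1 y1 + ?q x2 y2 + ?q (x1 - x2) (y1 - y2)"
        unfolding cost_def bt prod.case ..
      moreover have "cost b \<le> cost b0" using b by (simp add: S_def)
      ultimately have "?q x1 y1 \<le> cost b0 \<and> ?q x2 y2 \<le> cost b0"
        using rval_nonneg[OF p(1-3), of x1 y1] rval_nonneg[OF p(1-3), of x2 y2]
          rval_nonneg[OF p(1-3), of "x1 - x2" "y1 - y2"] by linarith
      then show "b \<in> {(x, y). ?q x y \<le> cost b0} \<times> {(x, y). ?q x y \<le> cost b0}" by (simp add: bt)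
    qed
    show "finite ({(x, y). ?q x y \<le> cost b0} \<times> {(x, y). ?q x y \<le> cost b0})"
      using finite_rval_le[OF p(1-3)] d by (intro finite_cartesian_product) (auto simp: add.commute)
  qed
  moreover have b0S: "b0 \<in> S" using b0 by (simp add: S_def)
  then have "S \<noteq> {}" by blast
  ultimately obtain b where b: "b \<in> S" "\<And>b'. b' \<in> S \<Longrightarrow> cost b \<le> cost b'"
    using arg_min_if_finite(1)[of S cost] arg_min_least[of S _ cost] by blast
  have bB: "b \<in> Bs" using b(1) by (simp add: S_def)
  have min: "cost b \<le> cost b'" if "b' \<in> Bs" for b'
    using b(2)[OF b0S] b(2)[of b'] that by (cases "cost b' \<le> cost b0") (auto simp: S_def)
  obtain x1 y1 x2 y2 where bt: "b = ((x1, y1), (x2, y2))" by (metis surj_pair)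
  have B: "(x1, y1) \<in> L" "(x2, y2) \<in> L" "parity x1 y1 = c1" "parity x2 y2 = c2" "\<bar>x1 * y2 - x2 * y1\<bar> = n"
    using bB by (auto simp: Bs_def bt)
  define A' B' C' where "A' = (?q x1 y1 + ?q (x1 - x2) (y1 - y2) - ?q x2 y2) / 2"
    and "B' = (?q x2 y2 + ?q (x1 - x2) (y1 - y2) - ?q x1 y1) / 2"
    and "C' = (?q x1 y1 + ?q x2 y2 - ?q (x1 - x2) (y1 - y2)) / 2"
  have q_eq: "?q (k * x1 + l * x2) (k * y1 + l * y2) = rval (A', B', C') k l" for k l
    by (simp add: A'_def B'_def C'_def selling_val_simp field_simps power2_eq_square)
  have q3: "?q (- x) (- y) = ?q x y" for x y by (simp add: selling_val_simp power2_eq_square algebra_simps)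
  \<comment> \<open>Each of the next three changes of basis keeps the classes and alters exactly one
    of the three values, by 4 C', 4 A' and 4 B' respectively.\<close>
  have C': "C' \<ge> 0"
  proof -
    have "((x1, y1), (- x2, - y2)) \<in> Bs"
      using B L_uminus[OF B(2)] by (auto simp: Bs_def abs_minus_commute)
    from min[OF this] show ?thesis
      using q_eq[of 1 1] q3[of x2 y2] by (simp add: cost_def bt C'_def selling_val_simp power2_eq_square algebra_simps)
  qed
  have A': "A' \<ge> 0"
  proof -
    have "(2 * x1 - x2, 2 * y1 - y2) \<in> L" using L_comb[OF B(1,2), of 2 "-1"] by simp
    moreover have "x1 * (2 * y1 - y2) - (2 * x1 - x2) * y1 = - (x1 * y2 - x2 * y1)" by (simp add: algebra_simps)
    ultimately have "((x1, y1), (2 * x1 - x2, 2 * y1 - y2)) \<in> Bs"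
      using B by (auto simp: Bs_def)
    from min[OF this] show ?thesis
      by (simp add: cost_def bt A'_def selling_val_simp power2_eq_square algebra_simps)
  qed
  have B': "B' \<ge> 0"
  proof -
    have "(2 * x2 - x1, 2 * y2 - y1) \<in> L" using L_comb[OF B(1,2), of "-1" 2] by (simp add: algebra_simps)
    moreover have "(2 * x2 - x1) * y2 - x2 * (2 * y2 - y1) = - (x1 * y2 - x2 * y1)" by (simp add: algebra_simps)
    ultimately have "((2 * x2 - x1, 2 * y2 - y1), (x2, y2)) \<in> Bs"
      using B by (auto simp: Bs_def)
    from min[OF this] show ?thesis
      by (simp add: cost_def bt B'_def selling_val_simp power2_eq_square algebra_simps)
  qed
  have sums: "?q x1 y1 = A' + C'" "?q x2 y2 = B' + C'" "?q (x1 - x2) (y1 - y2) = A' + B'"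
    by (simp_all add: A'_def B'_def C'_def field_simps)
  have kl: "\<exists>k l. x = k * x1 + l * x2 \<and> y = k * y1 + l * y2" if "(x, y) \<in> L" for x y
    using L_basis[OF B(1,2,5) that] by metis
  have par0: "parity (k * x1 + l * x2) (k * y1 + l * y2) =
    (if odd k then (if odd l then c3 else c1) else (if odd l then c2 else (False, False)))" for k l
    using B(3,4) parity_add(1)[OF B(3,4)] by auto
  have "class_min c1 (A, B, C) = ?q x1 y1"
  proof (rule antisym)
    show "class_min c1 (A, B, C) \<le> ?q x1 y1" by (rule class_min_le[OF B(1,3) p(1-3)])
    obtain x y where w: "(x, y) \<in> L" "parity x y = c1" "class_min c1 (A, B, C) = ?q x y" using class_min_attained[OF c(1)] .
    obtain k l where k: "x = k * x1 + l * x2" "y = k * y1 + l * y2" using kl[OF w(1)] by blast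
    have "odd k" "even l" using par0[of k l] w(2) dist c unfolding k by (auto split: if_splits)
    then show "?q x1 y1 \<le> class_min c1 (A, B, C)"
      using selling_val_ge(1)[OF A' B' C', of k l] w(3) q_eq[of k l] sums(1) unfolding k by simp
  qed
  moreover have "class_min c2 (A, B, C) = ?q x2 y2"
  proof (rule antisym)
    show "class_min c2 (A, B, C) \<le> ?q x2 y2" by (rule class_min_le[OF B(2,4) p(1-3)])
    obtain x y where w: "(x, y) \<in> L" "parity x y = c2" "class_min c2 (A, B, C) = ?q x y" using class_min_attained[OF c(2)] .
    obtain k l where k: "x = k * x1 + l * x2" "y = k * y1 + l * y2" using kl[OF w(1)] by blast
    have "even k" "odd l" using par0[of k l] w(2) dist c unfolding k by (auto split: if_splits)
    then show "?q x2 y2 \<le> class_min c2 (A, B, C)"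
      using selling_val_ge(2)[OF A' B' C', of k l] w(3) q_eq[of k l] sums(2) unfolding k by simp
  qed
  moreover have "class_min c3 (A, B, C) = ?q (x1 - x2) (y1 - y2)"
  proof (rule antisym)
    have "parity (x1 - x2) (y1 - y2) = c3" using parity_add(1)[OF B(3,4)] by simp
    then show "class_min c3 (A, B, C) \<le> ?q (x1 - x2) (y1 - y2)" by (rule class_min_le[OF L_diff[OF B(1,2)] _ p(1-3)])
    obtain x y where w: "(x, y) \<in> L" "parity x y = c3" "class_min c3 (A, B, C) = ?q x y" using class_min_attained[OF c(3)] .
    obtain k l where k: "x = k * x1 + l * x2" "y = k * y1 + l * y2" using kl[OF w(1)] by blast
    have "odd k" "odd l" using par0[of k l] w(2) dist c unfolding k by (auto split: if_splits)
    then show "?q (x1 - x2) (y1 - y2) \<le> class_min c3 (A, B, C)"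
      using selling_val_ge(3)[OF A' B' C', of k l] w(3) q_eq[of k l] sums(3) unfolding k by simp
  qed
  ultimately show ?thesis using that[OF p(1-3) d v(2) B] v by simp
qed

end

end

text \<open>Let G be the Gram matrix with rows (a, b), (b, c) and M the matrix with columns (p, s),
  (r, u); the hypotheses say M^T G M = \<mu> G. Determinants give det M = \<plusminus>\<mu>, and the
  negative sign forces trace 0. For det M = \<mu> the relation becomes linear in M and says that (s,
  u - p, - r) is proportional to (a, 2 b, c). So the form is a real multiple of an integral one read
  off from M, and its three parameters have a common sign.\<close>

lemma similitude_coeffs:
  fixes A B C \<mu> :: real and p s r u n :: int
  assumes nn: "A \<ge> 0" "B \<ge> 0" "C \<ge> 0" "A + C > 0" "B + C > 0" "A + B > 0" "\<mu> > 0"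
    and n: "n > 0" "\<bar>p * u - r * s\<bar> = n" and tr: "odd (p + u)"
    and q: "rval (A, B, C) p s = \<mu> * (A + C)" "rval (A, B, C) r u = \<mu> * (B + C)"
      "rval (A, B, C) (p - r) (s - u) = \<mu> * (A + B)"
  shows "p * u - r * s = n"
    and "(u - p \<ge> 0 \<and> 2 * s - (u - p) \<ge> 0 \<and> - 2 * r - (u - p) \<ge> 0) \<or>
         (u - p \<le> 0 \<and> 2 * s - (u - p) \<le> 0 \<and> - 2 * r - (u - p) \<le> 0)"
proof -
  define a b c where "a = A + C" and "b = C" and "c = B + C"
  define P S R U where "P = real_of_int p" and "S = real_of_int s" and "R = real_of_int r" and "U = real_of_int u"
  have a: "a > 0" and c: "c > 0" using nn by (auto simp: a_def c_def)
  have \<Delta>: "a * c - b * b > 0"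
  proof -
    have "a * c - b * b = A * B + B * C + C * A" by (simp add: a_def b_def c_def algebra_simps)
    moreover have "A * B + B * C + C * A > 0"
    proof -
      consider "A > 0" "B > 0" | "B > 0" "C > 0" | "A > 0" "C > 0" using nn by linarith
      then show ?thesis using nn by cases (simp_all add: add_pos_nonneg add_nonneg_pos)
    qed
    ultimately show ?thesis by simp
  qed
  have E1: "a * P\<^sup>2 + 2 * b * P * S + c * S\<^sup>2 = \<mu> * a" and E2: "a * R\<^sup>2 + 2 * b * R * U + c * U\<^sup>2 = \<mu> * c"
    using q(1,2) by (simp_all add: selling_val_simp a_def b_def c_def P_def S_def R_def U_def power2_eq_square algebra_simps)
  have "a * (P - R)\<^sup>2 + 2 * b * (P - R) * (S - U) + c * (S - U)\<^sup>2 = \<mu> * (a - 2 * b + c)"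
    using q(3) by (simp add: selling_val_simp a_def b_def c_def P_def S_def R_def U_def power2_eq_square algebra_simps)
  then have E3: "a * P * R + b * (P * U + S * R) + c * S * U = \<mu> * b"
    using E1 E2 by (simp add: power2_eq_square algebra_simps)
  define e where "e = P * U - R * S"
  have e_int: "e = real_of_int (p * u - r * s)" by (simp add: e_def P_def S_def R_def U_def)
  have "e\<^sup>2 * (a * c - b * b) =
     (a * P\<^sup>2 + 2 * b * P * S + c * S\<^sup>2) * (a * R\<^sup>2 + 2 * b * R * U + c * U\<^sup>2) - (a * P * R + b * (P * U + S * R) + c * S * U)\<^sup>2"
    by (simp add: e_def power2_eq_square algebra_simps)
  also have "\<dots> = \<mu>\<^sup>2 * (a * c - b * b)" unfolding E1 E2 E3 by (simp add: power2_eq_square algebra_simps)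
  finally have "e\<^sup>2 = \<mu>\<^sup>2" using \<Delta> by simp
  then have em: "e = \<mu> \<or> e = - \<mu>" by (simp add: power2_eq_iff)
  have r1: "e * (P * a + S * b) = \<mu> * (U * a - S * b)"
  proof -
    have "e * (P * a + S * b) = U * (a * P\<^sup>2 + 2 * b * P * S + c * S\<^sup>2) - S * (a * P * R + b * (P * U + S * R) + c * S * U)"
      by (simp add: e_def power2_eq_square algebra_simps)
    then show ?thesis unfolding E1 E3 by (simp add: algebra_simps)
  qed
  have r2: "e * (P * b + S * c) = \<mu> * (P * b - R * a)"
  proof -
    have "e * (P * b + S * c) = P * (a * P * R + b * (P * U + S * R) + c * S * U) - R * (a * P\<^sup>2 + 2 * b * P * S + c * S\<^sup>2)"
      by (simp add: e_def power2_eq_square algebra_simps)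
    then show ?thesis unfolding E1 E3 by (simp add: algebra_simps)
  qed
  have "e \<noteq> - \<mu>"
  proof
    assume "e = - \<mu>"
    then have "\<mu> * (P * a + S * b) = \<mu> * (- (U * a - S * b))" using r1 by (simp add: algebra_simps)
    then have "P * a + S * b = - (U * a - S * b)" using nn(7) by (metis mult_cancel_left less_irrefl)
    then have "(P + U) * a = 0" by (simp add: algebra_simps)
    then have "P + U = 0" using a by simp
    then have "p + u = 0" unfolding P_def U_def by linarith
    then show False using tr by simp
  qed
  then have e: "e = \<mu>" using em by blast
  then have "p * u - r * s > 0" using e_int nn(7) by (metis of_int_0_less_iff)
  then show "p * u - r * s = n" using n(2) by linarith
  have "P * a + S * b = U * a - S * b" using r1 nn(7) unfolding e by (metis mult_cancel_left less_irrefl)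
  then have k1: "(U - P) * a = 2 * S * b" by (simp add: algebra_simps)
  have "P * b + S * c = P * b - R * a" using r2 nn(7) unfolding e by (metis mult_cancel_left less_irrefl)
  then have k2: "S * c = - R * a" by (simp add: algebra_simps)
  define k where "k = S / a"
  have S: "S = k * a" using a by (simp add: k_def)
  have R: "R = - k * c"
  proof -
    have "R * a = (- k * c) * a" using k2 unfolding S by (simp add: algebra_simps)
    then show ?thesis using a by (metis mult_right_cancel less_irrefl)
  qed
  have UP: "U - P = 2 * k * b"
  proof -
    have "(U - P) * a = (2 * k * b) * a" using k1 unfolding S by (simp add: algebra_simps)
    then show ?thesis using a by simp
  qed
  have K: "U - P = 2 * (k * C)" "2 * S - (U - P) = 2 * (k * A)" "- 2 * R - (U - P) = 2 * (k * B)"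
    unfolding UP S R by (simp_all add: a_def b_def c_def algebra_simps)
  have kk: "real_of_int (u - p) = 2 * (k * C)" "real_of_int (2 * s - (u - p)) = 2 * (k * A)" "real_of_int (- 2 * r - (u - p)) = 2 * (k * B)"
    using K by (simp_all add: P_def S_def R_def U_def)
  show "(u - p \<ge> 0 \<and> 2 * s - (u - p) \<ge> 0 \<and> - 2 * r - (u - p) \<ge> 0) \<or>
         (u - p \<le> 0 \<and> 2 * s - (u - p) \<le> 0 \<and> - 2 * r - (u - p) \<le> 0)"
  proof (cases "k \<ge> 0")
    case True
    then have "k * C \<ge> 0" "k * A \<ge> 0" "k * B \<ge> 0" using nn by simp_all
    then have "real_of_int (u - p) \<ge> 0" "real_of_int (2 * s - (u - p)) \<ge> 0" "real_of_int (- 2 * r - (u - p)) \<ge> 0"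
      unfolding kk by simp_all
    then show ?thesis by linarith
  next
    case False
    then have "k * C \<le> 0" "k * A \<le> 0" "k * B \<le> 0" using nn by (simp_all add: mult_nonpos_nonneg)
    then have "real_of_int (u - p) \<le> 0" "real_of_int (2 * s - (u - p)) \<le> 0" "real_of_int (- 2 * r - (u - p)) \<le> 0"
      unfolding kk by linarith+
    then show ?thesis by linarith
  qed
qed

section \<open>Integral similitudes as quadruples\<close>

definition selling_quads :: "int \<Rightarrow> (int \<times> int \<times> int \<times> int) set" where
  "selling_quads n = {(t, A, B, C). odd t \<and> (A, B, C) \<in> selling_triples (4 * n - t\<^sup>2)}"

text \<open>The columns \<open>(p, s)\<close>, \<open>(r, u)\<close> of the matrix of trace \<open>t\<close> and determinant \<open>n\<close> that is a
  similitude of the form with parameters \<open>(A, B, C)\<close>.\<close>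

definition quad_matrix :: "int \<times> int \<times> int \<times> int \<Rightarrow> int \<times> int \<times> int \<times> int" where
  "quad_matrix = (\<lambda>(t, A, B, C). ((t - C) div 2, (A + C) div 2, - ((B + C) div 2), (t + C) div 2))"

text \<open>The determinant is 4 n = t^2 + A B + B C + C A rewritten. Modulo 2, determinant and
  trace are 1, so r s is odd and exactly one of p, u is odd: the parity of p tells the two residue
  classes apart.\<close>

lemma selling_quads_matrix:
  assumes "z \<in> selling_quads n" "quad_matrix z = (p, s, r, u)" "odd n"
  shows "z = (p + u, 2 * s - (u - p), - 2 * r - (u - p), u - p)" "p * u - r * s = n"
    "odd s" "odd r" "odd u = even p" "u - p > 0" "2 * s - (u - p) > 0" "- 2 * r - (u - p) > 0"
proof -
  obtain t A B C where z: "z = (t, A, B, C)" by (metis surj_pair)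
  have o: "odd t" "odd A" "odd B" "odd C" and p: "A > 0" "B > 0" "C > 0"
    and e: "A * B + B * C + C * A = 4 * n - t\<^sup>2"
    using assms by (auto simp: selling_quads_def selling_triples_def z)
  have "(t - C) div 2 = p" "(A + C) div 2 = s" "- ((B + C) div 2) = r" "(t + C) div 2 = u"
    using assms(2) by (simp_all add: quad_matrix_def z)
  then have 2: "2 * p = t - C" "2 * s = A + C" "2 * r = - (B + C)" "2 * u = t + C"
    using o by auto
  have zt: "t = p + u" "A = 2 * s - (u - p)" "B = - 2 * r - (u - p)" "C = u - p" using 2 by linarith+
  show "z = (p + u, 2 * s - (u - p), - 2 * r - (u - p), u - p)" unfolding z zt ..
  show "u - p > 0" "2 * s - (u - p) > 0" "- 2 * r - (u - p) > 0" using p(3,1,2) unfolding zt .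
  have "4 * n = 4 * (p * u - r * s)" using e unfolding zt by (simp add: power2_eq_square algebra_simps)
  then show n: "p * u - r * s = n" by simp
  show pu: "odd u = even p" using o(1) zt(1) by auto
  then have "even (p * u)" by auto
  moreover have "odd (p * u - r * s)" using n assms(3) by simp
  ultimately have "odd (r * s)" by simp
  then show "odd s" "odd r" by auto
qed

lemma selling_quadsI:
  assumes "odd (p + u)" "p * u - r * s = n" "u - p \<ge> 0" "2 * s - (u - p) \<ge> 0" "- 2 * r - (u - p) \<ge> 0"
  shows "(p + u, 2 * s - (u - p), - 2 * r - (u - p), u - p) \<in> selling_quads n"
    and "quad_matrix (p + u, 2 * s - (u - p), - 2 * r - (u - p), u - p) = (p, s, r, u)"
proof -
  have o: "odd (u - p)" "odd (2 * s - (u - p))" "odd (- 2 * r - (u - p))" using assms(1) by auto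
  then have "u - p > 0" "2 * s - (u - p) > 0" "- 2 * r - (u - p) > 0" using assms(3-5)
    by (metis dvd_0_right order_le_less)+
  then show "(p + u, 2 * s - (u - p), - 2 * r - (u - p), u - p) \<in> selling_quads n"
    using o assms(1,2) unfolding selling_quads_def selling_triples_def
    by (auto simp: power2_eq_square algebra_simps)
  show "quad_matrix (p + u, 2 * s - (u - p), - 2 * r - (u - p), u - p) = (p, s, r, u)"
    by (simp add: quad_matrix_def)
qed

text \<open>\<open>c1\<close> and \<open>c2\<close> are the columns of the residue matrix with upper
  left entry b. If the parameters read off come out nonpositive, the negative matrix is used: it has
  the same determinant and parities, and its columns still lie in L.\<close>

lemma (in odd_lattice) exists_quad:
  "\<exists>z\<in>selling_quads n. \<exists>p s r u. quad_matrix z = (p, s, r, u) \<and> (p, s) \<in> L \<and> (r, u) \<in> L \<and> odd p = b"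
proof -
  define c1 c2 c3 where "c1 = (b, True)" and "c2 = (True, \<not> b)" and "c3 = (\<not> b, b)"
  have c: "c1 \<noteq> (False, False)" "c2 \<noteq> (False, False)" "c3 \<noteq> (False, False)"
    and dist: "c1 \<noteq> c2" "c1 \<noteq> c3" "c2 \<noteq> c3"
    and rot: "c1 \<noteq> (True, False)" "c2 \<noteq> (False, True)" "c3 \<noteq> (True, True)"
    by (auto simp: c1_def c2_def c3_def)
  obtain A B C \<mu> p s r u where nn: "A \<ge> 0" "B \<ge> 0" "C \<ge> 0" "A + C > 0" "B + C > 0" "A + B > 0" "\<mu> > 0"
    and L: "(p, s) \<in> L" "(r, u) \<in> L" and par: "parity p s = c1" "parity r u = c2" and D: "\<bar>p * u - r * s\<bar> = n"
    and q: "rval (A, B, C) p s = \<mu> * (A + C)" "rval (A, B, C) r u = \<mu> * (B + C)"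
    "rval (A, B, C) (p - r) (s - u) = \<mu> * (A + B)"
    using exists_similitude[OF c dist rot] .
  have tr: "odd (p + u)" and pb: "odd p = b" using par by (auto simp: c1_def c2_def)
  note sc = similitude_coeffs[OF nn n_pos D tr q]
  from sc(2) show ?thesis
  proof (elim disjE)
    assume "u - p \<ge> 0 \<and> 2 * s - (u - p) \<ge> 0 \<and> - 2 * r - (u - p) \<ge> 0"
    then show ?thesis using selling_quadsI[OF tr sc(1)] L pb by blast
  next
    assume h: "u - p \<le> 0 \<and> 2 * s - (u - p) \<le> 0 \<and> - 2 * r - (u - p) \<le> 0"
    have tr': "odd (- p + - u)" and D': "(- p) * (- u) - (- r) * (- s) = n" using tr sc(1) by auto
    have L': "(- p, - s) \<in> L" "(- r, - u) \<in> L" "odd (- p) = b" using L_uminus L pb by auto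
    have "- u - - p \<ge> 0" "2 * - s - (- u - - p) \<ge> 0" "- 2 * - r - (- u - - p) \<ge> 0" using h by auto
    from selling_quadsI[OF tr' D' this] L' show ?thesis by blast
  qed
qed

lemma selling_val_matrix:
  fixes p s r u k l :: int
  assumes n: "p * u - r * s = n"
  shows "selling_val (2 * s - (u - p), - 2 * r - (u - p), u - p) (k * p + l * r) (k * s + l * u) =
    n * selling_val (2 * s - (u - p), - 2 * r - (u - p), u - p) k l"
  unfolding selling_val_simp n[symmetric] by (simp add: power2_eq_square algebra_simps)

text \<open>Invariance of the pairing \<open>(A, B, C), q' \<mapsto> A q'(0, 1) + B q'(1, 0) + C q'(1, -1)\<close> of two
  forms under a similitude of the first one.\<close>

lemma selling_val_pairing:
  fixes p s r u A' B' C' :: int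
  assumes n: "p * u - r * s = n"
  shows "(2 * s - (u - p)) * selling_val (A', B', C') r u + (- 2 * r - (u - p)) * selling_val (A', B', C') p s
      + (u - p) * selling_val (A', B', C') (p - r) (s - u) =
    n * ((2 * s - (u - p)) * (B' + C') + (- 2 * r - (u - p)) * (A' + C') + (u - p) * (A' + B'))"
  unfolding selling_val_simp n[symmetric] by (simp add: power2_eq_square algebra_simps)

text \<open>Written in the basis given by the second matrix, the columns of the first form an
  integral matrix N that is the identity modulo 2. As the second matrix scales its own form q' by n,
  the invariant pairing says that the values of q' at the columns of N and at their difference, with
  positive weights, add up to what the class minima give. So each value is minimal and N =
  \<plusminus>1; the sign follows from s, s' > 0.\<close>

lemma (in odd_lattice) unique_quad:
  assumes z: "z \<in> selling_quads n" "quad_matrix z = (p, s, r, u)" "(p, s) \<in> L" "(r, u) \<in> L"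
    and z': "z' \<in> selling_quads n" "quad_matrix z' = (p', s', r', u')" "(p', s') \<in> L" "(r', u') \<in> L"
    and par: "odd p = odd p'"
  shows "z = z'"
proof -
  have Z: "z = (p + u, 2 * s - (u - p), - 2 * r - (u - p), u - p)" "p * u - r * s = n"
    "odd s" "odd r" "odd u = even p" "u - p > 0" "2 * s - (u - p) > 0" "- 2 * r - (u - p) > 0"
    using selling_quads_matrix[OF z(1,2) odd_n] .
  have Z': "z' = (p' + u', 2 * s' - (u' - p'), - 2 * r' - (u' - p'), u' - p')" "p' * u' - r' * s' = n"
    "odd s'" "odd r'" "odd u' = even p'" "u' - p' > 0" "2 * s' - (u' - p') > 0" "- 2 * r' - (u' - p') > 0"
    using selling_quads_matrix[OF z'(1,2) odd_n] .
  define A B C where "A = 2 * s - (u - p)" and "B = - 2 * r - (u - p)" and "C = u - p"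
  define A' B' C' where "A' = 2 * s' - (u' - p')" and "B' = - 2 * r' - (u' - p')" and "C' = u' - p'"
  have P: "A > 0" "B > 0" "C > 0" and P': "A' > 0" "B' > 0" "C' > 0"
    using Z Z' by (auto simp: A_def B_def C_def A'_def B'_def C'_def)
  let ?q = "selling_val (A', B', C')"
  have D': "\<bar>p' * u' - r' * s'\<bar> = n" using Z'(2) n_pos by simp
  obtain k1 l1 where 1: "p = k1 * p' + l1 * r'" "s = k1 * s' + l1 * u'"
    using L_basis[OF z'(3,4) D' z(3)] by blast
  obtain k2 l2 where 2: "r = k2 * p' + l2 * r'" "u = k2 * s' + l2 * u'"
    using L_basis[OF z'(3,4) D' z(4)] by blast
  have par1: "odd k1" "even l1"
    using 1 par Z(3) Z'(3-5) by (metis even_add even_mult_iff)+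
  have par2: "even k2" "odd l2"
    using 2 par Z(4,5) Z'(3-5) by (metis even_add even_mult_iff)+
  have q: "?q (k * p' + l * r') (k * s' + l * u') = n * ?q k l" for k l
    using selling_val_matrix[OF Z'(2)] by (simp add: A'_def B'_def C'_def)
  have "A * ?q r u + B * ?q p s + C * ?q (p - r) (s - u) = n * (A * (B' + C') + B * (A' + C') + C * (A' + B'))"
    using selling_val_pairing[OF Z(2)] unfolding A_def B_def C_def .
  moreover have "p - r = (k1 - k2) * p' + (l1 - l2) * r'" "s - u = (k1 - k2) * s' + (l1 - l2) * u'"
    unfolding 1 2 by (simp_all add: algebra_simps)
  then have "?q (p - r) (s - u) = n * ?q (k1 - k2) (l1 - l2)" by (simp only: q)
  moreover have "?q p s = n * ?q k1 l1" "?q r u = n * ?q k2 l2" unfolding 1 2 by (rule q)+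
  ultimately have "n * (A * ?q k2 l2 + B * ?q k1 l1 + C * ?q (k1 - k2) (l1 - l2))
      = n * (A * (B' + C') + B * (A' + C') + C * (A' + B'))" by (simp add: algebra_simps)
  then have eq: "A * ?q k2 l2 + B * ?q k1 l1 + C * ?q (k1 - k2) (l1 - l2) = A * (B' + C') + B * (A' + C') + C * (A' + B')"
    using n_pos by simp
  note ge = selling_val_ge[of A' B' C', simplified]
  have g: "?q k2 l2 \<ge> B' + C'" "?q k1 l1 \<ge> A' + C'" "?q (k1 - k2) (l1 - l2) \<ge> A' + B'"
    using par1 par2 P' by (auto intro!: ge)
  have G: "A * ?q k2 l2 \<ge> A * (B' + C')" "B * ?q k1 l1 \<ge> B * (A' + C')" "C * ?q (k1 - k2) (l1 - l2) \<ge> C * (A' + B')"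
    using g P by (simp_all only: mult_left_mono less_imp_le)
  have "A * ?q k2 l2 \<le> A * (B' + C')" "B * ?q k1 l1 \<le> B * (A' + C')" "C * ?q (k1 - k2) (l1 - l2) \<le> C * (A' + B')"
    using G eq by linarith+
  then have le: "?q k2 l2 \<le> B' + C'" "?q k1 l1 \<le> A' + C'" "?q (k1 - k2) (l1 - l2) \<le> A' + B'"
    using P by (simp_all only: mult_le_cancel_left_pos)
  note mu = selling_val_min_unique[OF P']
  have k: "k2 = 0" "l1 = 0" "k1 = 1 \<or> k1 = -1"
    using mu(2)[OF par2 le(1)] mu(1)[OF par1 le(2)] by auto
  have "odd (k1 - k2)" "odd (l1 - l2)" using par1 par2 by auto
  from mu(3)[OF this le(3)] have l2: "l2 = k1" using k by auto
  have "s > 0" "s' > 0" using Z Z' by auto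
  then have "k1 = 1" using k 1 by auto
  then show ?thesis using 1 2 k l2 unfolding Z(1) Z'(1) by simp
qed

section \<open>Hermite normal forms and the count of quadruples\<close>

definition hnf :: "int \<Rightarrow> (int \<times> int \<times> int) set" where
  "hnf n = {(\<alpha>, \<beta>, \<delta>). \<alpha> > 0 \<and> \<delta> > 0 \<and> \<alpha> * \<delta> = n \<and> 0 \<le> \<beta> \<and> \<beta> < \<alpha>}"

lemma hnf_eq: "n > 0 \<Longrightarrow> hnf n = (\<lambda>(\<alpha>, \<beta>). (\<alpha>, \<beta>, n div \<alpha>)) ` (SIGMA \<alpha>:{d. d > 0 \<and> d dvd n}. {0..<\<alpha>})"
  by (auto simp: hnf_def image_iff pos_imp_zdiv_pos_iff zdvd_imp_le)

lemma card_hnf: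
  assumes "n > 0"
  shows "int (card (hnf n)) = (\<Sum>d | d > 0 \<and> d dvd n. d)"
proof -
  have fin: "finite {d. d > 0 \<and> d dvd n}"
    by (rule finite_subset[of _ "{0..n}"]) (use assms in \<open>auto dest: zdvd_imp_le\<close>)
  have "card (hnf n) = card (SIGMA \<alpha>:{d. d > 0 \<and> d dvd n}. {0..<\<alpha>})"
    unfolding hnf_eq[OF assms] by (rule card_image) (auto simp: inj_on_def)
  also have "\<dots> = (\<Sum>d | d > 0 \<and> d dvd n. nat d)" using fin by simp
  finally show ?thesis by simp
qed

text \<open>A Bezout combination of the columns is (b, \<delta>) with \<delta> the gcd of the second
  coordinates. The combinations with second coordinate 0 are the multiples of (\<alpha>, 0), so b
  matters only modulo \<alpha>.\<close>

lemma hnf_exists: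
  assumes n: "p * u - r * s = n" "n > 0"
  shows "\<exists>\<alpha> \<beta> \<delta>. (\<alpha>, \<beta>, \<delta>) \<in> hnf n \<and> (p, s) \<in> lat \<alpha> \<beta> \<delta> \<and> (r, u) \<in> lat \<alpha> \<beta> \<delta>"
proof -
  define \<delta> where "\<delta> = gcd s u"
  obtain s' u' where su: "s = \<delta> * s'" "u = \<delta> * u'" unfolding \<delta>_def by (meson dvdE gcd_dvd1 gcd_dvd2)
  have \<delta>0: "\<delta> \<noteq> 0" using n su by auto
  then have \<delta>: "\<delta> > 0" by (metis \<delta>_def gcd_ge_0_int order_le_less)
  obtain x y where "x * s + y * u = \<delta>" unfolding \<delta>_def using bezout_int by blast
  then have "\<delta> * (x * s' + y * u') = \<delta> * 1" unfolding su by (simp add: algebra_simps)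
  then have xy: "x * s' + y * u' = 1" using \<delta>0 mult_cancel_left by blast
  define \<alpha> where "\<alpha> = p * u' - r * s'"
  have \<alpha>n: "\<alpha> * \<delta> = n" using n(1) unfolding su \<alpha>_def by (simp add: algebra_simps)
  have \<alpha>: "\<alpha> > 0" using \<alpha>n n(2) \<delta> by (metis zero_less_mult_pos2)
  define b where "b = x * p + y * r"
  define \<beta> where "\<beta> = b mod \<alpha>"
  have b: "b = \<alpha> * (b div \<alpha>) + \<beta>" by (simp add: \<beta>_def)
  have p: "p = \<alpha> * y + b * s'"
  proof -
    have "\<alpha> * y + b * s' = p * (x * s' + y * u')" unfolding \<alpha>_def b_def by (simp add: algebra_simps)
    then show ?thesis by (simp add: xy)
  qed
  have r: "r = \<alpha> * (- x) + b * u'"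
  proof -
    have "\<alpha> * (- x) + b * u' = r * (x * s' + y * u')" unfolding \<alpha>_def b_def by (simp add: algebra_simps)
    then show ?thesis by (simp add: xy)
  qed
  have "p = \<alpha> * (y + (b div \<alpha>) * s') + \<beta> * s'"
    by (subst p, subst b) (simp add: algebra_simps)
  moreover have "r = \<alpha> * (- x + (b div \<alpha>) * u') + \<beta> * u'"
    by (subst r, subst b) (simp add: algebra_simps)
  ultimately have "(p, s) \<in> lat \<alpha> \<beta> \<delta>" "(r, u) \<in> lat \<alpha> \<beta> \<delta>"
    using su unfolding lat_def by blast+
  moreover have "(\<alpha>, \<beta>, \<delta>) \<in> hnf n" using \<alpha> \<delta> \<alpha>n by (simp add: hnf_def \<beta>_def)
  ultimately show ?thesis by blast
qed

lemma lat_dvd: "(x, y) \<in> lat \<alpha> \<beta> \<delta> \<Longrightarrow> \<delta> dvd y"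
  by (auto simp: lat_def)

text \<open>Columns of determinant n inside a lattice of index n span it, so (\<beta>, \<delta>) and
  (\<beta>', \<delta>') are integral combinations of the same two columns. This gives \<delta> =
  \<delta>' by divisibility and then \<beta> modulo \<alpha>.\<close>

lemma hnf_unique:
  assumes n: "p * u - r * s = n" "n > 0"
    and h: "(\<alpha>, \<beta>, \<delta>) \<in> hnf n" "(p, s) \<in> lat \<alpha> \<beta> \<delta>" "(r, u) \<in> lat \<alpha> \<beta> \<delta>"
    and h': "(\<alpha>', \<beta>', \<delta>') \<in> hnf n" "(p, s) \<in> lat \<alpha>' \<beta>' \<delta>'" "(r, u) \<in> lat \<alpha>' \<beta>' \<delta>'"
  shows "(\<alpha>, \<beta>, \<delta>) = (\<alpha>', \<beta>', \<delta>')"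
proof -
  have gen: "\<exists>i j. b = i * p + j * r \<and> d = i * s + j * u"
    if g: "(a, b, d) \<in> hnf n" "(p, s) \<in> lat a b d" "(r, u) \<in> lat a b d" for a b d
  proof -
    obtain k1 l1 k2 l2 where e: "p = a * k1 + b * l1" "s = d * l1" "r = a * k2 + b * l2" "u = d * l2"
      using g(2,3) unfolding lat_def by blast
    have ad: "a * d = n" using g(1) by (simp add: hnf_def)
    have "n * (k1 * l2 - k2 * l1) = n" using n(1) unfolding e ad[symmetric] by (simp add: algebra_simps)
    then have 1: "k1 * l2 - k2 * l1 = 1" using n(2) by simp
    have "- k2 * p + k1 * r = b * (k1 * l2 - k2 * l1)" "- k2 * s + k1 * u = d * (k1 * l2 - k2 * l1)"
      unfolding e by (simp_all add: algebra_simps)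
    then show ?thesis unfolding 1 by (metis mult_1_right)
  qed
  have dvds: "\<delta> dvd s" "\<delta> dvd u" "\<delta>' dvd s" "\<delta>' dvd u" 
    using lat_dvd[OF h(2)] lat_dvd[OF h(3)] lat_dvd[OF h'(2)] lat_dvd[OF h'(3)] .
  obtain i j where ij: "\<beta> = i * p + j * r" "\<delta> = i * s + j * u" using gen[OF h] by blast
  obtain i' j' where ij': "\<beta>' = i' * p + j' * r" "\<delta>' = i' * s + j' * u" using gen[OF h'] by blast
  have "\<delta> dvd \<delta>'" "\<delta>' dvd \<delta>" using dvds ij(2) ij'(2) by (metis dvd_add dvd_mult)+
  moreover have pos: "\<delta> > 0" "\<delta>' > 0" "\<alpha> > 0" and ad: "\<alpha> * \<delta> = n" "\<alpha>' * \<delta>' = n"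
    and b: "0 \<le> \<beta>" "\<beta> < \<alpha>" "0 \<le> \<beta>'" "\<beta>' < \<alpha>'" using h(1) h'(1) by (auto simp: hnf_def)
  ultimately have \<delta>: "\<delta> = \<delta>'" by (simp add: zdvd_antisym_nonneg)
  then have \<alpha>: "\<alpha> = \<alpha>'" using ad pos by (metis less_irrefl mult_right_cancel)
  obtain k1 l1 k2 l2 where e: "p = \<alpha> * k1 + \<beta>' * l1" "s = \<delta> * l1" "r = \<alpha> * k2 + \<beta>' * l2" "u = \<delta> * l2"
    using h'(2,3) unfolding lat_def \<alpha> \<delta> by blast
  have "\<delta> * (i * l1 + j * l2) = \<delta> * 1" using ij(2) unfolding e by (simp add: algebra_simps)
  then have 1: "i * l1 + j * l2 = 1" using pos by (metis less_irrefl mult_left_cancel)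
  have "\<beta> = \<alpha> * (i * k1 + j * k2) + \<beta>' * (i * l1 + j * l2)" using ij(1) unfolding e by (simp add: algebra_simps)
  then have "\<beta> mod \<alpha> = \<beta>' mod \<alpha>" unfolding 1 by simp
  then have "\<beta> = \<beta>'" using b \<alpha> by simp
  then show ?thesis using \<alpha> \<delta> by simp
qed

theorem card_selling_quads:
  assumes "n > 0" "odd n"
  shows "int (card (selling_quads n)) = 2 * (\<Sum>d | d > 0 \<and> d dvd n. d)"
proof -
  \<comment> \<open>\<open>R z h b\<close>: the matrix of z has its columns in the lattice h and an
    upper left entry of parity b. It will be a bijection between quadruples and pairs (h, b), and b
    accounts for the factor 2.\<close>
  define R where "R z h b \<longleftrightarrow> z \<in> selling_quads n \<and> (case h of (\<alpha>, \<beta>, \<delta>) \<Rightarrow> \<exists>p s r u. quad_matrix z = (p, s, r, u) \<and>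
    (p, s) \<in> lat \<alpha> \<beta> \<delta> \<and> (r, u) \<in> lat \<alpha> \<beta> \<delta> \<and> odd p = b)" for z h b
  have ol: "odd_lattice n \<alpha> \<delta>" if "(\<alpha>, \<beta>, \<delta>) \<in> hnf n" for \<alpha> \<beta> \<delta>
    using that assms by unfold_locales (auto simp: hnf_def)
  have ex1: "\<exists>z. R z h b" if "h \<in> hnf n" for h b
  proof -
    obtain \<alpha> \<beta> \<delta> where h: "h = (\<alpha>, \<beta>, \<delta>)" by (cases h)
    interpret odd_lattice n \<alpha> \<beta> \<delta> using ol that h by simp
    show ?thesis using exists_quad[of b] unfolding R_def h prod.case by blast
  qed
  have un1: "z = z'" if "h \<in> hnf n" "R z h b" "R z' h b" for h b z z'
  proof -
    obtain \<alpha> \<beta> \<delta> where h: "h = (\<alpha>, \<beta>, \<delta>)" by (cases h)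
    interpret odd_lattice n \<alpha> \<beta> \<delta> using ol that h by simp
    show ?thesis using unique_quad[of z _ _ _ _ z'] that(2,3) unfolding R_def h prod.case by blast
  qed
  have ex2: "\<exists>h\<in>hnf n. \<exists>b. R z h b" if z: "z \<in> selling_quads n" for z
  proof -
    obtain p s r u where m: "quad_matrix z = (p, s, r, u)" "p * u - r * s = n"
      using selling_quads_matrix(2)[OF z _ assms(2)] by (metis surj_pair)
    then show ?thesis using hnf_exists[OF m(2) assms(1)] z unfolding R_def by fast
  qed
  have un2: "h = h' \<and> b = b'" if "h \<in> hnf n" "h' \<in> hnf n" "R z h b" "R z h' b'" for h h' b b' z
  proof -
    obtain \<alpha> \<beta> \<delta> \<alpha>' \<beta>' \<delta>' where h: "h = (\<alpha>, \<beta>, \<delta>)" "h' = (\<alpha>', \<beta>', \<delta>')"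
      by (cases h, cases h')
    have z: "z \<in> selling_quads n" using that(3) by (simp add: R_def)
    obtain p s r u where m: "quad_matrix z = (p, s, r, u)" "p * u - r * s = n"
      using selling_quads_matrix(2)[OF z _ assms(2)] by (metis surj_pair)
    have "(p, s) \<in> lat \<alpha> \<beta> \<delta>" "(r, u) \<in> lat \<alpha> \<beta> \<delta>" "(p, s) \<in> lat \<alpha>' \<beta>' \<delta>'" "(r, u) \<in> lat \<alpha>' \<beta>' \<delta>'"
      "b = odd p" "b' = odd p" using that(3,4) m(1) unfolding R_def h by auto
    then show ?thesis using hnf_unique[OF m(2) assms(1)] that(1,2) unfolding h by blast
  qed
  define G where "G = (\<lambda>(h, b). SOME z. R z h b)"
  have G: "R (G (h, b)) h b" if "h \<in> hnf n" for h b
    unfolding G_def prod.case by (rule someI_ex[OF ex1[OF that]])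
  have "bij_betw G (hnf n \<times> UNIV) (selling_quads n)"
  proof (rule bij_betwI')
    fix x y assume "x \<in> hnf n \<times> (UNIV :: bool set)" "y \<in> hnf n \<times> (UNIV :: bool set)"
    moreover obtain h b h' b' where xy: "x = (h, b)" "y = (h', b')" by (metis surj_pair)
    ultimately have h: "h \<in> hnf n" "h' \<in> hnf n" by auto
    show "(G x = G y) = (x = y)"
    proof
      assume "G x = G y"
      then show "x = y" using un2[OF h G[OF h(1), of b], of b'] G[OF h(2), of b'] by (simp add: xy)
    qed simp
  next
    fix x assume "x \<in> hnf n \<times> (UNIV :: bool set)"
    then show "G x \<in> selling_quads n" using G by (cases x) (auto simp: R_def)
  next
    fix z assume "z \<in> selling_quads n"
    then obtain h b where "h \<in> hnf n" "R z h b" using ex2 by blast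
    then have "z = G (h, b)" by (intro un1[of h _ b] G)
    then show "\<exists>x\<in>hnf n \<times> UNIV. z = G x" using \<open>h \<in> hnf n\<close> by blast
  qed
  then have "card (selling_quads n) = card (hnf n \<times> (UNIV :: bool set))" by (simp add: bij_betw_same_card)
  then show ?thesis using card_hnf[OF assms(1)] by (simp add: card_cartesian_product)
qed

section \<open>A Liouville identity\<close>

text \<open>The coefficient k absorbs factors of 2 from d and e, so that restrictions to even d or e
  become sums of the same kind with k = 2, 4, 8.\<close>

definition reps :: "int \<Rightarrow> int \<Rightarrow> (int \<times> int \<times> int) set" where
  "reps k n = {(i, d, e). d > 0 \<and> e > 0 \<and> i\<^sup>2 + k * (d * e) = n}"

lemma finite_reps:
  assumes "k > 0"
  shows "finite (reps k n)"
proof (rule finite_subset)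
  show "reps k n \<subseteq> {-n..n} \<times> {0..n} \<times> {0..n}"
  proof (clarsimp simp: reps_def)
    fix i d e :: int assume p: "d > 0" "e > 0"
    have "d * 1 \<le> d * e" "1 * e \<le> d * e" using p by (intro mult_left_mono mult_right_mono; simp)+
    moreover have "1 * (d * e) \<le> k * (d * e)" using p assms by (intro mult_right_mono) auto
    moreover have "\<bar>i\<bar> \<le> i\<^sup>2" by (rule abs_le_square_int)
    ultimately show "- i\<^sup>2 - k * (d * e) \<le> i \<and> i \<le> i\<^sup>2 + k * (d * e) \<and> d \<le> i\<^sup>2 + k * (d * e) \<and> e \<le> i\<^sup>2 + k * (d * e)"
      using p mult_pos_pos[OF p] zero_le_power2[of i] by (intro conjI; linarith)
  qed
qed simp

lemma sum_reps_uminus: "(\<Sum>(i, d, e)\<in>reps k n. f (- i) d e) = (\<Sum>(i, d, e)\<in>reps k n. f i d e)"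
  by (rule sum.reindex_bij_witness[of _ "\<lambda>(i, d, e). (- i, d, e)" "\<lambda>(i, d, e). (- i, d, e)"])
     (auto simp: reps_def)

lemma sum_reps_swap: "(\<Sum>(i, d, e)\<in>reps k n. f i e d) = (\<Sum>(i, d, e)\<in>reps k n. f i d e)"
  by (rule sum.reindex_bij_witness[of _ "\<lambda>(i, d, e). (i, e, d)" "\<lambda>(i, d, e). (i, e, d)"])
     (auto simp: reps_def mult.commute)

lemma sum_reps_odd:
  assumes "\<And>i d e. f (- i) d e = - f i d e"
  shows "(\<Sum>(i, d, e)\<in>reps k n. f i d e) = (0::int)"
proof -
  have "(\<Sum>(i, d, e)\<in>reps k n. f i d e) = - (\<Sum>(i, d, e)\<in>reps k n. f i d e)"
    using sum_reps_uminus[of f k n] by (simp add: assms sum_negf case_prod_unfold)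
  then show ?thesis by simp
qed

lemma sum_reps_even_left:
  assumes "k > 0"
  shows "(\<Sum>(i, d, e)\<in>reps k n. if even d then f i d e else 0) = (\<Sum>(i, d, e)\<in>reps (2 * k) n. f i (2 * d) e)"
proof -
  have "(\<Sum>(i, d, e)\<in>reps k n. if even d then f i d e else 0) = (\<Sum>(i, d, e) | (i, d, e) \<in> reps k n \<and> even d. f i d e)"
    by (rule sum.mono_neutral_cong_right) (use finite_reps[OF assms] in \<open>auto split: if_splits\<close>)
  also have "\<dots> = (\<Sum>(i, d, e)\<in>reps (2 * k) n. f i (2 * d) e)"
    by (rule sum.reindex_bij_witness[of _ "\<lambda>(i, d, e). (i, 2 * d, e)" "\<lambda>(i, d, e). (i, d div 2, e)"])
       (auto simp: reps_def algebra_simps)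
  finally show ?thesis .
qed

text \<open>In the coordinates \<open>X = e - 2 i\<close>, \<open>Y = d + i\<close>, \<open>Z = 2 d + 2 i - e\<close> the equation
  \<open>i\<^sup>2 + d e = n\<close> becomes \<open>4 Y\<^sup>2 + X\<^sup>2 - Z\<^sup>2 = 4 n\<close>, whose symmetries \<open>X \<mapsto> - X\<close> and
  \<open>(Y, Z) \<mapsto> (- Y, - Z)\<close> give the identity; the solutions on the walls \<open>X = Z\<close> and \<open>2 Y = Z\<close>
  contribute the last two sums.\<close>

theorem liouville_identity:
  fixes F :: "int \<Rightarrow> int \<Rightarrow> int \<Rightarrow> int"
  assumes odd_X: "\<And>X Y Z. F (- X) Y Z = - F X Y Z"
    and even_YZ: "\<And>X Y Z. F X (- Y) (- Z) = F X Y Z"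
  shows "2 * (\<Sum>(i, d, e)\<in>reps 1 n. F (e - 2 * i) (d + i) (2 * d + 2 * i - e)) =
    (\<Sum>(i, d, e)\<in>reps 1 n. F (d + e) i (d - e))
    + 2 * (\<Sum>(X, Y) | Y\<^sup>2 = n \<and> 0 < X \<and> X < 2 * Y. F X Y X)
    - (\<Sum>(X, Y) | X\<^sup>2 = 4 * n \<and> \<bar>2 * Y\<bar> < X. F X Y (2 * Y))"
proof -
  define E where "E = {(X, Y, Z). 4 * Y\<^sup>2 + X\<^sup>2 - Z\<^sup>2 = 4 * n}"
  define P where "P = {(X, Y, Z) \<in> E. X + Z > 0 \<and> 2 * Y - Z > 0}"
  define Q where "Q = {(X, Y, Z) \<in> E. \<bar>Z\<bar> < X}"
  let ?F = "\<lambda>(X, Y, Z). F X Y Z"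
  have even_XZ: "\<exists>k. X + Z = 2 * k" if "(X, Y, Z) \<in> E" for X Y Z
  proof -
    have "X\<^sup>2 - Z\<^sup>2 = 4 * (n - Y\<^sup>2)" using that by (simp add: E_def)
    then have "even (X\<^sup>2 - Z\<^sup>2)" by simp
    then have "even (X + Z)" by simp
    then show ?thesis by (elim evenE) blast
  qed
  have PF: "(\<Sum>(i, d, e)\<in>reps 1 n. F (e - 2 * i) (d + i) (2 * d + 2 * i - e)) = sum ?F P"
    and QF: "(\<Sum>(i, d, e)\<in>reps 1 n. F (d + e) i (d - e)) = sum ?F Q"
    and fin: "finite P" "finite Q"
  proof -
    have b1: "bij_betw (\<lambda>(i, d, e). (e - 2 * i, d + i, 2 * d + 2 * i - e)) (reps 1 n) P"
    proof (rule bij_betw_byWitness[where f' = "\<lambda>(X, Y, Z). (Y - (X + Z) div 2, (X + Z) div 2, 2 * Y - Z)"])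
      show "\<forall>a'\<in>P. (case case a' of (X, Y, Z) \<Rightarrow> (Y - (X + Z) div 2, (X + Z) div 2, 2 * Y - Z) of
          (i, d, e) \<Rightarrow> (e - 2 * i, d + i, 2 * d + 2 * i - e)) = a'"
        by (auto simp: P_def dest!: even_XZ)
      show "(\<lambda>(X, Y, Z). (Y - (X + Z) div 2, (X + Z) div 2, 2 * Y - Z)) ` P \<subseteq> reps 1 n"
      proof clarify
        fix X Y Z assume h: "(X, Y, Z) \<in> P"
        then obtain k where k: "X + Z = 2 * k" using even_XZ[of X Y Z] by (auto simp: P_def)
        then have Xk: "X = 2 * k - Z" by simp
        show "(Y - (X + Z) div 2, (X + Z) div 2, 2 * Y - Z) \<in> reps 1 n"
          using h unfolding Xk by (auto simp: reps_def P_def E_def power2_eq_square algebra_simps)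
      qed
    qed (auto simp: reps_def P_def E_def power2_eq_square algebra_simps)
    have b2: "bij_betw (\<lambda>(i, d, e). (d + e, i, d - e)) (reps 1 n) Q"
    proof (rule bij_betw_byWitness[where f' = "\<lambda>(X, Y, Z). (Y, (X + Z) div 2, (X - Z) div 2)"])
      show "\<forall>a'\<in>Q. (case case a' of (X, Y, Z) \<Rightarrow> (Y, (X + Z) div 2, (X - Z) div 2) of
          (i, d, e) \<Rightarrow> (d + e, i, d - e)) = a'"
        by (auto simp: Q_def dest!: even_XZ)
      show "(\<lambda>(X, Y, Z). (Y, (X + Z) div 2, (X - Z) div 2)) ` Q \<subseteq> reps 1 n"
      proof clarify
        fix X Y Z assume h: "(X, Y, Z) \<in> Q"
        then obtain k where k: "X + Z = 2 * k" using even_XZ[of X Y Z] by (auto simp: Q_def)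
        then have Xk: "X = 2 * k - Z" by simp
        show "(Y, (X + Z) div 2, (X - Z) div 2) \<in> reps 1 n"
          using h unfolding Xk by (auto simp: reps_def Q_def E_def power2_eq_square algebra_simps)
      qed
    qed (auto simp: reps_def Q_def E_def power2_eq_square algebra_simps)
    show "(\<Sum>(i, d, e)\<in>reps 1 n. F (e - 2 * i) (d + i) (2 * d + 2 * i - e)) = sum ?F P"
      using sum.reindex_bij_betw[OF b1, of ?F] by (simp add: case_prod_unfold)
    show "(\<Sum>(i, d, e)\<in>reps 1 n. F (d + e) i (d - e)) = sum ?F Q"
      using sum.reindex_bij_betw[OF b2, of ?F] by (simp add: case_prod_unfold)
    show "finite P" "finite Q" using finite_reps[of 1 n] bij_betw_finite[OF b1] bij_betw_finite[OF b2] by simp_all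
  qed
  \<comment> \<open>\<open>P3\<close> is the common part of \<open>P\<close> and \<open>Q\<close>.
    On \<open>P1\<close>, where |X| < Z, the summand is odd in X; \<open>Q1\<close> mirrors
    \<open>P3\<close>. Thus \<open>P\<close> contributes P2 + P3 and \<open>Q\<close> contributes Q0
    + 2 P3.\<close>
  define P1 P2 P3 where "P1 = {(X, Y, Z) \<in> P. X < Z}" and "P2 = {(X, Y, Z) \<in> P. X = Z}" and "P3 = {(X, Y, Z) \<in> P. X > Z}"
  define Q0 Q1 where "Q0 = {(X, Y, Z) \<in> Q. 2 * Y = Z}" and "Q1 = {(X, Y, Z) \<in> Q. 2 * Y < Z}"
  have fins: "finite P1" "finite P2" "finite P3" "finite Q0" "finite Q1"
    using fin by (auto simp: P1_def P2_def P3_def Q0_def Q1_def intro: rev_finite_subset)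
  have "P = P1 \<union> (P2 \<union> P3)" by (auto simp: P1_def P2_def P3_def)
  moreover have "P1 \<inter> (P2 \<union> P3) = {}" "P2 \<inter> P3 = {}" by (auto simp: P1_def P2_def P3_def)
  ultimately have SP: "sum ?F P = sum ?F P1 + (sum ?F P2 + sum ?F P3)"
    using fins by (simp add: sum.union_disjoint)
  have "Q = Q0 \<union> (Q1 \<union> P3)" by (auto simp: P3_def P_def Q_def Q0_def Q1_def)
  moreover have "Q0 \<inter> (Q1 \<union> P3) = {}" "Q1 \<inter> P3 = {}" by (auto simp: P3_def P_def Q0_def Q1_def)
  ultimately have SQ: "sum ?F Q = sum ?F Q0 + (sum ?F Q1 + sum ?F P3)"
    using fins by (simp add: sum.union_disjoint)
  have "sum ?F P1 = (\<Sum>(X, Y, Z)\<in>P1. - F X Y Z)"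
    by (rule sum.reindex_bij_witness[of _ "\<lambda>(X, Y, Z). (- X, Y, Z)" "\<lambda>(X, Y, Z). (- X, Y, Z)"])
       (auto simp: P1_def P_def E_def odd_X)
  then have S1: "sum ?F P1 = 0" by (simp add: sum_negf case_prod_unfold)
  have S3: "sum ?F Q1 = sum ?F P3"
    by (rule sum.reindex_bij_witness[of _ "\<lambda>(X, Y, Z). (X, - Y, - Z)" "\<lambda>(X, Y, Z). (X, - Y, - Z)"])
       (auto simp: Q1_def Q_def P3_def P_def E_def even_YZ)
  have S2: "sum ?F P2 = (\<Sum>(X, Y) | Y\<^sup>2 = n \<and> 0 < X \<and> X < 2 * Y. F X Y X)"
    by (rule sum.reindex_bij_witness[of _ "\<lambda>(X, Y). (X, Y, X)" "\<lambda>(X, Y, Z). (X, Y)"])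
       (auto simp: P2_def P_def E_def)
  have S0: "sum ?F Q0 = (\<Sum>(X, Y) | X\<^sup>2 = 4 * n \<and> \<bar>2 * Y\<bar> < X. F X Y (2 * Y))"
    by (rule sum.reindex_bij_witness[of _ "\<lambda>(X, Y). (X, Y, 2 * Y)" "\<lambda>(X, Y, Z). (X, Y)"])
       (auto simp: Q0_def Q_def E_def power_mult_distrib)
  show ?thesis unfolding PF QF using SP SQ S1 S3 S2 S0 by linarith
qed

section \<open>Two weights for the identity\<close>

lemma sum_wall:
  "(\<Sum>(X, Y) | Y\<^sup>2 = n \<and> 0 < X \<and> X < 2 * Y. f X Y) =
    (\<Sum>s | s > 0 \<and> s\<^sup>2 = n. \<Sum>X | 0 < X \<and> X < 2 * s. f X (s::int))"
proof -
  have fin: "finite {s::int. s > 0 \<and> s\<^sup>2 = n}"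
    by (rule finite_subset[OF _ finite_square_le[of n]]) auto
  have eq: "{(X, Y). Y\<^sup>2 = n \<and> 0 < X \<and> X < 2 * Y} =
      prod.swap ` (SIGMA Y:{s. s > 0 \<and> s\<^sup>2 = n}. {X. 0 < X \<and> X < 2 * Y})" by force
  have "(\<Sum>(X, Y) | Y\<^sup>2 = n \<and> 0 < X \<and> X < 2 * Y. f X Y) =
      (\<Sum>(Y, X)\<in>(SIGMA Y:{s. s > 0 \<and> s\<^sup>2 = n}. {X. 0 < X \<and> X < 2 * Y}). f X Y)"
    unfolding eq by (subst sum.reindex) (auto simp: case_prod_unfold)
  also have "\<dots> = (\<Sum>s | s > 0 \<and> s\<^sup>2 = n. \<Sum>X | 0 < X \<and> X < 2 * s. f X s)"
    using fin by (subst sum.Sigma) (auto intro: finite_subset[of _ "{0..2 * _}"])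
  finally show ?thesis .
qed

definition sgp :: "int \<Rightarrow> int" where "sgp i = (if even i then 1 else - 1)"

lemma sum_odd_below: "(\<Sum>X | odd X \<and> 0 < X \<and> X < 2 * int s. X) = (int s)\<^sup>2"
proof (induction s)
  case 0
  have e: "{X. odd X \<and> 0 < X \<and> X < 2 * int 0} = {}" by auto
  show ?case unfolding e by simp
next
  case (Suc s)
  have "{X. odd X \<and> 0 < X \<and> X < 2 * int (Suc s)} = insert (2 * int s + 1) {X. odd X \<and> 0 < X \<and> X < 2 * int s}"
    by (auto, presburger)
  moreover have "finite {X. odd X \<and> 0 < X \<and> X < 2 * int s}" by (rule finite_subset[of _ "{0..2 * int s}"]) auto
  ultimately show ?case using Suc by (simp add: power2_eq_square algebra_simps)
qed

lemma sum_even_below: "(\<Sum>X | even X \<and> 0 < X \<and> X < 2 * int s. X) = int s * (int s - 1)"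
proof (induction s)
  case 0
  have e: "{X. even X \<and> 0 < X \<and> X < 2 * int 0} = {}" by auto
  show ?case unfolding e by simp
next
  case (Suc s)
  have fin: "finite {X. even X \<and> 0 < X \<and> X < 2 * int s}" by (rule finite_subset[of _ "{0..2 * int s}"]) auto
  show ?case
  proof (cases "s = 0")
    case True
    have e: "{X. even X \<and> 0 < X \<and> X < 2 * int (Suc s)} = {}" using True by auto
    show ?thesis unfolding e using True by simp
  next
    case False
    then have "{X. even X \<and> 0 < X \<and> X < 2 * int (Suc s)} = insert (2 * int s) {X. even X \<and> 0 < X \<and> X < 2 * int s}"
      by auto
    then show ?thesis using Suc fin by (simp add: power2_eq_square algebra_simps)
  qed
qed

lemma sgp_simps: "sgp (- i) = sgp i" "sgp (i + j) = sgp i * sgp j"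
  by (auto simp: sgp_def)

text \<open>The weight is (-1)^Y X on odd X. With the sums a, b, c below the identity reads 2 (b -
  c) = 2 (a + b) + 2 W, so b drops out and a + c = - W. In the wall sum W each s contributes (-1)^s
  (1 + 3 + ... + (2 s - 1)) = (-1)^s n.\<close>

lemma sum_reps_sgp:
  "(\<Sum>(i, d, e)\<in>reps 1 n. if odd e then sgp i * d else 0) = - (\<Sum>s | s > 0 \<and> s\<^sup>2 = n. sgp s * n)"
proof -
  define F where "F = (\<lambda>X Y Z :: int. if odd X then sgp Y * X else 0)"
  have L: "2 * (\<Sum>(i, d, e)\<in>reps 1 n. F (e - 2 * i) (d + i) (2 * d + 2 * i - e)) =
    (\<Sum>(i, d, e)\<in>reps 1 n. F (d + e) i (d - e))
    + 2 * (\<Sum>(X, Y) | Y\<^sup>2 = n \<and> 0 < X \<and> X < 2 * Y. F X Y X)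
    - (\<Sum>(X, Y) | X\<^sup>2 = 4 * n \<and> \<bar>2 * Y\<bar> < X. F X Y (2 * Y))"
    by (rule liouville_identity) (auto simp: F_def sgp_simps)
  have Q0: "(\<Sum>(X, Y) | X\<^sup>2 = 4 * n \<and> \<bar>2 * Y\<bar> < X. F X Y (2 * Y)) = 0"
  proof (intro sum.neutral ballI, clarify)
    fix X Y :: int assume "X\<^sup>2 = 4 * n"
    then have "even (X\<^sup>2)" by simp
    then show "F X Y (2 * Y) = 0" by (simp add: F_def)
  qed
  have P2: "(\<Sum>(X, Y) | Y\<^sup>2 = n \<and> 0 < X \<and> X < 2 * Y. F X Y X) = (\<Sum>s | s > 0 \<and> s\<^sup>2 = n. sgp s * n)"
  unfolding sum_wall
  proof (rule sum.cong, simp)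
    fix Y :: int assume Y: "Y \<in> {Y. Y > 0 \<and> Y\<^sup>2 = n}"
    have "(\<Sum>X | 0 < X \<and> X < 2 * Y. F X Y X) = (\<Sum>X | odd X \<and> 0 < X \<and> X < 2 * Y. sgp Y * X)"
      by (rule sum.mono_neutral_cong_right) (auto simp: F_def intro: finite_subset[of _ "{0..2 * Y}"])
    also have "\<dots> = sgp Y * Y\<^sup>2"
      using sum_odd_below[of "nat Y"] Y by (simp flip: sum_distrib_left)
    finally show "(\<Sum>X | 0 < X \<and> X < 2 * Y. F X Y X) = sgp Y * n" using Y by simp
  qed
  have "(\<Sum>(i, d, e)\<in>reps 1 n. F (e - 2 * i) (d + i) (2 * d + 2 * i - e)) =
      (\<Sum>(i, d, e)\<in>reps 1 n. if odd e then sgp d * sgp i * e else 0) - (\<Sum>(i, d, e)\<in>reps 1 n. if odd e then sgp d * sgp i * 2 * i else 0)"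
    by (subst sum_subtractf[symmetric], rule sum.cong) (auto simp: F_def sgp_simps algebra_simps)
  moreover have "(\<Sum>(i, d, e)\<in>reps 1 n. if odd e then sgp d * sgp i * 2 * i else 0) = 0"
    by (rule sum_reps_odd) (simp add: sgp_simps)
  ultimately have A: "(\<Sum>(i, d, e)\<in>reps 1 n. F (e - 2 * i) (d + i) (2 * d + 2 * i - e)) =
      (\<Sum>(i, d, e)\<in>reps 1 n. if odd e then sgp d * sgp i * e else 0)" by simp
  define b where "b = (\<Sum>(i, d, e)\<in>reps 1 n. if odd e \<and> even d then sgp i * e else 0)"
  define c where "c = (\<Sum>(i, d, e)\<in>reps 1 n. if odd e \<and> odd d then sgp i * d else 0)"
  define a where "a = (\<Sum>(i, d, e)\<in>reps 1 n. if odd e \<and> even d then sgp i * d else 0)"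
  have c': "c = (\<Sum>(i, d, e)\<in>reps 1 n. if odd e \<and> odd d then sgp i * e else 0)"
    unfolding c_def using sum_reps_swap[of "\<lambda>i d e. if odd e \<and> odd d then sgp i * d else 0" 1 n]
    by (simp add: conj_commute)
  have h1: "(\<Sum>(i, d, e)\<in>reps 1 n. if odd e then sgp d * sgp i * e else 0) = b - c"
    unfolding b_def c' by (subst sum_subtractf[symmetric], rule sum.cong) (auto simp: sgp_def)
  have h2: "(\<Sum>(i, d, e)\<in>reps 1 n. F (d + e) i (d - e)) = 2 * (a + b)"
  proof -
    have "(\<Sum>(i, d, e)\<in>reps 1 n. F (d + e) i (d - e)) = (a + b) + (\<Sum>(i, d, e)\<in>reps 1 n. if odd d \<and> even e then sgp i * (d + e) else 0)"
      unfolding a_def b_def by (subst sum.distrib[symmetric], subst sum.distrib[symmetric], rule sum.cong) (auto simp: F_def algebra_simps)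
    also have "(\<Sum>(i, d, e)\<in>reps 1 n. if odd d \<and> even e then sgp i * (d + e) else 0) =
        (\<Sum>(i, d, e)\<in>reps 1 n. if odd e \<and> even d then sgp i * (e + d) else 0)"
      by (rule sum_reps_swap)
    also have "\<dots> = a + b" unfolding a_def b_def by (subst sum.distrib[symmetric], rule sum.cong) (auto simp: algebra_simps)
    finally show ?thesis by simp
  qed
  have h3: "(\<Sum>(i, d, e)\<in>reps 1 n. if odd e then sgp i * d else 0) = a + c"
    unfolding a_def c_def by (subst sum.distrib[symmetric], rule sum.cong) auto
  show ?thesis using L unfolding A Q0 P2 h1 h2 h3 by (simp only: algebra_simps)
qed

lemma chi_m4_uminus: "chi_m4 (- i) = - chi_m4 i"
  unfolding chi_m4_def by presburger

lemma chi_m4_even: "even i \<Longrightarrow> chi_m4 i = 0"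
  unfolding chi_m4_def by presburger

lemma chi_m4_add_double: "chi_m4 (2 * d + i) = sgp d * chi_m4 i"
  unfolding chi_m4_def sgp_def by presburger

lemma sum_chi_m4_interval:
  "(\<Sum>Y = - 2 * int m..2 * int m. chi_m4 Y * Y) = - chi_m4 (2 * int m + 1) * (2 * int m)"
proof (induction m)
  case (Suc m)
  have "{- 2 * int (Suc m)..2 * int (Suc m)} = insert (- 2 * int m - 2) (insert (- 2 * int m - 1)
      (insert (2 * int m + 2) (insert (2 * int m + 1) {- 2 * int m..2 * int m})))" by auto
  moreover have "chi_m4 (- 2 * int m - 2) = 0" "chi_m4 (2 * int m + 2) = 0" by (rule chi_m4_even, simp)+
  moreover have "chi_m4 (- 2 * int m - 1) = - chi_m4 (2 * int m + 1)"
    using chi_m4_uminus[of "2 * int m + 1"] by simp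
  moreover have "chi_m4 (2 * int (Suc m) + 1) = - chi_m4 (2 * int m + 1)"
    using chi_m4_add_double[of 1 "2 * int m + 1"] by (simp add: sgp_def add.commute add.left_commute)
  ultimately show ?case using Suc by (simp add: algebra_simps)
qed simp

text \<open>The weight is \<chi>(Y) Y X on even X. Parity reduces all sums to i^2 + 4 d e = n, where
  n mod 8 = 1 excludes d, e both odd, and the identity becomes 12 b - 12 a - 4 c = 4 a + 4 b + 4 c +
  2 T. With a + c = 2 D and b + c = D the unknown c cancels, leaving 12 D = - T.\<close>

lemma sum_reps_chi_m4:
  assumes n: "n mod 8 = 1"
  shows "12 * (\<Sum>(i, d, e)\<in>reps 8 n. chi_m4 i * i * d) =
    - (\<Sum>s | s > 0 \<and> s\<^sup>2 = n. chi_m4 s * s * (n - 1))"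
proof -
  define F where "F = (\<lambda>X Y Z :: int. if even X then chi_m4 Y * Y * X else 0)"
  have L: "2 * (\<Sum>(i, d, e)\<in>reps 1 n. F (e - 2 * i) (d + i) (2 * d + 2 * i - e)) =
    (\<Sum>(i, d, e)\<in>reps 1 n. F (d + e) i (d - e))
    + 2 * (\<Sum>(X, Y) | Y\<^sup>2 = n \<and> 0 < X \<and> X < 2 * Y. F X Y X)
    - (\<Sum>(X, Y) | X\<^sup>2 = 4 * n \<and> \<bar>2 * Y\<bar> < X. F X Y (2 * Y))"
    by (rule liouville_identity) (auto simp: F_def chi_m4_uminus)
  have on: "odd n" using n by presburger
  define S where "S = {s::int. s > 0 \<and> s\<^sup>2 = n}"
  have fin: "finite S" unfolding S_def
    by (rule finite_subset[of _ "{0..n}"]) (auto simp: self_le_power)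
  have So: "odd s" if "s \<in> S" for s using that on by (auto simp: S_def)
  have Q0: "(\<Sum>(X, Y) | X\<^sup>2 = 4 * n \<and> \<bar>2 * Y\<bar> < X. F X Y (2 * Y)) = (\<Sum>s\<in>S. - chi_m4 s * (s - 1) * (2 * s))"
  proof -
    have eq: "{(X, Y). X\<^sup>2 = 4 * n \<and> \<bar>2 * Y\<bar> < X} = (\<lambda>(s, Y). (2 * s, Y)) ` (SIGMA s:S. {- (s - 1)..s - 1})"
    proof (intro equalityI subsetI)
      fix w assume "w \<in> {(X, Y). X\<^sup>2 = 4 * n \<and> \<bar>2 * Y\<bar> < X}"
      then obtain X Y where w: "w = (X, Y)" "X\<^sup>2 = 4 * n" "\<bar>2 * Y\<bar> < X" by blast
      have "even (X\<^sup>2)" using w(2) by simp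
      then obtain s where X: "X = 2 * s" by (auto elim!: evenE)
      then have "s \<in> S" "Y \<in> {- (s - 1)..s - 1}" using w by (auto simp: S_def power_mult_distrib)
      then show "w \<in> (\<lambda>(s, Y). (2 * s, Y)) ` (SIGMA s:S. {- (s - 1)..s - 1})" unfolding w X by force
    qed (auto simp: S_def power_mult_distrib)
    have "(\<Sum>(X, Y) | X\<^sup>2 = 4 * n \<and> \<bar>2 * Y\<bar> < X. F X Y (2 * Y)) =
        (\<Sum>(s, Y)\<in>(SIGMA s:S. {- (s - 1)..s - 1}). F (2 * s) Y (2 * Y))"
      unfolding eq by (subst sum.reindex) (auto simp: case_prod_unfold inj_on_def)
    also have "\<dots> = (\<Sum>s\<in>S. \<Sum>Y = - (s - 1)..s - 1. F (2 * s) Y (2 * Y))"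
      using fin by (subst sum.Sigma) auto
    also have "\<dots> = (\<Sum>s\<in>S. - chi_m4 s * (s - 1) * (2 * s))"
    proof (rule sum.cong, simp)
      fix s assume s: "s \<in> S"
      then obtain k where k: "s = 2 * k + 1" using So by (auto elim!: oddE)
      then have "k \<ge> 0" using s by (simp add: S_def)
      then obtain m where m: "s = 2 * int m + 1" using k nonneg_int_cases[of k] by metis
      have "(\<Sum>Y = - (s - 1)..s - 1. F (2 * s) Y (2 * Y)) = (\<Sum>Y = - 2 * int m..2 * int m. chi_m4 Y * Y) * (2 * s)"
        unfolding sum_distrib_right by (rule sum.cong) (auto simp: F_def m)
      also have "\<dots> = - chi_m4 s * (s - 1) * (2 * s)" unfolding sum_chi_m4_interval by (simp add: m)
      finally show "(\<Sum>Y = - (s - 1)..s - 1. F (2 * s) Y (2 * Y)) = - chi_m4 s * (s - 1) * (2 * s)" .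
    qed
    finally show ?thesis .
  qed
  have P2: "(\<Sum>(X, Y) | Y\<^sup>2 = n \<and> 0 < X \<and> X < 2 * Y. F X Y X) = (\<Sum>s\<in>S. chi_m4 s * s * (s * (s - 1)))"
  unfolding sum_wall S_def[symmetric]
  proof (rule sum.cong, simp)
    fix Y assume Y: "Y \<in> S"
    have "(\<Sum>X | 0 < X \<and> X < 2 * Y. F X Y X) = (\<Sum>X | even X \<and> 0 < X \<and> X < 2 * Y. chi_m4 Y * Y * X)"
      by (rule sum.mono_neutral_cong_right) (auto simp: F_def intro: finite_subset[of _ "{0..2 * Y}"])
    also have "\<dots> = chi_m4 Y * Y * (Y * (Y - 1))"
      using sum_even_below[of "nat Y"] Y by (simp add: S_def flip: sum_distrib_left)
    finally show "(\<Sum>X | 0 < X \<and> X < 2 * Y. F X Y X) = chi_m4 Y * Y * (Y * (Y - 1))" .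
  qed
  \<comment> \<open>The walls contribute \<chi>(s) s times 2 s (s - 1) and 2 (s - 1), which add up
    to 2 (s^2 - 1) = 2 (n - 1).\<close>
  have bd: "2 * (\<Sum>(X, Y) | Y\<^sup>2 = n \<and> 0 < X \<and> X < 2 * Y. F X Y X)
      - (\<Sum>(X, Y) | X\<^sup>2 = 4 * n \<and> \<bar>2 * Y\<bar> < X. F X Y (2 * Y)) = 2 * (\<Sum>s\<in>S. chi_m4 s * s * (n - 1))"
    unfolding P2 Q0 sum_distrib_left sum_subtractf[symmetric]
    by (rule sum.cong) (auto simp: S_def power2_eq_square algebra_simps)
  let ?w = "\<lambda>i::int. chi_m4 i * i"
  have dbl: "(\<Sum>(i, d, e)\<in>reps 1 n. if even d \<and> even e then f i d e else 0) =
      (\<Sum>(i, d, e)\<in>reps 4 n. f i (2 * d) (2 * e))" for f :: "int \<Rightarrow> int \<Rightarrow> int \<Rightarrow> int"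
  proof -
    have "(\<Sum>(i, d, e)\<in>reps 1 n. if even d \<and> even e then f i d e else 0) =
        (\<Sum>(i, d, e)\<in>reps 1 n. if even d then (if even e then f i d e else 0) else 0)"
      by (rule sum.cong) auto
    also have "\<dots> = (\<Sum>(i, d, e)\<in>reps 2 n. if even e then f i (2 * d) e else 0)"
      by (subst sum_reps_even_left) simp_all
    also have "\<dots> = (\<Sum>(i, d, e)\<in>reps 2 n. if even d then f i (2 * e) d else 0)"
      by (rule sum_reps_swap[symmetric])
    also have "\<dots> = (\<Sum>(i, d, e)\<in>reps 4 n. f i (2 * e) (2 * d))"
      by (subst sum_reps_even_left) simp_all
    also have "\<dots> = (\<Sum>(i, d, e)\<in>reps 4 n. f i (2 * d) (2 * e))"
      by (rule sum_reps_swap)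
    finally show ?thesis .
  qed
  have A: "(\<Sum>(i, d, e)\<in>reps 1 n. F (e - 2 * i) (d + i) (2 * d + 2 * i - e)) =
      (\<Sum>(i, d, e)\<in>reps 4 n. ?w i * sgp d * (2 * e - 4 * d))"
  proof -
    have "(\<Sum>(i, d, e)\<in>reps 1 n. F (e - 2 * i) (d + i) (2 * d + 2 * i - e)) =
        (\<Sum>(i, d, e)\<in>reps 1 n. if even d \<and> even e then chi_m4 (d + i) * (d + i) * (e - 2 * i) else 0)"
    proof (rule sum.cong, simp, clarify)
      fix i d e assume "(i, d, e) \<in> reps 1 n"
      then have "i\<^sup>2 + d * e = n" by (simp add: reps_def)
      then have "odd (i\<^sup>2 + d * e)" using on by simp
      then have "even e \<Longrightarrow> odd i" by simp
      then have "even e \<Longrightarrow> odd d \<Longrightarrow> chi_m4 (d + i) = 0" by (intro chi_m4_even) simp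
      then show "F (e - 2 * i) (d + i) (2 * d + 2 * i - e) =
          (if even d \<and> even e then chi_m4 (d + i) * (d + i) * (e - 2 * i) else 0)"
        by (auto simp: F_def)
    qed
    also have "\<dots> = (\<Sum>(i, d, e)\<in>reps 4 n. chi_m4 (2 * d + i) * (2 * d + i) * (2 * e - 2 * i))"
      by (rule dbl)
    also have "\<dots> = (\<Sum>(i, d, e)\<in>reps 4 n. ?w i * sgp d * (2 * e - 4 * d))
        + (\<Sum>(i, d, e)\<in>reps 4 n. chi_m4 i * sgp d * (4 * d * e - 2 * i * i))"
      unfolding chi_m4_add_double
      by (subst sum.distrib[symmetric], rule sum.cong) (auto simp: algebra_simps)
    also have "(\<Sum>(i, d, e)\<in>reps 4 n. chi_m4 i * sgp d * (4 * d * e - 2 * i * i)) = 0"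
      by (rule sum_reps_odd) (simp add: chi_m4_uminus)
    finally show ?thesis by simp
  qed
  have B: "(\<Sum>(i, d, e)\<in>reps 1 n. F (d + e) i (d - e)) = (\<Sum>(i, d, e)\<in>reps 4 n. ?w i * (2 * d + 2 * e))"
  proof -
    have "(\<Sum>(i, d, e)\<in>reps 1 n. F (d + e) i (d - e)) =
        (\<Sum>(i, d, e)\<in>reps 1 n. if even d \<and> even e then ?w i * (d + e) else 0)"
    proof (rule sum.cong, simp, clarify)
      fix i d e assume "(i, d, e) \<in> reps 1 n"
      then have "i\<^sup>2 + d * e = n" by (simp add: reps_def)
      then have "odd (i\<^sup>2 + d * e)" using on by simp
      then have "odd d \<Longrightarrow> odd e \<Longrightarrow> even i" by simp
      then have "odd d \<Longrightarrow> odd e \<Longrightarrow> chi_m4 i = 0" by (intro chi_m4_even) simp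
      then show "F (d + e) i (d - e) = (if even d \<and> even e then ?w i * (d + e) else 0)"
        by (auto simp: F_def)
    qed
    also have "\<dots> = (\<Sum>(i, d, e)\<in>reps 4 n. ?w i * (2 * d + 2 * e))" by (rule dbl)
    finally show ?thesis .
  qed
  have even_de: "even d \<or> even e" if "(i, d, e) \<in> reps 4 n" for i d e
  proof (rule ccontr)
    assume h: "\<not> (even d \<or> even e)"
    have e: "i\<^sup>2 + 4 * (d * e) = n" using that by (simp add: reps_def)
    then have "odd i" using on by (metis even_add even_mult_iff even_numeral even_power zero_less_numeral)
    then have "i\<^sup>2 mod 8 = 1" by (rule odd_square_mod_8)
    moreover have "odd (d * e)" using h by simp
    moreover have "n mod 8 \<noteq> 1" if "I + 4 * w = n" "I mod 8 = 1" "odd w" for I w using that by presburger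
    ultimately show False using e n by blast
  qed
  define a where "a = (\<Sum>(i, d, e)\<in>reps 4 n. if even d \<and> odd e then ?w i * d else 0)"
  define b where "b = (\<Sum>(i, d, e)\<in>reps 4 n. if even d \<and> odd e then ?w i * e else 0)"
  define c where "c = (\<Sum>(i, d, e)\<in>reps 4 n. if even d \<and> even e then ?w i * d else 0)"
  have a': "a = (\<Sum>(i, d, e)\<in>reps 4 n. if even e \<and> odd d then ?w i * e else 0)"
    unfolding a_def by (rule sum_reps_swap[symmetric])
  have b': "b = (\<Sum>(i, d, e)\<in>reps 4 n. if even e \<and> odd d then ?w i * d else 0)"
    unfolding b_def by (rule sum_reps_swap[symmetric])
  have c': "c = (\<Sum>(i, d, e)\<in>reps 4 n. if even e \<and> even d then ?w i * e else 0)"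
    unfolding c_def by (rule sum_reps_swap[symmetric])
  have lin: "(\<Sum>(i, d, e)\<in>R. k1 * f1 i d e + k2 * f2 i d e + k3 * f3 i d e + k4 * f4 i d e + k5 * f5 i d e + k6 * f6 i d e) =
      k1 * (\<Sum>(i, d, e)\<in>R. f1 i d e) + k2 * (\<Sum>(i, d, e)\<in>R. f2 i d e) + k3 * (\<Sum>(i, d, e)\<in>R. f3 i d e)
      + k4 * (\<Sum>(i, d, e)\<in>R. f4 i d e) + k5 * (\<Sum>(i, d, e)\<in>R. f5 i d e) + k6 * (\<Sum>(i, d, e)\<in>R. f6 i d e)"
    for R :: "(int \<times> int \<times> int) set" and f1 f2 f3 f4 f5 f6 :: "int \<Rightarrow> int \<Rightarrow> int \<Rightarrow> int" and k1 k2 k3 k4 k5 k6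
    by (simp add: sum.distrib sum_distrib_left case_prod_unfold)
  have "(\<Sum>(i, d, e)\<in>reps 4 n. ?w i * sgp d * (2 * e - 4 * d)) =
      (\<Sum>(i, d, e)\<in>reps 4 n. 2 * (if even d \<and> odd e then ?w i * e else 0) + - 4 * (if even d \<and> odd e then ?w i * d else 0)
        + - 2 * (if even e \<and> odd d then ?w i * e else 0) + 4 * (if even e \<and> odd d then ?w i * d else 0)
        + 2 * (if even e \<and> even d then ?w i * e else 0) + - 4 * (if even d \<and> even e then ?w i * d else 0))"
    by (rule sum.cong) (auto simp: sgp_def algebra_simps dest!: even_de)
  also have "\<dots> = 2 * b + - 4 * a + - 2 * a + 4 * b + 2 * c + - 4 * c"
    unfolding lin by (simp only: flip: a_def b_def c_def a' b' c')
  finally have A': "(\<Sum>(i, d, e)\<in>reps 4 n. ?w i * sgp d * (2 * e - 4 * d)) = 6 * b - 6 * a - 2 * c" by simp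
  have "(\<Sum>(i, d, e)\<in>reps 4 n. ?w i * (2 * d + 2 * e)) =
      (\<Sum>(i, d, e)\<in>reps 4 n. 2 * (if even d \<and> odd e then ?w i * e else 0) + 2 * (if even d \<and> odd e then ?w i * d else 0)
        + 2 * (if even e \<and> odd d then ?w i * e else 0) + 2 * (if even e \<and> odd d then ?w i * d else 0)
        + 2 * (if even e \<and> even d then ?w i * e else 0) + 2 * (if even d \<and> even e then ?w i * d else 0))"
    by (rule sum.cong) (auto simp: algebra_simps dest!: even_de)
  also have "\<dots> = 2 * b + 2 * a + 2 * a + 2 * b + 2 * c + 2 * c"
    unfolding lin by (simp only: flip: a_def b_def c_def a' b' c')
  finally have B': "(\<Sum>(i, d, e)\<in>reps 4 n. ?w i * (2 * d + 2 * e)) = 4 * a + 4 * b + 4 * c" by simp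
  define D where "D = (\<Sum>(i, d, e)\<in>reps 8 n. ?w i * d)"
  have D1: "a + c = 2 * D"
  proof -
    have "a + c = (\<Sum>(i, d, e)\<in>reps 4 n. if even d then ?w i * d else 0)"
      unfolding a_def c_def by (subst sum.distrib[symmetric], rule sum.cong) auto
    also have "\<dots> = (\<Sum>(i, d, e)\<in>reps 8 n. ?w i * (2 * d))" by (subst sum_reps_even_left) simp_all
    finally show ?thesis by (simp add: D_def sum_distrib_left case_prod_unfold algebra_simps)
  qed
  have D2: "b + c = D"
  proof -
    have "b + c = (\<Sum>(i, d, e)\<in>reps 4 n. if even d then ?w i * e else 0)"
      unfolding b_def c' by (subst sum.distrib[symmetric], rule sum.cong) auto
    also have "\<dots> = (\<Sum>(i, d, e)\<in>reps 8 n. ?w i * e)" by (subst sum_reps_even_left) simp_all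
    also have "\<dots> = D" unfolding D_def by (rule sum_reps_swap)
    finally show ?thesis .
  qed
  define T where "T = (\<Sum>s\<in>S. chi_m4 s * s * (n - 1))"
  have "2 * (6 * b - 6 * a - 2 * c) = (4 * a + 4 * b + 4 * c) + 2 * T"
    using L bd unfolding A B A' B' T_def by (simp only: add_diff_eq)
  moreover have "a = 2 * D - c" "b = D - c" using D1 D2 by simp_all
  ultimately have "12 * D = - T" by simp
  then show ?thesis unfolding D_def T_def S_def .
qed

section \<open>Theta series\<close>

unbundle no vec_syntax and fps_syntax

section \<open>The substitutions q^2 and -q for q, and the operator q d/dq\<close>

definition sq :: "int fps \<Rightarrow> int fps" where "sq f = f oo fps_X ^ 2"

definition neg :: "int fps \<Rightarrow> int fps" where "neg f = f oo (- fps_X)"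

definition theta_D :: "int fps \<Rightarrow> int fps" where "theta_D f = fps_X * fps_deriv f"

lemma sq_nth: "sq f $ n = (if even n then f $ (n div 2) else 0)"
proof -
  have "sq f $ n = (\<Sum>i = 0..n. if 2 * i = n then f $ i else 0)"
    unfolding sq_def fps_compose_nth
    by (rule sum.cong) (auto simp: power_mult[symmetric] fps_X_power_nth)
  also have "\<dots> = (\<Sum>i = 0..n. if i = n div 2 then (if even n then f $ i else 0) else 0)"
    by (rule sum.cong) auto
  also have "\<dots> = (if even n then f $ (n div 2) else 0)" by simp
  finally show ?thesis .
qed

lemma neg_nth: "neg f $ n = (- 1) ^ n * f $ n"
  by (simp add: neg_def fps_compose_uminus')

lemma theta_D_nth: "theta_D f $ n = int n * f $ n"
  by (simp add: theta_D_def fps_mult_fps_X_deriv_shift)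

lemma sq_mult: "sq (f * g) = sq f * sq g"
  by (simp add: sq_def fps_compose_mult_distrib)

lemma sq_power: "sq (f ^ n) = sq f ^ n"
  by (simp add: sq_def fps_compose_power)

lemma sq_diff: "sq (f - g) = sq f - sq g"
  by (simp add: fps_eq_iff sq_nth)

lemma sq_numeral: "sq (numeral k) = numeral k"
  by (simp add: fps_eq_iff sq_nth fps_numeral_nth) (auto elim!: evenE)

lemma sq_inject: "sq f = sq g \<Longrightarrow> f = g"
proof (rule fps_ext)
  fix n assume "sq f = sq g"
  then have "sq f $ (2 * n) = sq g $ (2 * n)" by simp
  then show "f $ n = g $ n" by (simp add: sq_nth)
qed

lemma neg_mult: "neg (f * g) = neg f * neg g"
  by (simp add: neg_def fps_compose_mult_distrib)

lemma neg_power: "neg (f ^ n) = neg f ^ n"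
  by (simp add: neg_def fps_compose_power)

lemma neg_numeral: "neg (numeral k) = numeral k"
  by (simp add: fps_eq_iff neg_nth fps_numeral_nth)

lemma neg_sq: "neg (sq f) = sq f"
  by (auto simp: fps_eq_iff neg_nth sq_nth)

lemma theta_D_mult: "theta_D (f * g) = theta_D f * g + f * theta_D g"
  by (simp add: theta_D_def algebra_simps)

lemma theta_D_power_Suc: "theta_D (f ^ Suc n) = of_nat (Suc n) * f ^ n * theta_D f"
  by (induction n) (simp_all add: theta_D_mult algebra_simps)

lemma theta_D_sq: "theta_D (sq f) = 2 * sq (theta_D f)"
  by (auto simp: fps_eq_iff theta_D_nth sq_nth fps_numeral_fps_const elim!: evenE)

lemma theta_D_neg: "theta_D (neg f) = neg (theta_D f)"
  by (simp add: fps_eq_iff theta_D_nth neg_nth)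

lemma theta_D_numeral_mult: "theta_D (numeral k * f) = numeral k * theta_D f"
  by (simp add: fps_eq_iff theta_D_nth fps_numeral_fps_const)

text \<open>As a has no constant term, n f_n is determined by the coefficients below n: a series is
  known from its logarithmic derivative and its constant term.\<close>

lemma theta_D_unique:
  assumes "theta_D f = a * f" "theta_D g = a * g" "a $ 0 = 0" "f $ 0 = g $ 0"
  shows "f = g"
proof (rule fps_ext)
  fix n show "f $ n = g $ n"
  proof (induction n rule: less_induct)
    case (less n)
    show ?case
    proof (cases "n = 0")
      case False
      have "(\<Sum>i = 0..n. a $ i * f $ (n - i)) = (\<Sum>i = 0..n. a $ i * g $ (n - i))"
      proof (rule sum.cong, simp)
        fix i assume "i \<in> {0..n}"
        then show "a $ i * f $ (n - i) = a $ i * g $ (n - i)"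
          using less.IH[of "n - i"] assms(3) False by (cases "i = 0") auto
      qed
      then have "int n * f $ n = int n * g $ n"
        using arg_cong[OF assms(1), of "\<lambda>F. F $ n"] arg_cong[OF assms(2), of "\<lambda>F. F $ n"]
        by (simp add: theta_D_nth fps_mult_nth)
      then show ?thesis using False by simp
    qed (use assms in simp)
  qed
qed

text \<open>The difference d satisfies d (f + g) = G d(q^2). If d starts in degree n > 0, the right
  side starts in degree 2 n or later, while the left side has the coefficient 2 f_0 d_n in degree
  n.\<close>

lemma square_eq_mult_sq_unique:
  assumes f: "f ^ 2 = G * sq f" and g: "g ^ 2 = G * sq g" and "f $ 0 = g $ 0" "f $ 0 \<noteq> 0"
  shows "f = g"
proof -
  define d where "d = f - g"
  have d: "d * (f + g) = G * sq d"
    using f g by (simp add: d_def sq_diff algebra_simps power2_eq_square)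
  have "d $ n = 0" for n
  proof (induction n rule: less_induct)
    case (less n)
    show ?case
    proof (cases "n = 0")
      case True then show ?thesis using assms by (simp add: d_def)
    next
      case False
      have "(d * (f + g)) $ n = (\<Sum>i = 0..n. d $ i * (f + g) $ (n - i))" by (rule fps_mult_nth)
      also have "\<dots> = (\<Sum>i = 0..n. if i = n then d $ n * (f + g) $ 0 else 0)"
        using less by (intro sum.cong) auto
      also have "\<dots> = d $ n * (f $ 0 + g $ 0)" by simp
      finally have "(d * (f + g)) $ n = d $ n * (f $ 0 + g $ 0)" .
      moreover have "(G * sq d) $ n = 0"
        unfolding fps_mult_nth using less False by (intro sum.neutral) (auto simp: sq_nth)
      ultimately show ?thesis using d assms(3,4) by simp
    qed
  qed
  then have "d = 0" by (simp add: fps_eq_iff)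
  then show ?thesis by (simp add: d_def)
qed

text \<open>The Cauchy product for series indexed by solutions of equations: disjointness of the
  sets \<open>A n\<close> makes the degree k a function of s, so a product is computed by naming the
  set P of combined solutions.\<close>

lemma Abs_fps_mult_nth:
  fixes w :: "'a \<Rightarrow> int" and v :: "'b \<Rightarrow> int"
  assumes fin: "\<And>n. finite (A n)" "\<And>n. finite (B n)"
    and disj: "\<And>m n. m \<noteq> n \<Longrightarrow> A m \<inter> A n = {}"
    and P: "\<And>s t. (s, t) \<in> P \<longleftrightarrow> (\<exists>k\<le>n. s \<in> A k \<and> t \<in> B (n - k))"
  shows "(Abs_fps (\<lambda>n. \<Sum>s\<in>A n. w s) * Abs_fps (\<lambda>n. \<Sum>t\<in>B n. v t)) $ n = (\<Sum>(s, t)\<in>P. w s * v t)"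
proof -
  have "(Abs_fps (\<lambda>n. \<Sum>s\<in>A n. w s) * Abs_fps (\<lambda>n. \<Sum>t\<in>B n. v t)) $ n =
      (\<Sum>k = 0..n. \<Sum>(s, t)\<in>A k \<times> B (n - k). w s * v t)"
    by (simp add: fps_mult_nth sum_product sum.cartesian_product)
  also have "\<dots> = (\<Sum>(s, t)\<in>(\<Union>k\<in>{0..n}. A k \<times> B (n - k)). w s * v t)"
    using fin disj by (subst sum.UNION_disjoint) blast+
  also have "(\<Union>k\<in>{0..n}. A k \<times> B (n - k)) = P"
  proof (intro Set.set_eqI)
    fix x show "x \<in> (\<Union>k\<in>{0..n}. A k \<times> B (n - k)) \<longleftrightarrow> x \<in> P" using P by (cases x) force
  qed
  finally show ?thesis .
qed

lemma finite_int_square_eq: "finite {i::int. i\<^sup>2 = c}"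
  by (rule finite_subset[OF _ finite_square_le[of c]]) auto

lemma finite_int_square_eq': "k > 0 \<Longrightarrow> finite {i::int. k * i\<^sup>2 = c}"
  by (rule finite_subset[OF _ finite_int_square_eq[of "c div k"]]) auto

lemma sum_symmetric_squares:
  fixes f :: "int \<Rightarrow> int"
  assumes "\<And>i. f (- i) = f i" "c \<noteq> 0"
  shows "(\<Sum>i | i\<^sup>2 = c. f i) = 2 * (\<Sum>i | i > 0 \<and> i\<^sup>2 = c. f i)"
proof -
  have "{i. i\<^sup>2 = c} = {i. i > 0 \<and> i\<^sup>2 = c} \<union> {i. i < 0 \<and> i\<^sup>2 = c}" using assms(2) by force
  then have "(\<Sum>i | i\<^sup>2 = c. f i) = sum f ({i. i > 0 \<and> i\<^sup>2 = c} \<union> {i. i < 0 \<and> i\<^sup>2 = c})"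
    by (rule arg_cong)
  also have "\<dots> = (\<Sum>i | i > 0 \<and> i\<^sup>2 = c. f i) + (\<Sum>i | i < 0 \<and> i\<^sup>2 = c. f i)"
  proof (rule sum.union_disjoint)
    show "finite {i::int. i > 0 \<and> i\<^sup>2 = c}" "finite {i::int. i < 0 \<and> i\<^sup>2 = c}"
      by (rule finite_subset[OF _ finite_int_square_eq[of c]]; blast)+
  qed auto
  also have "(\<Sum>i | i < 0 \<and> i\<^sup>2 = c. f i) = (\<Sum>i | i > 0 \<and> i\<^sup>2 = c. f i)"
    by (rule sum.reindex_bij_witness[of _ uminus uminus]) (auto simp: assms)
  finally show ?thesis by simp
qed

text \<open>\<open>psi2\<close> and \<open>U2\<close> are twice the series \<open>\<psi>(q) = \<Sum>q\<^bsup>j(j+1)/2\<^esup>\<close> and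
  \<open>\<Sum>(-1)\<^sup>j (2j+1) q\<^bsup>j(j+1)/2\<^esup>\<close> over \<open>j \<ge> 0\<close>: the index is \<open>i = \<plusminus>(2j+1)\<close>.\<close>

definition phi :: "int fps" where "phi = Abs_fps (\<lambda>n. \<Sum>i | i\<^sup>2 = int n. 1)"
definition phim :: "int fps" where "phim = Abs_fps (\<lambda>n. \<Sum>i | i\<^sup>2 = int n. sgp i)"
definition psi2 :: "int fps" where "psi2 = Abs_fps (\<lambda>n. \<Sum>i | i\<^sup>2 = 8 * int n + 1. 1)"
definition U2 :: "int fps" where "U2 = Abs_fps (\<lambda>n. \<Sum>i | i\<^sup>2 = 8 * int n + 1. chi_m4 i * i)"
definition Lam :: "int fps" where
  "Lam = Abs_fps (\<lambda>n. \<Sum>(d, e) | d > 0 \<and> e > 0 \<and> d * e = int n. d)"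
definition Lamo :: "int fps" where
  "Lamo = Abs_fps (\<lambda>n. \<Sum>(d, e) | d > 0 \<and> e > 0 \<and> d * e = int n \<and> odd e. d)"
definition Sigo :: "int fps" where
  "Sigo = Abs_fps (\<lambda>n. \<Sum>d | d > 0 \<and> d dvd 2 * int n + 1. d)"

lemma neg_phi: "neg phi = phim"
proof (rule fps_ext)
  fix n
  have "(- 1) ^ n = sgp i" if "i\<^sup>2 = int n" for i
  proof -
    have "even n = even (i\<^sup>2)" using that by simp
    then show ?thesis by (auto simp: sgp_def)
  qed
  then have "(\<Sum>i | i\<^sup>2 = int n. sgp i) = (\<Sum>i | i\<^sup>2 = int n. (- 1) ^ n)" by (intro sum.cong) auto
  then show "neg phi $ n = phim $ n" by (simp add: neg_nth phi_def phim_def)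
qed

text \<open>An odd square is 1 modulo 8, so i^2 = 4 n + 1 is solvable only for even n, where it is
  the equation of \<open>psi2\<close>. The same congruence is behind
  \<open>sq_sq_U2\<close>.\<close>

lemma sq_psi2: "sq psi2 = Abs_fps (\<lambda>n. \<Sum>i | i\<^sup>2 = 4 * int n + 1. 1)"
proof (rule fps_ext)
  fix n
  show "sq psi2 $ n = Abs_fps (\<lambda>n. \<Sum>i | i\<^sup>2 = 4 * int n + 1. 1) $ n"
  proof (cases "even n")
    case True then show ?thesis by (auto simp: sq_nth psi2_def elim!: evenE)
  next
    case False
    have "i\<^sup>2 \<noteq> 4 * int n + 1" for i
    proof
      assume h: "i\<^sup>2 = 4 * int n + 1"
      then have "odd (i\<^sup>2)" by simp
      then have "i\<^sup>2 mod 8 = 1" by (intro odd_square_mod_8) simp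
      then show False using h False by presburger
    qed
    then show ?thesis using False by (simp add: sq_nth)
  qed
qed

lemma sq_phim: "sq phim = Abs_fps (\<lambda>n. \<Sum>i | 2 * i\<^sup>2 = int n. sgp i)"
proof (rule fps_ext)
  fix n
  show "sq phim $ n = Abs_fps (\<lambda>n. \<Sum>i | 2 * i\<^sup>2 = int n. sgp i) $ n"
  proof (cases "even n")
    case True then show ?thesis by (auto simp: sq_nth phim_def elim!: evenE)
  next
    case False
    have "2 * i\<^sup>2 \<noteq> int n" for i using False by presburger
    then show ?thesis using False by (simp add: sq_nth)
  qed
qed

lemma sq_sq_U2: "sq (sq U2) = Abs_fps (\<lambda>n. \<Sum>i | i\<^sup>2 = 2 * int n + 1. chi_m4 i * i)"
proof (rule fps_ext)
  fix n
  show "sq (sq U2) $ n = Abs_fps (\<lambda>n. \<Sum>i | i\<^sup>2 = 2 * int n + 1. chi_m4 i * i) $ n"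
  proof (cases "4 dvd n")
    case True then show ?thesis by (auto simp: sq_nth U2_def elim!: dvdE)
  next
    case False
    have "i\<^sup>2 \<noteq> 2 * int n + 1" for i
    proof
      assume h: "i\<^sup>2 = 2 * int n + 1"
      then have "odd (i\<^sup>2)" by simp
      then have "i\<^sup>2 mod 8 = 1" by (intro odd_square_mod_8) simp
      then show False using h False by presburger
    qed
    moreover have "sq (sq U2) $ n = 0" using False by (auto simp: sq_nth)
    ultimately show ?thesis by simp
  qed
qed

section \<open>Identities for pairs of squares\<close>

lemma phi_mult_nth:
  fixes w v :: "int \<Rightarrow> int"
  shows "(Abs_fps (\<lambda>n. \<Sum>i | i\<^sup>2 = int n. w i) * Abs_fps (\<lambda>n. \<Sum>i | i\<^sup>2 = int n. v i)) $ n =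
    (\<Sum>(x, y) | x\<^sup>2 + y\<^sup>2 = int n. w x * v y)"
proof (rule Abs_fps_mult_nth)
  fix s t :: int
  show "((s, t) \<in> {(x, y). x\<^sup>2 + y\<^sup>2 = int n}) = (\<exists>k\<le>n. s \<in> {i. i\<^sup>2 = int k} \<and> t \<in> {i. i\<^sup>2 = int (n - k)})"
  proof
    assume "(s, t) \<in> {(x, y). x\<^sup>2 + y\<^sup>2 = int n}"
    then have h: "s\<^sup>2 + t\<^sup>2 = int n" by simp
    then have "nat (s\<^sup>2) \<le> n" "t\<^sup>2 = int (n - nat (s\<^sup>2))"
      using zero_le_power2[of s] zero_le_power2[of t] by linarith+
    then show "\<exists>k\<le>n. s \<in> {i. i\<^sup>2 = int k} \<and> t \<in> {i. i\<^sup>2 = int (n - k)}"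
      by (intro exI[of _ "nat (s\<^sup>2)"]) simp
  qed (auto simp: of_nat_diff)
qed (auto simp: finite_int_square_eq)

lemma finite_sum_two_squares: "finite {(x, y). x\<^sup>2 + y\<^sup>2 = (c::int)}"
proof (rule finite_subset)
  show "{(x, y). x\<^sup>2 + y\<^sup>2 = c} \<subseteq> {t. t\<^sup>2 \<le> c} \<times> {t. t\<^sup>2 \<le> c}" by auto
qed (simp add: finite_square_le)

lemma sum_antisymmetric:
  fixes f :: "int \<Rightarrow> int \<Rightarrow> int"
  assumes "\<And>x y. (x, y) \<in> S \<Longrightarrow> (y, x) \<in> S" "\<And>x y. (x, y) \<in> S \<Longrightarrow> f y x = - f x y"
  shows "(\<Sum>(x, y)\<in>S. f x y) = 0"
proof -
  have "(\<Sum>(x, y)\<in>S. f x y) = (\<Sum>(x, y)\<in>S. - f x y)"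
  proof (rule sum.reindex_bij_witness[of _ prod.swap prod.swap])
    fix a assume a: "a \<in> S"
    obtain x y where xy: "a = (x, y)" by (cases a)
    have "- f y x = f x y" using assms(2)[of x y] a xy by (metis minus_minus)
    then show "(case prod.swap a of (x, y) \<Rightarrow> - f x y) = (case a of (x, y) \<Rightarrow> f x y)" by (simp add: xy)
  qed (use assms(1) in auto)
  then show ?thesis by (simp add: sum_negf case_prod_unfold)
qed

lemma sum_split_parity:
  fixes f :: "int \<Rightarrow> int \<Rightarrow> int"
  shows "(\<Sum>(x, y) | x\<^sup>2 + y\<^sup>2 = (c::int). f x y) =
    (\<Sum>(x, y) | x\<^sup>2 + y\<^sup>2 = c \<and> even (x + y). f x y) + (\<Sum>(x, y) | x\<^sup>2 + y\<^sup>2 = c \<and> odd (x + y). f x y)"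
proof -
  have "{(x, y). x\<^sup>2 + y\<^sup>2 = c} = {(x, y). x\<^sup>2 + y\<^sup>2 = c \<and> even (x + y)} \<union> {(x, y). x\<^sup>2 + y\<^sup>2 = c \<and> odd (x + y)}"
    by blast
  then have "(\<Sum>(x, y) | x\<^sup>2 + y\<^sup>2 = c. f x y) =
      (\<Sum>(x, y)\<in>{(x, y). x\<^sup>2 + y\<^sup>2 = c \<and> even (x + y)} \<union> {(x, y). x\<^sup>2 + y\<^sup>2 = c \<and> odd (x + y)}. f x y)"
    by (rule arg_cong)
  also have "\<dots> = (\<Sum>(x, y) | x\<^sup>2 + y\<^sup>2 = c \<and> even (x + y). f x y) + (\<Sum>(x, y) | x\<^sup>2 + y\<^sup>2 = c \<and> odd (x + y). f x y)"
    by (rule sum.union_disjoint) (auto intro: finite_subset[OF _ finite_sum_two_squares[of c]])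
  finally show ?thesis .
qed

text \<open>For odd x + y, interchanging x and y changes the sign (-1)^y, so these pairs cancel. For
  even x + y put x = u + v, y = u - v, where (-1)^y = (-1)^u (-1)^v.\<close>

theorem phi_mult_phim: "phi * phim = sq phim ^ 2"
proof (rule fps_ext)
  fix n
  have "(phi * phim) $ n = (\<Sum>(x, y) | x\<^sup>2 + y\<^sup>2 = int n. sgp y)"
    unfolding phi_def phim_def by (subst phi_mult_nth) simp
  also have "\<dots> = (\<Sum>(x, y) | x\<^sup>2 + y\<^sup>2 = int n \<and> even (x + y). sgp y)"
  proof -
    have "(\<Sum>(x, y) | x\<^sup>2 + y\<^sup>2 = int n \<and> odd (x + y). sgp y) = 0"
      by (rule sum_antisymmetric) (auto simp: sgp_def add.commute)
    then show ?thesis by (subst sum_split_parity) simp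
  qed
  also have "\<dots> = (\<Sum>(u, v) | 2 * u\<^sup>2 + 2 * v\<^sup>2 = int n. sgp u * sgp v)"
  proof (rule sum.reindex_bij_witness[of _ "\<lambda>(u, v). (u + v, u - v)" "\<lambda>(x, y). ((x + y) div 2, (x - y) div 2)"])
    fix a assume "a \<in> {(x, y). x\<^sup>2 + y\<^sup>2 = int n \<and> even (x + y)}"
    then obtain x y where a: "a = (x, y)" "x\<^sup>2 + y\<^sup>2 = int n" "even (x + y)" by blast
    then obtain u where "x + y = 2 * u" by (elim evenE)
    then have "x = u + (x - u) \<and> y = u - (x - u)" by simp
    then obtain v where xy: "x = u + v" "y = u - v" by blast
    show "(case case a of (x, y) \<Rightarrow> ((x + y) div 2, (x - y) div 2) of (u, v) \<Rightarrow> (u + v, u - v)) = a"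
      by (simp add: a xy)
    show "(case a of (x, y) \<Rightarrow> ((x + y) div 2, (x - y) div 2)) \<in> {(u, v). 2 * u\<^sup>2 + 2 * v\<^sup>2 = int n}"
      using a(2) by (simp add: a xy power2_eq_square algebra_simps)
    show "(case case a of (x, y) \<Rightarrow> ((x + y) div 2, (x - y) div 2) of (u, v) \<Rightarrow> sgp u * sgp v) = (case a of (x, y) \<Rightarrow> sgp y)"
      by (auto simp: a xy sgp_def)
  qed (auto simp: power2_eq_square algebra_simps)
  also have "\<dots> = (sq phim ^ 2) $ n"
  proof -
    have "(sq phim * sq phim) $ n = (\<Sum>(u, v) | 2 * u\<^sup>2 + 2 * v\<^sup>2 = int n. sgp u * sgp v)"
      unfolding sq_phim
    proof (rule Abs_fps_mult_nth)
      fix s t :: int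
      show "((s, t) \<in> {(u, v). 2 * u\<^sup>2 + 2 * v\<^sup>2 = int n}) = (\<exists>k\<le>n. s \<in> {i. 2 * i\<^sup>2 = int k} \<and> t \<in> {i. 2 * i\<^sup>2 = int (n - k)})"
      proof
        assume "(s, t) \<in> {(u, v). 2 * u\<^sup>2 + 2 * v\<^sup>2 = int n}"
        then have h: "2 * s\<^sup>2 + 2 * t\<^sup>2 = int n" by simp
        then have "nat (2 * s\<^sup>2) \<le> n" "2 * t\<^sup>2 = int (n - nat (2 * s\<^sup>2))"
          using zero_le_power2[of s] zero_le_power2[of t] by linarith+
        then show "\<exists>k\<le>n. s \<in> {i. 2 * i\<^sup>2 = int k} \<and> t \<in> {i. 2 * i\<^sup>2 = int (n - k)}"
          by (intro exI[of _ "nat (2 * s\<^sup>2)"]) simp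
      qed (auto simp: of_nat_diff)
    qed (auto simp: finite_int_square_eq')
    then show ?thesis by (simp add: power2_eq_square)
  qed
  finally show "(phi * phim) $ n = (sq phim ^ 2) $ n" .
qed

lemma odd_square_sum_exp:
  fixes s t :: int
  assumes "odd s" "odd t" "s\<^sup>2 + t\<^sup>2 = 8 * int n + 2"
  shows "\<exists>k\<le>n. s\<^sup>2 = 8 * int k + 1 \<and> t\<^sup>2 = 8 * int (n - k) + 1"
proof -
  have m: "s\<^sup>2 mod 8 = 1" "t\<^sup>2 mod 8 = 1" using odd_square_mod_8 assms by auto
  define a b where "a = s\<^sup>2 div 8" and "b = t\<^sup>2 div 8"
  have ab: "s\<^sup>2 = 8 * a + 1" "t\<^sup>2 = 8 * b + 1" using m unfolding a_def b_def by presburger+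
  have "a \<ge> 0" "b \<ge> 0" using ab zero_le_power2[of s] zero_le_power2[of t] by presburger+
  then have "nat a \<le> n" "s\<^sup>2 = 8 * int (nat a) + 1" "t\<^sup>2 = 8 * int (n - nat a) + 1"
    using assms(3) ab by linarith+
  then show ?thesis by blast
qed

text \<open>With i = u + v, j = u - v the equation becomes u^2 + v^2 = 4 n + 1, where exactly one of
  u, v is even. Calling it 2 y gives a term of \<phi>(q) times \<open>sq psi2\<close>; the choice of
  the even one is the factor 2.\<close>

theorem psi2_square: "psi2 ^ 2 = 2 * phi * sq psi2"
proof (rule fps_ext)
  fix n
  let ?Y = "{(y, l). 4 * y\<^sup>2 + l\<^sup>2 = 4 * int n + 1}"
  have "(psi2 * psi2) $ n = (\<Sum>(i, j) | i\<^sup>2 + j\<^sup>2 = 8 * int n + 2. 1 * 1)"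
    unfolding psi2_def
  proof (rule Abs_fps_mult_nth)
    fix s t :: int
    show "((s, t) \<in> {(i, j). i\<^sup>2 + j\<^sup>2 = 8 * int n + 2}) = (\<exists>k\<le>n. s \<in> {i. i\<^sup>2 = 8 * int k + 1} \<and> t \<in> {i. i\<^sup>2 = 8 * int (n - k) + 1})"
    proof
      assume "(s, t) \<in> {(i, j). i\<^sup>2 + j\<^sup>2 = 8 * int n + 2}"
      then have h: "s\<^sup>2 + t\<^sup>2 = 8 * int n + 2" by simp
      have "odd s \<and> odd t"
      proof (rule ccontr)
        assume "\<not> (odd s \<and> odd t)"
        moreover have "even (s\<^sup>2 + t\<^sup>2)" using h by simp
        ultimately have "even s" "even t" by auto
        then obtain a b where "s = 2 * a" "t = 2 * b" by (auto elim!: evenE)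
        then have "4 * (a\<^sup>2 + b\<^sup>2) = 8 * int n + 2" using h by (simp add: power_mult_distrib)
        then show False by presburger
      qed
      then show "\<exists>k\<le>n. s \<in> {i. i\<^sup>2 = 8 * int k + 1} \<and> t \<in> {i. i\<^sup>2 = 8 * int (n - k) + 1}"
        using odd_square_sum_exp[OF _ _ h] by auto
    qed (auto simp: of_nat_diff)
  qed (auto simp: finite_int_square_eq)
  also have "\<dots> = int (card {(i, j). i\<^sup>2 + j\<^sup>2 = 8 * int n + 2})" by simp
  also have "{(i, j). i\<^sup>2 + j\<^sup>2 = 8 * int n + 2} = (\<lambda>(y, l). (l + 2 * y, l - 2 * y)) ` ?Y \<union> (\<lambda>(y, l). (2 * y + l, 2 * y - l)) ` ?Y"
  proof (intro equalityI subsetI)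
    fix a assume "a \<in> {(i, j). i\<^sup>2 + j\<^sup>2 = 8 * int n + 2}"
    then obtain i j where a: "a = (i, j)" "i\<^sup>2 + j\<^sup>2 = 8 * int n + 2" by blast
    have "even (i\<^sup>2 + j\<^sup>2)" using a(2) by simp
    then have "even (i + j)" by simp
    then obtain u where "i + j = 2 * u" by (elim evenE)
    then have "i = u + (i - u) \<and> j = u - (i - u)" by simp
    then obtain v where ij: "i = u + v" "j = u - v" by blast
    have uv: "u\<^sup>2 + v\<^sup>2 = 4 * int n + 1" using a(2) unfolding ij by (simp add: power2_eq_square algebra_simps)
    then have "odd (u\<^sup>2 + v\<^sup>2)" by simp
    then consider "even v" | "even u" by auto
    then show "a \<in> (\<lambda>(y, l). (l + 2 * y, l - 2 * y)) ` ?Y \<union> (\<lambda>(y, l). (2 * y + l, 2 * y - l)) ` ?Y"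
    proof cases
      case 1
      then obtain y where v: "v = 2 * y" by (elim evenE)
      then have "(y, u) \<in> ?Y" using uv by (simp add: power_mult_distrib)
      then show ?thesis unfolding a ij v by force
    next
      case 2
      then obtain y where u: "u = 2 * y" by (elim evenE)
      then have "(y, v) \<in> ?Y" using uv by (simp add: power_mult_distrib)
      then show ?thesis unfolding a ij u by force
    qed
  qed (auto simp: power2_eq_square algebra_simps)
  also have "card \<dots> = card ?Y + card ?Y"
  proof -
    have fin: "finite ?Y"
    proof (rule finite_subset)
      show "?Y \<subseteq> (\<lambda>(x, l). (x div 2, l)) ` {(x, y). x\<^sup>2 + y\<^sup>2 = 4 * int n + 1}"
      proof clarify
        fix y l :: int assume "4 * y\<^sup>2 + l\<^sup>2 = 4 * int n + 1"
        then have "(2 * y, l) \<in> {(x, y). x\<^sup>2 + y\<^sup>2 = 4 * int n + 1}" by (simp add: power_mult_distrib)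
        then show "(y, l) \<in> (\<lambda>(x, l). (x div 2, l)) ` {(x, y). x\<^sup>2 + y\<^sup>2 = 4 * int n + 1}"
          by (rule rev_image_eqI) simp
      qed
    qed (simp add: finite_sum_two_squares)
    have odd_l: "odd l" if "(y, l) \<in> ?Y" for y l
    proof -
      have "odd (4 * y\<^sup>2 + l\<^sup>2)" using that by simp
      then show ?thesis by simp
    qed
    have "(\<lambda>(y, l). (l + 2 * y, l - 2 * y)) ` ?Y \<inter> (\<lambda>(y, l). (2 * y + l, 2 * y - l)) ` ?Y = {}"
    proof (rule ccontr)
      assume "\<not> ?thesis"
      then obtain y l y' l' where h: "(y, l) \<in> ?Y" "l + 2 * y = 2 * y' + l'" "l - 2 * y = 2 * y' - l'" by fastforce
      then have "2 * l = 4 * y'" by linarith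
      then show False using odd_l[OF h(1)] by presburger
    qed
    moreover have "card ((\<lambda>(y, l). (l + 2 * y, l - 2 * y)) ` ?Y) = card ?Y"
      "card ((\<lambda>(y, l). (2 * y + l, 2 * y - l)) ` ?Y) = card ?Y"
      by (rule card_image; auto simp: inj_on_def)+
    ultimately show ?thesis using fin by (simp add: card_Un_disjoint)
  qed
  finally have L: "(psi2 * psi2) $ n = 2 * int (card ?Y)" by simp
  have "(phi * sq psi2) $ n = (\<Sum>(y, l)\<in>?Y. 1 * 1)"
    unfolding phi_def sq_psi2
  proof (rule Abs_fps_mult_nth)
    fix s t :: int
    show "((s, t) \<in> ?Y) = (\<exists>k\<le>n. s \<in> {i. i\<^sup>2 = int k} \<and> t \<in> {i. i\<^sup>2 = 4 * int (n - k) + 1})"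
    proof
      assume "(s, t) \<in> ?Y"
      then have h: "4 * s\<^sup>2 + t\<^sup>2 = 4 * int n + 1" by simp
      then have "nat (s\<^sup>2) \<le> n" "t\<^sup>2 = 4 * int (n - nat (s\<^sup>2)) + 1"
        using zero_le_power2[of s] zero_le_power2[of t] by linarith+
      then show "\<exists>k\<le>n. s \<in> {i. i\<^sup>2 = int k} \<and> t \<in> {i. i\<^sup>2 = 4 * int (n - k) + 1}"
        by (intro exI[of _ "nat (s\<^sup>2)"]) simp
    qed (auto simp: of_nat_diff)
  qed (auto simp: finite_int_square_eq)
  then have "(2 * (phi * sq psi2)) $ n = 2 * int (card ?Y)" by (simp add: fps_numeral_fps_const)
  then show "(psi2 ^ 2) $ n = (2 * phi * sq psi2) $ n" using L by (simp add: power2_eq_square mult.assoc)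
qed

text \<open>Pairs are weighted by (-1)^y (x^2 - y^2), which is antisymmetric for even x + y. For odd
  x + y the numbers i = x + y, j = x - y are odd with i j = x^2 - y^2, i^2 + j^2 = 2 n and \<chi>(i)
  \<chi>(j) = (-1)^y. Since i^2 and j^2 have the form 2 k + 1, the degree drops by one, whence
  \<open>fps_X\<close>.\<close>

theorem phi_wronskian: "theta_D phi * phim - phi * theta_D phim = fps_X * sq (sq U2) ^ 2"
proof (rule fps_ext)
  fix n
  have D: "theta_D (Abs_fps (\<lambda>n. \<Sum>i | i\<^sup>2 = int n. w i)) = Abs_fps (\<lambda>n. \<Sum>i | i\<^sup>2 = int n. i\<^sup>2 * w i)" for w
    by (simp add: fps_eq_iff theta_D_nth sum_distrib_left)
  have "(theta_D phi * phim - phi * theta_D phim) $ n =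
      (\<Sum>(x, y) | x\<^sup>2 + y\<^sup>2 = int n. sgp y * (x\<^sup>2 - y\<^sup>2))"
    unfolding phi_def phim_def D fps_sub_nth phi_mult_nth sum_subtractf[symmetric]
    by (rule sum.cong) (auto simp: algebra_simps)
  also have "\<dots> = (\<Sum>(x, y) | x\<^sup>2 + y\<^sup>2 = int n \<and> odd (x + y). sgp y * (x\<^sup>2 - y\<^sup>2))"
  proof -
    have "(\<Sum>(x, y) | x\<^sup>2 + y\<^sup>2 = int n \<and> even (x + y). sgp y * (x\<^sup>2 - y\<^sup>2)) = 0"
      by (rule sum_antisymmetric) (auto simp: sgp_def algebra_simps)
    then show ?thesis by (subst sum_split_parity) simp
  qed
  also have "\<dots> = (fps_X * sq (sq U2) ^ 2) $ n"
  proof (cases n)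
    case 0
    have e: "{(x, y). x\<^sup>2 + y\<^sup>2 = int n \<and> odd (x + y)} = ({} :: (int \<times> int) set)" using 0 by auto
    show ?thesis unfolding e using 0 by simp
  next
    case (Suc m)
    have "(sq (sq U2) * sq (sq U2)) $ m = (\<Sum>(i, j) | i\<^sup>2 + j\<^sup>2 = 2 * int m + 2 \<and> odd i. (chi_m4 i * i) * (chi_m4 j * j))"
      unfolding sq_sq_U2
    proof (rule Abs_fps_mult_nth)
      fix s t :: int
      show "((s, t) \<in> {(i, j). i\<^sup>2 + j\<^sup>2 = 2 * int m + 2 \<and> odd i}) = (\<exists>k\<le>m. s \<in> {i. i\<^sup>2 = 2 * int k + 1} \<and> t \<in> {i. i\<^sup>2 = 2 * int (m - k) + 1})"
      proof
        assume "(s, t) \<in> {(i, j). i\<^sup>2 + j\<^sup>2 = 2 * int m + 2 \<and> odd i}"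
        then have h: "s\<^sup>2 + t\<^sup>2 = 2 * int m + 2" "odd s" by auto
        then have "odd (s\<^sup>2)" by simp
        then obtain a where a: "s\<^sup>2 = 2 * a + 1" by (elim oddE)
        have t: "t\<^sup>2 = 2 * (int m - a) + 1" using h(1) a by simp
        have "a \<ge> 0" "int m - a \<ge> 0" using a t zero_le_power2[of s] zero_le_power2[of t] by presburger+
        then show "\<exists>k\<le>m. s \<in> {i. i\<^sup>2 = 2 * int k + 1} \<and> t \<in> {i. i\<^sup>2 = 2 * int (m - k) + 1}"
          using a t by (intro exI[of _ "nat a"]) (auto simp: of_nat_diff nat_le_iff)
      next
        assume "\<exists>k\<le>m. s \<in> {i. i\<^sup>2 = 2 * int k + 1} \<and> t \<in> {i. i\<^sup>2 = 2 * int (m - k) + 1}"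
        then obtain k where k: "k \<le> m" "s\<^sup>2 = 2 * int k + 1" "t\<^sup>2 = 2 * int (m - k) + 1" by auto
        have "odd (s\<^sup>2)" using k by simp
        then have "odd s" by simp
        then show "(s, t) \<in> {(i, j). i\<^sup>2 + j\<^sup>2 = 2 * int m + 2 \<and> odd i}" using k by (simp add: of_nat_diff)
      qed
    qed (auto simp: finite_int_square_eq)
    also have "\<dots> = (\<Sum>(x, y) | x\<^sup>2 + y\<^sup>2 = int n \<and> odd (x + y). sgp y * (x\<^sup>2 - y\<^sup>2))"
    proof (rule sum.reindex_bij_witness[of _ "\<lambda>(u, v). (u + v, u - v)" "\<lambda>(i, j). ((i + j) div 2, (i - j) div 2)"])
      fix a assume "a \<in> {(i, j). i\<^sup>2 + j\<^sup>2 = 2 * int m + 2 \<and> odd i}"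
      then obtain i j where a: "a = (i, j)" "i\<^sup>2 + j\<^sup>2 = 2 * int m + 2" "odd i" by blast
      have "even (i\<^sup>2 + j\<^sup>2)" using a(2) by simp
      then have "even (i + j)" by simp
      then obtain u where "i + j = 2 * u" by (elim evenE)
      then have "i = u + (i - u) \<and> j = u - (i - u)" by simp
    then obtain v where ij: "i = u + v" "j = u - v" by blast
      show "(case case a of (i, j) \<Rightarrow> ((i + j) div 2, (i - j) div 2) of (u, v) \<Rightarrow> (u + v, u - v)) = a"
        by (simp add: a ij)
      show "(case a of (i, j) \<Rightarrow> ((i + j) div 2, (i - j) div 2)) \<in> {(x, y). x\<^sup>2 + y\<^sup>2 = int n \<and> odd (x + y)}"
        using a(2,3) Suc by (simp add: a ij power2_eq_square algebra_simps)
      have "chi_m4 (u + v) * chi_m4 (u - v) = sgp v"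
        using a(3) unfolding ij chi_m4_def sgp_def by presburger
      then show "(case case a of (i, j) \<Rightarrow> ((i + j) div 2, (i - j) div 2) of (x, y) \<Rightarrow> sgp y * (x\<^sup>2 - y\<^sup>2)) =
          (case a of (i, j) \<Rightarrow> (chi_m4 i * i) * (chi_m4 j * j))"
        by (simp add: a ij power2_eq_square) (simp add: algebra_simps)
    qed (use Suc in \<open>auto simp: power2_eq_square algebra_simps\<close>)
    finally show ?thesis using Suc by (simp add: power2_eq_square)
  qed
  finally show "(theta_D phi * phim - phi * theta_D phim) $ n = (fps_X * sq (sq U2) ^ 2) $ n" .
qed

section \<open>Logarithmic derivatives\<close>

lemma finite_divisor_pairs: "finite {(d::int, e). d > 0 \<and> e > 0 \<and> d * e = c}"
proof (rule finite_subset)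
  show "{(d, e). d > 0 \<and> e > 0 \<and> d * e = c} \<subseteq> {0..c} \<times> {0..c}"
  proof
    fix a assume "a \<in> {(d, e). d > 0 \<and> e > 0 \<and> d * e = c}"
    then obtain d e where a: "a = (d, e)" "d > 0" "e > 0" "d * e = c" by blast
    have "d * 1 \<le> d * e" "1 * e \<le> d * e" using a by (intro mult_left_mono mult_right_mono; simp)+
    then show "a \<in> {0..c} \<times> {0..c}" using a by auto
  qed
qed simp

text \<open>The product with \<open>Lamo\<close> is a sum over i^2 + d e = n with e odd, which
  \<open>sum_reps_sgp\<close> evaluates; the two signs of s give the factor 2.\<close>

lemma theta_D_phim: "theta_D phim = - 2 * Lamo * phim"
proof (rule fps_ext)
  fix n
  have "(phim * Lamo) $ n = (\<Sum>(i, t)\<in>{(i, d, e). (i, d, e) \<in> reps 1 (int n) \<and> odd e}. sgp i * (case t of (d, e) \<Rightarrow> d))"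
    unfolding phim_def Lamo_def
  proof (rule Abs_fps_mult_nth)
    fix s :: int and t :: "int \<times> int"
    obtain d e where t: "t = (d, e)" by (cases t)
    show "((s, t) \<in> {(i, d, e). (i, d, e) \<in> reps 1 (int n) \<and> odd e}) =
      (\<exists>k\<le>n. s \<in> {i. i\<^sup>2 = int k} \<and> t \<in> {(d, e). d > 0 \<and> e > 0 \<and> d * e = int (n - k) \<and> odd e})"
    proof
      assume "(s, t) \<in> {(i, d, e). (i, d, e) \<in> reps 1 (int n) \<and> odd e}"
      then have h: "d > 0" "e > 0" "s\<^sup>2 + d * e = int n" "odd e" by (auto simp: t reps_def)
      have "d * e > 0" using h by simp
      then have "nat (s\<^sup>2) \<le> n" "d * e = int (n - nat (s\<^sup>2))"
        using h(3) zero_le_power2[of s] by linarith+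
      then show "\<exists>k\<le>n. s \<in> {i. i\<^sup>2 = int k} \<and> t \<in> {(d, e). d > 0 \<and> e > 0 \<and> d * e = int (n - k) \<and> odd e}"
        using h by (intro exI[of _ "nat (s\<^sup>2)"]) (simp add: t)
    qed (auto simp: of_nat_diff reps_def)
  qed (auto simp: finite_int_square_eq intro: finite_subset[OF _ finite_divisor_pairs])
  also have "\<dots> = (\<Sum>(i, d, e)\<in>reps 1 (int n). if odd e then sgp i * d else 0)"
    by (rule sum.mono_neutral_cong_left) (use finite_reps[of 1 "int n"] in \<open>auto split: if_splits\<close>)
  finally have "(phim * Lamo) $ n = - (\<Sum>s | s > 0 \<and> s\<^sup>2 = int n. sgp s * int n)"
    by (simp add: sum_reps_sgp)
  moreover have "int n * phim $ n = 2 * (\<Sum>s | s > 0 \<and> s\<^sup>2 = int n. sgp s * int n)"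
  proof (cases "n = 0")
    case False
    then have "(\<Sum>i | i\<^sup>2 = int n. sgp i * int n) = 2 * (\<Sum>s | s > 0 \<and> s\<^sup>2 = int n. sgp s * int n)"
      by (intro sum_symmetric_squares) (simp_all add: sgp_simps)
    then show ?thesis by (simp add: phim_def sum_distrib_left mult.commute)
  qed (simp only: of_nat_0 mult_zero_left mult_zero_right sum.neutral_const)
  ultimately have "theta_D phim $ n = - 2 * (phim * Lamo) $ n" by (simp add: theta_D_nth)
  also have "\<dots> = (- 2 * Lamo * phim) $ n" by (simp add: fps_numeral_fps_const mult.assoc mult.commute[of phim])
  finally show "theta_D phim $ n = (- 2 * Lamo * phim) $ n" .
qed

text \<open>Twelve times the product with \<open>Lam\<close> has the coefficient - 8 n S, and
  \<open>U2\<close> has the coefficient 2 S, hence the factor 3. Jacobi's product of all (1 - q^n)^3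
  has the same logarithmic derivative.\<close>

lemma theta_D_U2: "theta_D U2 = - 3 * Lam * U2"
proof (rule fps_ext)
  fix n
  define S where "S = (\<Sum>s | s > 0 \<and> s\<^sup>2 = 8 * int n + 1. chi_m4 s * s)"
  have "(U2 * Lam) $ n = (\<Sum>(i, t)\<in>reps 8 (8 * int n + 1). (chi_m4 i * i) * (case t of (d, e) \<Rightarrow> d))"
    unfolding U2_def Lam_def
  proof (rule Abs_fps_mult_nth)
    fix s :: int and t :: "int \<times> int"
    obtain d e where t: "t = (d, e)" by (cases t)
    show "((s, t) \<in> reps 8 (8 * int n + 1)) =
      (\<exists>k\<le>n. s \<in> {i. i\<^sup>2 = 8 * int k + 1} \<and> t \<in> {(d, e). d > 0 \<and> e > 0 \<and> d * e = int (n - k)})"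
    proof
      assume "(s, t) \<in> reps 8 (8 * int n + 1)"
      then have h: "d > 0" "e > 0" "s\<^sup>2 + 8 * (d * e) = 8 * int n + 1" by (auto simp: t reps_def)
      have "d * e > 0" using h by simp
      define k where "k = int n - d * e"
      have s: "s\<^sup>2 = 8 * k + 1" using h by (simp add: k_def)
      then have "k \<ge> 0" using zero_le_power2[of s] by presburger
      then show "\<exists>k\<le>n. s \<in> {i. i\<^sup>2 = 8 * int k + 1} \<and> t \<in> {(d, e). d > 0 \<and> e > 0 \<and> d * e = int (n - k)}"
        using h(1,2) s \<open>d * e > 0\<close> by (intro exI[of _ "nat k"]) (auto simp: t k_def of_nat_diff nat_le_iff)
    qed (auto simp: of_nat_diff reps_def)
  qed (auto simp: finite_int_square_eq finite_divisor_pairs)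
  then have "12 * (U2 * Lam) $ n = - (\<Sum>s | s > 0 \<and> s\<^sup>2 = 8 * int n + 1. chi_m4 s * s * (8 * int n))"
    using sum_reps_chi_m4[of "8 * int n + 1"] by (simp add: case_prod_unfold)
  also have "\<dots> = - ((\<Sum>s | s > 0 \<and> s\<^sup>2 = 8 * int n + 1. chi_m4 s * s) * (8 * int n))"
    by (simp only: sum_distrib_right)
  finally have X: "12 * (U2 * Lam) $ n = - (S * (8 * int n))" unfolding S_def .
  have U: "U2 $ n = 2 * S" unfolding U2_def S_def fps_nth_Abs_fps
    by (rule sum_symmetric_squares) (simp_all add: chi_m4_uminus)
  have "4 * theta_D U2 $ n = 4 * (- 3 * (U2 * Lam) $ n)"
    using X by (simp add: theta_D_nth U algebra_simps)
  then have "theta_D U2 $ n = - 3 * (U2 * Lam) $ n" by simp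
  also have "\<dots> = (- 3 * Lam * U2) $ n" by (simp add: fps_numeral_fps_const mult.assoc mult.commute[of U2])
  finally show "theta_D U2 $ n = (- 3 * Lam * U2) $ n" .
qed

lemma Lamo_eq: "Lamo = Lam - sq Lam"
proof (rule fps_ext)
  fix n
  have fin: "finite {(d, e). d > 0 \<and> e > 0 \<and> d * e = int n \<and> odd e}" "finite {(d, e). d > 0 \<and> e > 0 \<and> d * e = int n \<and> even e}"
    by (rule finite_subset[OF _ finite_divisor_pairs[of "int n"]]; auto)+
  have "Lam $ n = (\<Sum>(d, e)\<in>{(d, e). d > 0 \<and> e > 0 \<and> d * e = int n \<and> odd e} \<union> {(d, e). d > 0 \<and> e > 0 \<and> d * e = int n \<and> even e}. d)"
    unfolding Lam_def fps_nth_Abs_fps by (rule arg_cong) blast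
  also have "\<dots> = Lamo $ n + (\<Sum>(d, e) | d > 0 \<and> e > 0 \<and> d * e = int n \<and> even e. d)"
    unfolding Lamo_def fps_nth_Abs_fps by (rule sum.union_disjoint[OF fin]) auto
  also have "(\<Sum>(d, e) | d > 0 \<and> e > 0 \<and> d * e = int n \<and> even e. d) = sq Lam $ n"
  proof (cases "even n")
    case True
    then obtain m where m: "n = 2 * m" by (elim evenE)
    have "(\<Sum>(d, e) | d > 0 \<and> e > 0 \<and> d * e = int n \<and> even e. d) = (\<Sum>(d, e) | d > 0 \<and> e > 0 \<and> d * e = int m. d)"
      by (rule sum.reindex_bij_witness[of _ "\<lambda>(d, e). (d, 2 * e)" "\<lambda>(d, e). (d, e div 2)"]) (auto simp: m elim!: evenE)
    then show ?thesis by (simp add: sq_nth m Lam_def)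
  next
    case False
    have "even e \<Longrightarrow> d * e \<noteq> int n" for d e :: int using False by (metis even_mult_iff even_of_nat)
    then have e: "{(d, e). d > 0 \<and> e > 0 \<and> d * e = int n \<and> even e} = {}" by blast
    show ?thesis unfolding e using False by (simp add: sq_nth)
  qed
  finally show "Lamo $ n = (Lam - sq Lam) $ n" by simp
qed

lemma Lamo_minus_neg: "Lamo - neg Lamo = 2 * fps_X * sq Sigo"
proof (rule fps_ext)
  fix n
  show "(Lamo - neg Lamo) $ n = (2 * fps_X * sq Sigo) $ n"
  proof (cases "odd n")
    case True
    then obtain m where m: "n = 2 * m + 1" by (elim oddE)
    have n: "int n = 2 * int m + 1" using m by simp
    have "Lamo $ n = (\<Sum>d | d > 0 \<and> d dvd 2 * int m + 1. d)"
      unfolding Lamo_def fps_nth_Abs_fps n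
    proof (rule sum.reindex_bij_witness[of _ "\<lambda>d. (d, (2 * int m + 1) div d)" fst])
      fix d assume d: "d \<in> {d. d > 0 \<and> d dvd 2 * int m + 1}"
      then obtain e where e: "2 * int m + 1 = d * e" by (auto elim!: dvdE)
      have "0 < 2 * int m + 1" "odd (2 * int m + 1)" by simp_all
      then have "d * e > 0" "odd (d * e)" unfolding e .
      then have "e > 0" "odd e" using d by (simp_all add: zero_less_mult_iff)
      then show "(d, (2 * int m + 1) div d) \<in> {(d, e). d > 0 \<and> e > 0 \<and> d * e = 2 * int m + 1 \<and> odd e}"
        using d e by auto
    next
      fix a assume "a \<in> {(d, e). d > 0 \<and> e > 0 \<and> d * e = 2 * int m + 1 \<and> odd e}"
      then obtain d e where a: "a = (d, e)" "d > 0" "2 * int m + 1 = d * e" by auto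
      show "(fst a, (2 * int m + 1) div fst a) = a" "fst a \<in> {d. d > 0 \<and> d dvd 2 * int m + 1}"
        unfolding a(3) using a(1,2) by auto
    qed auto
    moreover have "(fps_X * sq Sigo) $ n = (\<Sum>d | d > 0 \<and> d dvd 2 * int m + 1. d)"
      by (simp add: m sq_nth Sigo_def)
    ultimately show ?thesis using True by (simp add: neg_nth mult.assoc fps_numeral_fps_const)
  next
    case False
    then have "(fps_X * sq Sigo) $ n = 0" by (cases n) (auto simp: sq_nth)
    then show ?thesis using False by (simp add: neg_nth mult.assoc fps_numeral_fps_const)
  qed
qed

section \<open>Product identities between the theta series\<close>

lemma sq_uminus: "sq (- f) = - sq f"
  by (simp add: fps_eq_iff sq_nth)

lemma neg_uminus: "neg (- f) = - neg f"
  by (simp add: fps_eq_iff neg_nth)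

lemma nth_0_values: "phim $ 0 = 1" "phi $ 0 = 1" "psi2 $ 0 = 2" "U2 $ 0 = 2" "Lam $ 0 = 0"
proof -
  have "{i::int. i\<^sup>2 = 1} = {1, -1}" by (auto simp: power2_eq_1_iff)
  then show "psi2 $ 0 = 2" "U2 $ 0 = 2" by (simp_all add: psi2_def U2_def chi_m4_def)
  show "phim $ 0 = 1" "phi $ 0 = 1" by (simp_all add: phim_def phi_def sgp_def)
  have e: "{(d::int, e). d > 0 \<and> e > 0 \<and> d * e = int 0} = {}" by auto
  show "Lam $ 0 = 0" unfolding Lam_def fps_nth_Abs_fps e by simp
qed

text \<open>Both sides have the logarithmic derivative - 6 \<open>Lam\<close>: on the right,
  \<open>phim ^ 3\<close> contributes - 6 (\<open>Lam\<close> - \<open>sq Lam\<close>) and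
  \<open>sq U2\<close> contributes - 6 \<open>sq Lam\<close>.\<close>

lemma U2_square: "U2 ^ 2 = 2 * phim ^ 3 * sq U2"
proof (rule theta_D_unique)
  show "theta_D (U2 ^ 2) = (- 6 * Lam) * U2 ^ 2"
    by (simp add: power2_eq_square theta_D_mult theta_D_U2 algebra_simps)
  have t1: "theta_D (phim ^ 3) = 3 * phim ^ 2 * (- 2 * Lamo * phim)"
    using theta_D_power_Suc[of phim 2] by (simp add: theta_D_phim numeral_3_eq_3)
  have t2: "theta_D (sq U2) = 2 * (- 3 * sq Lam * sq U2)"
    by (simp add: theta_D_sq theta_D_U2 sq_mult sq_uminus sq_numeral)
  have "theta_D (phim ^ 3 * sq U2) = - 6 * (Lamo + sq Lam) * (phim ^ 3 * sq U2)"
    unfolding theta_D_mult t1 t2 by (simp add: algebra_simps power2_eq_square power3_eq_cube)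
  then show "theta_D (2 * phim ^ 3 * sq U2) = (- 6 * Lam) * (2 * phim ^ 3 * sq U2)"
    by (simp add: mult.assoc theta_D_numeral_mult Lamo_eq)
  show "(- 6 * Lam) $ 0 = 0" by (simp add: nth_0_values)
  show "U2 ^ 2 $ 0 = (2 * phim ^ 3 * sq U2) $ 0" by (simp add: nth_0_values sq_nth fps_nth_power_0)
qed

text \<open>By the identities for pairs of squares, \<open>phim ^ 2 * psi2\<close> satisfies the
  same equation f^2 = 2 \<phi>(-q)^3 f(q^2) as \<open>U2\<close>, and both have constant term
  2.\<close>

lemma U2_eq: "U2 = phim ^ 2 * psi2"
proof (rule square_eq_mult_sq_unique[OF U2_square])
  have "(phim ^ 2 * psi2) ^ 2 = phim ^ 3 * phim * psi2 ^ 2"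
    by (simp add: power2_eq_square power3_eq_cube algebra_simps)
  also have "\<dots> = 2 * phim ^ 3 * (phi * phim) * sq psi2" by (simp add: psi2_square algebra_simps)
  also have "\<dots> = 2 * phim ^ 3 * sq (phim ^ 2 * psi2)" by (simp add: phi_mult_phim sq_mult sq_power)
  finally show "(phim ^ 2 * psi2) ^ 2 = 2 * phim ^ 3 * sq (phim ^ 2 * psi2)" .
qed (simp_all add: nth_0_values fps_nth_power_0)

lemma theta_D_phi: "theta_D phi = - 2 * neg Lamo * phi"
proof -
  have n: "neg phim = phi" by (simp add: fps_eq_iff neg_nth flip: neg_phi)
  have "theta_D phi = neg (theta_D phim)" by (simp add: theta_D_neg[symmetric] n)
  also have "\<dots> = - 2 * neg Lamo * phi" by (simp add: theta_D_phim neg_mult n neg_uminus neg_numeral)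
  finally show ?thesis .
qed

text \<open>Divided by \<phi>(q) \<phi>(-q), the Wronskian is a difference of logarithmic
  derivatives, namely 4 q \<open>sq Sigo\<close>. What remains is an identity in q^2; with q for q^2
  it expresses \<open>Sigo\<close> by \<open>sq U2\<close>, which factors into theta series. The
  constant is 2^4, as \<open>psi2\<close> is twice \<psi>.\<close>

theorem psi2_power4: "psi2 ^ 4 = 16 * Sigo"
proof -
  have "fps_X * (sq (sq U2) ^ 2) = 2 * (Lamo - neg Lamo) * (phi * phim)"
    unfolding phi_wronskian[symmetric] theta_D_phi theta_D_phim by (simp add: algebra_simps)
  also have "\<dots> = fps_X * (4 * sq Sigo * sq phim ^ 2)"
    unfolding phi_mult_phim Lamo_minus_neg by (simp add: algebra_simps)
  finally have "sq (sq U2 ^ 2) = sq (4 * Sigo * phim ^ 2)"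
    by (simp add: sq_mult sq_power sq_numeral)
  then have U: "sq U2 ^ 2 = 4 * Sigo * phim ^ 2" by (rule sq_inject)
  have "sq U2 = phi * phim * sq psi2" by (simp add: U2_eq sq_mult sq_power phi_mult_phim)
  then have "phim ^ 2 * (2 * phi * sq psi2) ^ 2 = 4 * sq U2 ^ 2"
    by (simp add: power_mult_distrib algebra_simps)
  also have "\<dots> = phim ^ 2 * (16 * Sigo)" unfolding U by (simp add: algebra_simps)
  finally have "phim ^ 2 * (2 * phi * sq psi2) ^ 2 = phim ^ 2 * (16 * Sigo)" .
  moreover have "phim \<noteq> 0" using nth_0_values(1) by auto
  ultimately have "(2 * phi * sq psi2) ^ 2 = 16 * Sigo" by simp
  moreover have "psi2 ^ 4 = (psi2 ^ 2) ^ 2" by (simp flip: power_mult)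
  ultimately show ?thesis by (simp add: psi2_square)
qed

text \<open>Both sides have the same square, by \<open>psi2_square\<close> and its image under q ->
  -q; the constant terms decide the sign.\<close>

lemma psi2_mult_neg: "psi2 * neg psi2 = 2 * sq phim * sq psi2"
proof -
  have "neg psi2 ^ 2 = 2 * phim * sq psi2"
    using arg_cong[OF psi2_square, of neg] by (simp add: neg_power neg_mult neg_numeral neg_sq neg_phi)
  then have "(psi2 * neg psi2) ^ 2 = 4 * (phi * phim) * sq psi2 ^ 2"
    unfolding power_mult_distrib psi2_square by (simp add: power2_eq_square)
  also have "\<dots> = (2 * sq phim * sq psi2) ^ 2" by (simp add: phi_mult_phim power_mult_distrib)
  finally have "psi2 * neg psi2 = 2 * sq phim * sq psi2 \<or> psi2 * neg psi2 = - (2 * sq phim * sq psi2)"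
    by (simp add: power2_eq_iff)
  moreover have "(psi2 * neg psi2) $ 0 \<noteq> (- (2 * sq phim * sq psi2)) $ 0"
    by (simp add: nth_0_values neg_nth sq_nth)
  ultimately show ?thesis by metis
qed

section \<open>The generating function of the class numbers\<close>

definition hser :: "int fps" where
  "hser = Abs_fps (\<lambda>n. \<Sum>z\<in>selling_triples (8 * int n + 3). 1)"

text \<open>For odd t write t^2 = 8 j + 1; then 4 (2 n + 1) - t^2 = 8 (n - j) + 3, so the degrees of
  the two factors add up to n.\<close>

lemma hser_mult_nth:
  fixes v :: "int \<Rightarrow> int"
  shows "(hser * Abs_fps (\<lambda>n. \<Sum>i | i\<^sup>2 = 8 * int n + 1. v i)) $ n =
    (\<Sum>(t, z)\<in>selling_quads (2 * int n + 1). v t)"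
proof -
  let ?P = "{(z, t). (t, z) \<in> selling_quads (2 * int n + 1)}"
  have "(hser * Abs_fps (\<lambda>n. \<Sum>i | i\<^sup>2 = 8 * int n + 1. v i)) $ n = (\<Sum>(z, t)\<in>?P. 1 * v t)"
    unfolding hser_def
  proof (rule Abs_fps_mult_nth)
    fix z :: "int \<times> int \<times> int" and t :: int
    obtain A B C where z: "z = (A, B, C)" by (cases z)
    show "((z, t) \<in> ?P) = (\<exists>k\<le>n. z \<in> selling_triples (8 * int k + 3) \<and> t \<in> {i. i\<^sup>2 = 8 * int (n - k) + 1})"
    proof
      assume "(z, t) \<in> ?P"
      then have t: "odd t" and T: "z \<in> selling_triples (4 * (2 * int n + 1) - t\<^sup>2)"
        by (auto simp: selling_quads_def z)
      have pos: "8 * int n + 4 - t\<^sup>2 > 0" using selling_triples_pos[OF T] by simp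
      define j where "j = t\<^sup>2 div 8"
      have j: "t\<^sup>2 = 8 * j + 1" using odd_square_mod_8[OF t] unfolding j_def by presburger
      have "j \<ge> 0" "j \<le> int n" using j pos zero_le_power2[of t] by presburger+
      then have "n - nat j \<le> n" "int (n - (n - nat j)) = j" "int (n - nat j) = int n - j" by linarith+
      moreover have "4 * (2 * int n + 1) - t\<^sup>2 = 8 * (int n - j) + 3" using j by simp
      ultimately have "z \<in> selling_triples (8 * int (n - nat j) + 3)" "t\<^sup>2 = 8 * int (n - (n - nat j)) + 1"
        using T j by (simp_all only:)
      then show "\<exists>k\<le>n. z \<in> selling_triples (8 * int k + 3) \<and> t \<in> {i. i\<^sup>2 = 8 * int (n - k) + 1}"
        by (intro exI[of _ "n - nat j"]) (simp only: mem_Collect_eq, simp)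
    next
      assume "\<exists>k\<le>n. z \<in> selling_triples (8 * int k + 3) \<and> t \<in> {i. i\<^sup>2 = 8 * int (n - k) + 1}"
      then obtain k where k: "k \<le> n" "z \<in> selling_triples (8 * int k + 3)" "t\<^sup>2 = 8 * int (n - k) + 1" by auto
      have "4 * (2 * int n + 1) - t\<^sup>2 = 8 * int k + 3" using k by (simp add: of_nat_diff)
      then have "z \<in> selling_triples (4 * (2 * int n + 1) - t\<^sup>2)" using k(2) by (simp only:)
      moreover have "odd (t\<^sup>2)" using k(3) by simp
      then have "odd t" by simp
      ultimately show "(z, t) \<in> ?P" by (simp add: selling_quads_def z)
    qed
  next
    fix a b :: nat assume "a \<noteq> b"
    then show "selling_triples (8 * int a + 3) \<inter> selling_triples (8 * int b + 3) = {}"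
      by (auto simp: selling_triples_def)
  qed (auto simp: finite_selling_triples finite_int_square_eq)
  also have "\<dots> = (\<Sum>(t, z)\<in>selling_quads (2 * int n + 1). v t)"
    by (rule sum.reindex_bij_witness[of _ prod.swap prod.swap]) auto
  finally show ?thesis .
qed

lemma hser_mult_psi2: "hser * psi2 = 2 * Sigo"
proof (rule fps_ext)
  fix n
  have "(hser * psi2) $ n = int (card (selling_quads (2 * int n + 1)))"
    unfolding psi2_def hser_mult_nth by (simp add: case_prod_unfold)
  also have "\<dots> = (2 * Sigo) $ n"
    by (subst card_selling_quads) (simp_all add: Sigo_def fps_numeral_fps_const)
  finally show "(hser * psi2) $ n = (2 * Sigo) $ n" .
qed

text \<open>The two formulas for \<open>Sigo\<close> give 8 \<open>hser\<close> =
  \<open>psi2 ^ 3\<close>. Multiplied by \<open>neg psi2\<close>, the right side is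
  \<open>psi2 ^ 2\<close> times \<open>psi2 * neg psi2\<close>; the first factor brings in
  \<phi>(q), and the rest collapses by
  \<open>sq phim * sq psi2 ^ 2 = 2 * sq (sq U2)\<close>.\<close>

theorem hser_mult_neg_psi2: "hser * neg psi2 = phi * sq (sq U2)"
proof -
  have nz: "psi2 \<noteq> 0" using nth_0_values(3) by auto
  have "psi2 * (8 * (hser * psi2 * neg psi2)) = psi2 * (psi2 ^ 4 * neg psi2)"
    unfolding psi2_power4 hser_mult_psi2 by (simp add: algebra_simps)
  then have "8 * (hser * psi2 * neg psi2) = psi2 ^ 4 * neg psi2" using nz mult_cancel_left by blast
  then have "psi2 * (8 * (hser * neg psi2)) = psi2 * (psi2 ^ 2 * (psi2 * neg psi2))"
    by (simp add: power4_eq_xxxx power2_eq_square algebra_simps)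
  then have "8 * (hser * neg psi2) = psi2 ^ 2 * (psi2 * neg psi2)" using nz mult_cancel_left by blast
  also have "\<dots> = 4 * (phi * (sq phim * sq psi2 ^ 2))"
    unfolding psi2_square psi2_mult_neg by (simp add: power2_eq_square algebra_simps)
  also have "sq phim * sq psi2 ^ 2 = 2 * sq (sq U2)"
  proof -
    have "2 * sq (sq U2) = sq phim * (2 * sq phi * sq (sq psi2))"
      unfolding U2_eq sq_mult sq_power using arg_cong[OF phi_mult_phim, of sq]
      by (simp add: sq_mult sq_power algebra_simps)
    also have "2 * sq phi * sq (sq psi2) = sq psi2 ^ 2"
      using arg_cong[OF psi2_square, of sq] by (simp add: sq_mult sq_power sq_numeral)
    finally show ?thesis by simp
  qed
  finally have "8 * (hser * neg psi2) = 8 * (phi * sq (sq U2))" by (simp add: algebra_simps)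
  then show ?thesis by simp
qed

section \<open>The character modulo 8\<close>

definition eps8 :: "int \<Rightarrow> int" where
  "eps8 i = (if i mod 8 \<in> {1, 7} then 1 else - 1)"

text \<open>The supplementary law (2/i) = (-1)^((i^2 - 1)/8), where \<open>eps8\<close> is the
  Jacobi symbol (2/i) on odd i. Twisting by it is thus the substitution -q for q in
  \<open>psi2\<close>.\<close>

lemma eps8_square:
  assumes "i\<^sup>2 = 8 * int n + 1"
  shows "(- 1) ^ n = eps8 i"
proof -
  have "odd (i\<^sup>2)" using assms by simp
  then have "odd i" by simp
  define k r where "k = i div 8" and "r = i mod 8"
  have i: "i = 8 * k + r" by (simp add: k_def r_def)
  have "r = 1 \<or> r = 3 \<or> r = 5 \<or> r = 7" using \<open>odd i\<close> unfolding r_def by presburger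
  then have "even (int n) \<longleftrightarrow> r = 1 \<or> r = 7"
  proof (elim disjE)
    assume r: "r = 1"
    have "int n = 2 * (4 * k\<^sup>2 + k)" using assms unfolding i r by (simp add: power2_eq_square algebra_simps)
    then show ?thesis using r by simp
  next
    assume r: "r = 3"
    have "int n = 2 * (4 * k\<^sup>2 + 3 * k) + 1" using assms unfolding i r by (simp add: power2_eq_square algebra_simps)
    then show ?thesis using r by simp
  next
    assume r: "r = 5"
    have "int n = 2 * (4 * k\<^sup>2 + 5 * k + 1) + 1" using assms unfolding i r by (simp add: power2_eq_square algebra_simps)
    then show ?thesis using r by simp
  next
    assume r: "r = 7"
    have "int n = 2 * (4 * k\<^sup>2 + 7 * k + 3)" using assms unfolding i r by (simp add: power2_eq_square algebra_simps)
    then show ?thesis using r by simp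
  qed
  then have "even n \<longleftrightarrow> i mod 8 \<in> {1, 7}" by (simp add: r_def)
  then show ?thesis by (simp add: eps8_def)
qed

lemma neg_psi2: "neg psi2 = Abs_fps (\<lambda>n. \<Sum>i | i\<^sup>2 = 8 * int n + 1. eps8 i)"
proof (rule fps_ext)
  fix n
  have "(\<Sum>i | i\<^sup>2 = 8 * int n + 1. eps8 i) = (\<Sum>i | i\<^sup>2 = 8 * int n + 1. (- 1) ^ n)"
    by (rule sum.cong) (simp_all add: eps8_square)
  then show "neg psi2 $ n = Abs_fps (\<lambda>n. \<Sum>i | i\<^sup>2 = 8 * int n + 1. eps8 i) $ n"
    by (simp add: neg_nth psi2_def)
qed

lemma sum_selling_quads_eps8:
  "(\<Sum>(t, z)\<in>selling_quads (2 * int n + 1). eps8 t) =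
    (\<Sum>(y, x) | x\<^sup>2 + 2 * y\<^sup>2 = 2 * int n + 1. chi_m4 x * x)"
proof -
  have "(\<Sum>(t, z)\<in>selling_quads (2 * int n + 1). eps8 t) = (phi * sq (sq U2)) $ n"
    unfolding hser_mult_neg_psi2[symmetric] neg_psi2 hser_mult_nth ..
  also have "\<dots> = (\<Sum>(y, x) | x\<^sup>2 + 2 * y\<^sup>2 = 2 * int n + 1. 1 * (chi_m4 x * x))"
    unfolding phi_def sq_sq_U2
  proof (rule Abs_fps_mult_nth)
    fix s t :: int
    show "((s, t) \<in> {(y, x). x\<^sup>2 + 2 * y\<^sup>2 = 2 * int n + 1}) =
      (\<exists>k\<le>n. s \<in> {i. i\<^sup>2 = int k} \<and> t \<in> {i. i\<^sup>2 = 2 * int (n - k) + 1})"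
    proof
      assume "(s, t) \<in> {(y, x). x\<^sup>2 + 2 * y\<^sup>2 = 2 * int n + 1}"
      then have h: "t\<^sup>2 + 2 * s\<^sup>2 = 2 * int n + 1" by simp
      then have "nat (s\<^sup>2) \<le> n" "t\<^sup>2 = 2 * int (n - nat (s\<^sup>2)) + 1"
        using zero_le_power2[of s] zero_le_power2[of t] by linarith+
      then show "\<exists>k\<le>n. s \<in> {i. i\<^sup>2 = int k} \<and> t \<in> {i. i\<^sup>2 = 2 * int (n - k) + 1}"
        by (intro exI[of _ "nat (s\<^sup>2)"]) simp
    qed (auto simp: of_nat_diff)
  qed (auto simp: finite_int_square_eq)
  finally show ?thesis by simp
qed

section \<open>Representations of a prime by x^2 + 2 y^2\<close>

lemma prime_x2_2y2_unique:
  fixes x y u v :: int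
  assumes p: "prime p" and x: "int p = x\<^sup>2 + 2 * y\<^sup>2" and u: "int p = u\<^sup>2 + 2 * v\<^sup>2"
  shows "u\<^sup>2 = x\<^sup>2 \<and> v\<^sup>2 = y\<^sup>2"
proof -
  have pp: "prime (int p)" using p by simp
  have pos: "int p > 0" using p prime_gt_0_nat by simp
  have "(x * v - u * y) * (x * v + u * y) = (x\<^sup>2 + 2 * y\<^sup>2) * v\<^sup>2 - y\<^sup>2 * (u\<^sup>2 + 2 * v\<^sup>2)"
    by (simp add: power2_eq_square algebra_simps)
  also have "\<dots> = int p * (v\<^sup>2 - y\<^sup>2)" unfolding x[symmetric] u[symmetric] by (simp add: algebra_simps)
  finally have e: "(x * v - u * y) * (x * v + u * y) = int p * (v\<^sup>2 - y\<^sup>2)" .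
  then have "int p dvd (x * v - u * y) * (x * v + u * y)" by simp
  then have d: "int p dvd x * v - u * y \<or> int p dvd x * v + u * y"
    using pp prime_dvd_mult_iff by blast
  \<comment> \<open>In p^2 = w^2 + 2 z^2 a nonzero z divisible by p would be too large. Equations of
    this kind arise below by composing the two representations of p, in two ways that differ by the
    sign of y.\<close>
  have zero: "z = 0" if z: "int p dvd z" "w\<^sup>2 + 2 * z\<^sup>2 = (int p)\<^sup>2" for z w
  proof (rule ccontr)
    assume "z \<noteq> 0"
    obtain k where k: "z = int p * k" using z(1) by (elim dvdE)
    then have "k \<noteq> 0" using \<open>z \<noteq> 0\<close> by auto
    then have "k\<^sup>2 \<ge> 1" by (simp add: int_one_le_iff_zero_less)
    then have "(int p)\<^sup>2 * 1 \<le> (int p)\<^sup>2 * k\<^sup>2" by (intro mult_left_mono) auto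
    then have "(int p)\<^sup>2 \<le> z\<^sup>2" by (simp add: k power_mult_distrib)
    moreover have "(int p)\<^sup>2 > 0" using pos by simp
    ultimately show False using z(2) zero_le_power2[of w] by linarith
  qed
  have "(x\<^sup>2 + 2 * y\<^sup>2) * (u\<^sup>2 + 2 * v\<^sup>2) = (int p)\<^sup>2" using x u by (simp add: power2_eq_square)
  then have "(x * u + 2 * y * v)\<^sup>2 + 2 * (x * v - u * y)\<^sup>2 = (int p)\<^sup>2"
    "(x * u - 2 * y * v)\<^sup>2 + 2 * (x * v + u * y)\<^sup>2 = (int p)\<^sup>2"
    by (simp_all add: power2_eq_square algebra_simps)
  then have "x * v - u * y = 0 \<or> x * v + u * y = 0" using d zero by blast
  then have "int p * (v\<^sup>2 - y\<^sup>2) = 0" using e by auto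
  then have "v\<^sup>2 = y\<^sup>2" using pos by simp
  then show ?thesis using x u by simp
qed

text \<open>By uniqueness the solutions are (\<plusminus>y, \<plusminus>x), four distinct ones
  because p is odd and not a square, and \<chi>(u) u is even in u.\<close>

lemma sum_chi_m4_x2_2y2_prime:
  fixes x y :: int
  assumes p: "prime p" "odd p" and x: "int p = x\<^sup>2 + 2 * y\<^sup>2"
  shows "(\<Sum>(v, u) | u\<^sup>2 + 2 * v\<^sup>2 = int p. chi_m4 u * u) = 4 * (chi_m4 x * x)"
proof -
  have "odd (int p)" using p(2) by simp
  then have "odd (x\<^sup>2 + 2 * y\<^sup>2)" unfolding x .
  then have x0: "x \<noteq> 0" by auto
  have y0: "y \<noteq> 0"
  proof
    assume "y = 0"
    then have "int p = int (nat \<bar>x\<bar>) * int (nat \<bar>x\<bar>)" using x by (simp add: power2_eq_square)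
    then have "int p = int (nat \<bar>x\<bar> * nat \<bar>x\<bar>)" by (simp only: of_nat_mult)
    then have pk: "p = nat \<bar>x\<bar> * nat \<bar>x\<bar>" by (simp only: of_nat_eq_iff)
    then have "nat \<bar>x\<bar> = 1" using p(1) prime_product[of "nat \<bar>x\<bar>" "nat \<bar>x\<bar>"] by simp
    then show False using pk p(1) by simp
  qed
  have eq: "{(v, u). u\<^sup>2 + 2 * v\<^sup>2 = int p} = {y, - y} \<times> {x, - x}"
  proof (intro equalityI subsetI)
    fix a assume "a \<in> {(v, u). u\<^sup>2 + 2 * v\<^sup>2 = int p}"
    then obtain v u where a: "a = (v, u)" "int p = u\<^sup>2 + 2 * v\<^sup>2" by force
    from prime_x2_2y2_unique[OF p(1) x a(2)] show "a \<in> {y, - y} \<times> {x, - x}"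
      by (auto simp: a(1) power2_eq_iff)
  qed (use x in auto)
  show ?thesis unfolding eq using x0 y0 by (simp add: sum.cartesian_product[symmetric] chi_m4_uminus)
qed

lemma x2_2y2_mod_8:
  fixes x y :: int
  assumes "odd p" "int p = x\<^sup>2 + 2 * y\<^sup>2"
  shows "p mod 8 \<in> {1, 3}"
proof -
  have "odd (int p)" using assms(1) by simp
  then have "odd (x\<^sup>2 + 2 * y\<^sup>2)" unfolding assms(2) .
  then have "odd x" by simp
  then have "x\<^sup>2 mod 8 = 1" by (rule odd_square_mod_8)
  then obtain a where a: "x\<^sup>2 = 8 * a + 1" by (metis mult_div_mod_eq)
  have "\<exists>b. y\<^sup>2 = 4 * b \<or> y\<^sup>2 = 4 * b + 1"
  proof (cases "even y")
    case True
    then obtain k where "y = 2 * k" by (elim evenE)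
    then have "y\<^sup>2 = 4 * k\<^sup>2" by (simp add: power_mult_distrib)
    then show ?thesis by blast
  next
    case False
    then have "y\<^sup>2 mod 8 = 1" by (rule odd_square_mod_8)
    then have "y\<^sup>2 = 4 * (2 * (y\<^sup>2 div 8)) + 1" by presburger
    then show ?thesis by blast
  qed
  then obtain b where "y\<^sup>2 = 4 * b \<or> y\<^sup>2 = 4 * b + 1" by blast
  then have "int p = 8 * (a + b) + 1 \<or> int p = 8 * (a + b) + 3" using assms(2) a by auto
  moreover have "(8 * c + 1) mod 8 = (1::int)" "(8 * c + 3) mod 8 = (3::int)" for c
    by (simp_all add: mod_mult_self4)
  ultimately have "int p mod 8 = 1 \<or> int p mod 8 = 3" by metis
  then have "int (p mod 8) = int 1 \<or> int (p mod 8) = int 3" by (simp add: zmod_int)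
  then have "p mod 8 = 1 \<or> p mod 8 = 3" by (simp only: of_nat_eq_iff)
  then show ?thesis by simp
qed

section \<open>Residue classes of t modulo 8\<close>

definition odd_part :: "nat \<Rightarrow> int \<Rightarrow> int" where
  "odd_part p r = (\<Sum>t | t mod 8 = r \<and> t\<^sup>2 \<le> 4 * int p. int (card (selling_triples (4 * int p - t\<^sup>2))))"

lemma hurwitz_H_sum_eq_odd_part:
  assumes "odd p" "odd m"
  shows "3 * hurwitz_H_sum m 8 p = real_of_int (odd_part p (m mod 8))"
proof -
  have "3 * hurwitz_H (4 * int p - t\<^sup>2) = real (card (selling_triples (4 * int p - t\<^sup>2)))"
    if "t mod 8 = m mod 8" "t\<^sup>2 \<le> 4 * int p" for t
  proof -
    have "odd t" using that(1) assms(2) by presburger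
    then have "t\<^sup>2 mod 8 = 1" by (rule odd_square_mod_8)
    moreover have "odd (int p)" using assms(1) by simp
    ultimately have "(4 * int p - t\<^sup>2) mod 8 = 3" by presburger
    moreover from this have "4 * int p - t\<^sup>2 > 0" using that(2) by (cases "4 * int p - t\<^sup>2 = 0") auto
    ultimately show ?thesis by (rule hurwitz_H_eq_card_selling_triples)
  qed
  then show ?thesis
    unfolding hurwitz_H_sum_finite odd_part_def sum_distrib_left of_int_sum
    by (intro sum.cong) (auto simp: cong_def)
qed

lemma odd_part_uminus:
  "odd_part p 7 = odd_part p 1" "odd_part p 5 = odd_part p 3"
proof -
  have m: "(- t) mod 8 = 1 \<longleftrightarrow> t mod 8 = 7" "(- t) mod 8 = 3 \<longleftrightarrow> t mod 8 = 5" for t :: int by presburger+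
  show "odd_part p 7 = odd_part p 1" unfolding odd_part_def
    by (rule sum.reindex_bij_witness[of _ uminus uminus]) (auto simp: m simp flip: m)
  show "odd_part p 5 = odd_part p 3" unfolding odd_part_def
    by (rule sum.reindex_bij_witness[of _ uminus uminus]) (auto simp: m simp flip: m)
qed

lemma sum_selling_quads_odd_part:
  fixes v :: "int \<Rightarrow> int"
  assumes "\<And>t. odd t \<Longrightarrow> v t = w (t mod 8)"
  shows "(\<Sum>(t, z)\<in>selling_quads (int p). v t) = (\<Sum>r\<in>{1, 3, 5, 7}. w r * odd_part p r)"
proof -
  let ?T = "{t::int. odd t \<and> t\<^sup>2 \<le> 4 * int p}"
  let ?g = "\<lambda>t. int (card (selling_triples (4 * int p - t\<^sup>2)))"
  have fin: "finite ?T" by (rule finite_subset[OF _ finite_square_le[of "4 * int p"]]) auto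
  have "selling_quads (int p) = (SIGMA t:?T. selling_triples (4 * int p - t\<^sup>2))"
  proof -
    have "t\<^sup>2 \<le> 4 * int p" if "z \<in> selling_triples (4 * int p - t\<^sup>2)" for t z
      using selling_triples_pos[OF that] by simp
    then show ?thesis by (auto simp: selling_quads_def)
  qed
  then have "(\<Sum>(t, z)\<in>selling_quads (int p). v t) = (\<Sum>(t, z)\<in>(SIGMA t:?T. selling_triples (4 * int p - t\<^sup>2)). v t)"
    by (simp only:)
  also have "\<dots> = (\<Sum>t\<in>?T. \<Sum>z\<in>selling_triples (4 * int p - t\<^sup>2). v t)"
    by (rule sum.Sigma[symmetric]) (use fin finite_selling_triples in auto)
  also have "\<dots> = (\<Sum>t\<in>?T. w (t mod 8) * ?g t)"
    by (rule sum.cong) (simp_all add: assms mult.commute)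
  also have "\<dots> = (\<Sum>r\<in>{1, 3, 5, 7}. \<Sum>t\<in>{t \<in> ?T. t mod 8 = r}. w (t mod 8) * ?g t)"
  proof (rule sum.group[symmetric, OF fin])
    show "(\<lambda>t. t mod 8) ` ?T \<subseteq> {1, 3, 5, 7}"
    proof
      fix r assume "r \<in> (\<lambda>t. t mod 8) ` ?T"
      then obtain t :: int where "odd t" "r = t mod 8" by blast
      then have "r = 1 \<or> r = 3 \<or> r = 5 \<or> r = 7" by presburger
      then show "r \<in> {1, 3, 5, 7}" by simp
    qed
  qed simp
  also have "\<dots> = (\<Sum>r\<in>{1, 3, 5, 7}. w r * odd_part p r)"
  proof (rule sum.cong, simp)
    fix r :: int assume r: "r \<in> {1, 3, 5, 7}"
    have "r = 1 \<or> r = 3 \<or> r = 5 \<or> r = 7" using r by simp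
    then have "odd t" if "t mod 8 = r" for t using that by presburger
    then have "{t \<in> ?T. t mod 8 = r} = {t. t mod 8 = r \<and> t\<^sup>2 \<le> 4 * int p}" by blast
    then show "(\<Sum>t\<in>{t \<in> ?T. t mod 8 = r}. w (t mod 8) * ?g t) = w r * odd_part p r"
      unfolding odd_part_def sum_distrib_left by (intro sum.cong) auto
  qed
  finally show ?thesis .
qed

text \<open>The divisors 1 and p turn 2 \<sigma>(p) into 2 (p + 1). Weight 1 gives the residues 1, 7
  and 3, 5 equal signs, \<open>eps8\<close> gives them opposite ones; the factor 2 on the left is
  the symmetry t -> -t.\<close>

lemma odd_part_prime:
  assumes "prime p" "odd p"
  shows "2 * (odd_part p 1 + odd_part p 3) = 2 * (int p + 1)"
    and "2 * (odd_part p 1 - odd_part p 3) = (\<Sum>(y, x) | x\<^sup>2 + 2 * y\<^sup>2 = int p. chi_m4 x * x)"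
proof -
  obtain n where n: "p = 2 * n + 1" using assms(2) by (elim oddE)
  then have pn: "int p = 2 * int n + 1" by simp
  have "{d::int. d > 0 \<and> d dvd int p} = {1, int p}"
  proof (intro equalityI subsetI)
    fix d assume d: "d \<in> {d::int. d > 0 \<and> d dvd int p}"
    then have "d = int (nat d)" by simp
    moreover from this have "nat d dvd p" using d by (metis int_dvd_int_iff mem_Collect_eq)
    then have "nat d = 1 \<or> nat d = p" using assms(1) by (simp add: prime_nat_iff)
    ultimately show "d \<in> {1, int p}" by auto
  qed (use assms prime_gt_0_nat in auto)
  moreover have "int p \<noteq> 1" using assms(1) by auto
  ultimately have "(\<Sum>d | d > 0 \<and> d dvd int p. d) = int p + 1" by simp
  then have "int (card (selling_quads (int p))) = 2 * (int p + 1)"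
    using card_selling_quads[of "int p"] assms prime_gt_0_nat by simp
  then have "(\<Sum>(t, z)\<in>selling_quads (int p). 1) = 2 * (int p + 1)" by (simp add: case_prod_unfold)
  moreover have "(\<Sum>(t, z)\<in>selling_quads (int p). 1) = (\<Sum>r\<in>{1, 3, 5, 7}. 1 * odd_part p r)"
    by (rule sum_selling_quads_odd_part) simp
  ultimately show "2 * (odd_part p 1 + odd_part p 3) = 2 * (int p + 1)" by (simp add: odd_part_uminus)
  have "(\<Sum>(t, z)\<in>selling_quads (int p). eps8 t) = (\<Sum>r\<in>{1, 3, 5, 7}. (if r \<in> {1, 7} then 1 else - 1) * odd_part p r)"
    by (rule sum_selling_quads_odd_part) (simp add: eps8_def)
  also have "\<dots> = 2 * (odd_part p 1 - odd_part p 3)" by (simp add: odd_part_uminus)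
  finally show "2 * (odd_part p 1 - odd_part p 3) = (\<Sum>(y, x) | x\<^sup>2 + 2 * y\<^sup>2 = int p. chi_m4 x * x)"
    using sum_selling_quads_eps8[of n] unfolding pn by simp
qed

theorem theorem4p7:
  fixes p :: nat and x y m :: int
  assumes "prime p" and "p \<ge> 3"
    and "p mod 8 \<in> {1, 3} \<Longrightarrow> int p = x\<^sup>2 + 2 * y\<^sup>2"
  shows "(m mod 8 \<in> {1, 7} \<and> p mod 8 \<in> {1, 3} \<longrightarrow>
            hurwitz_H_sum m 8 p = (real p + 1) / 6 + 1 / 3 * of_int (chi_m4 x) * of_int x)
       \<and> (m mod 8 \<in> {1, 3, 5, 7} \<and> p mod 8 \<in> {5, 7} \<longrightarrow>
            hurwitz_H_sum m 8 p = (real p + 1) / 6)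
       \<and> (m mod 8 \<in> {3, 5} \<and> p mod 8 \<in> {1, 3} \<longrightarrow>
            hurwitz_H_sum m 8 p = (real p + 1) / 6 - 1 / 3 * of_int (chi_m4 x) * of_int x)"
proof -
  have p: "odd p" using assms(1,2) prime_odd_nat[of p] by simp
  define E where "E = (\<Sum>(y, x) | x\<^sup>2 + 2 * y\<^sup>2 = int p. chi_m4 x * x)"
  have odd_m: "odd m" if "m mod 8 \<in> {1, 3, 5, 7}" using that by (auto; presburger)
  have "real_of_int (2 * (odd_part p 1 + odd_part p 3)) = real_of_int (2 * (int p + 1))"
    "real_of_int (2 * (odd_part p 1 - odd_part p 3)) = real_of_int E"
    using odd_part_prime[OF assms(1) p, folded E_def] by (simp_all only:)
  then have "real p + 1 = real_of_int (odd_part p 1) + real_of_int (odd_part p 3)"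
    "real_of_int E = 2 * (real_of_int (odd_part p 1) - real_of_int (odd_part p 3))" by simp_all
  then have "real_of_int (odd_part p 1) = (real p + 1) / 2 + real_of_int E / 4"
    "real_of_int (odd_part p 3) = (real p + 1) / 2 - real_of_int E / 4" by (simp_all add: field_simps)
  \<comment> \<open>The denominator 12 is 3 from counting triples times 4 from solving for the two
    sums; the four representations of p reduce it to 3.\<close>
  then have H: "m mod 8 \<in> {1, 7} \<Longrightarrow> hurwitz_H_sum m 8 p = (real p + 1) / 6 + real_of_int E / 12"
    "m mod 8 \<in> {3, 5} \<Longrightarrow> hurwitz_H_sum m 8 p = (real p + 1) / 6 - real_of_int E / 12"
    using hurwitz_H_sum_eq_odd_part[OF p odd_m] odd_part_uminus[of p] by (auto simp: field_simps)
  have E1: "E = 4 * (chi_m4 x * x)" if "p mod 8 \<in> {1, 3}"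
    unfolding E_def by (rule sum_chi_m4_x2_2y2_prime[OF assms(1) p assms(3)[OF that]])
  have E0: "E = 0" if "p mod 8 \<in> {5, 7}"
  proof -
    have "x\<^sup>2 + 2 * y\<^sup>2 \<noteq> int p" for x y :: int using x2_2y2_mod_8[OF p, of x y] that by auto
    then have e: "{(y, x). x\<^sup>2 + 2 * y\<^sup>2 = int p} = ({} :: (int \<times> int) set)" by blast
    show ?thesis unfolding E_def e by simp
  qed
  show ?thesis using H E1 E0 by auto
qed

end
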